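(* A valued vector space $\mathcal{V}$ with variable base field $K$ and value set $(\Gamma,<)$ is NIP if and only if $K$ is NIP (and $\Gamma$ is NIP).
   Context: Valued vector space: $K$ is a field, $V$ a $K$-vector space, $(\Gamma,<,\infty)$ a totally ordered set with last element $\infty$, and $\mathrm{val}:V\to\Gamma$ a surjective map such that $\mathrm{val}(x)=\infty$ iff $x=0$, $\mathrm{val}(x-y)\ge\min(\mathrm{val}(x),\mathrm{val}(y))$, and $\mathrm{val}(kx)=\mathrm{val}(x)$ for all $k\in K\setminus\{0\}$, $x\in V$. It is considered as a three-sorted structure in the language $\{(V,+,0),(K,+,\cdot,0,1),(\Gamma,<,\infty),\mathrm{scal}:K\times V\to V,\mathrm{val}:V\to\Gamma\}$, where $\mathrm{scal}$ is scalar multiplication. $K$ is considered as a pure field, and $\Gamma$ with its induced structure, i.e. the order and the predicates $D_n=\{\gamma\in\Gamma\mid\dim_K(B_\gamma)=n\}$, $n\in\mathbb{N}$, where $B_\gamma=\{x\mid\mathrm{val}(x)\ge\gamma\}/\{x\mid\mathrm{val}(x)>\gamma\}$ and $B_\infty=\{0\}$. (The condition on $\Gamma$ is automatic for such a coloured linear order; it is kept because the statement is meant also for enrichments of $K$ and $\Gamma$.) *)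

theory Defs
  imports Complex_Main
begin

section \<open>Many-sorted first-order logic\<close>

text \<open>The set of symbols of a language is the domain of the partial maps below. A function symbol is
  declared with its argument sorts and its value sort.\<close>

record ('s, 'f, 'r) lang =
  fun_sig :: "'f \<Rightarrow> ('s list \<times> 's) option"
  rel_sig :: "'r \<Rightarrow> 's list option"

record ('s, 'f, 'r, 'a) struct =
  univ :: "'s \<Rightarrow> 'a set"
  fun_int :: "'f \<Rightarrow> 'a list \<Rightarrow> 'a"
  rel_int :: "'r \<Rightarrow> 'a list \<Rightarrow> bool"

text \<open>A variable is a pair of its sort and an index.\<close>

datatype ('s, 'f) tm = Var "'s \<times> nat" | Fn 'f "('s, 'f) tm list"

datatype ('s, 'f, 'r) fm =
    Eq "('s, 'f) tm" "('s, 'f) tm"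
  | Rel 'r "('s, 'f) tm list"
  | Neg "('s, 'f, 'r) fm"
  | Conj "('s, 'f, 'r) fm" "('s, 'f, 'r) fm"
  | Exi "'s \<times> nat" "('s, 'f, 'r) fm"

inductive tm_sort :: "('s, 'f, 'r) lang \<Rightarrow> ('s, 'f) tm \<Rightarrow> 's \<Rightarrow> bool" for L where
  "tm_sort L (Var (s, i)) s"
| "fun_sig L f = Some (ss, s) \<Longrightarrow> list_all2 (tm_sort L) ts ss \<Longrightarrow> tm_sort L (Fn f ts) s"

primrec wf_fm :: "('s, 'f, 'r) lang \<Rightarrow> ('s, 'f, 'r) fm \<Rightarrow> bool" where
  "wf_fm L (Eq t u) \<longleftrightarrow> (\<exists>s. tm_sort L t s \<and> tm_sort L u s)"
| "wf_fm L (Rel r ts) \<longleftrightarrow> (\<exists>ss. rel_sig L r = Some ss \<and> list_all2 (tm_sort L) ts ss)"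
| "wf_fm L (Neg p) \<longleftrightarrow> wf_fm L p"
| "wf_fm L (Conj p q) \<longleftrightarrow> wf_fm L p \<and> wf_fm L q"
| "wf_fm L (Exi v p) \<longleftrightarrow> wf_fm L p"

primrec eval_tm :: "('s, 'f, 'r, 'a) struct \<Rightarrow> ('s \<times> nat \<Rightarrow> 'a) \<Rightarrow> ('s, 'f) tm \<Rightarrow> 'a" where
  "eval_tm M e (Var v) = e v"
| "eval_tm M e (Fn f ts) = fun_int M f (map (eval_tm M e) ts)"

primrec sat :: "('s, 'f, 'r, 'a) struct \<Rightarrow> ('s \<times> nat \<Rightarrow> 'a) \<Rightarrow> ('s, 'f, 'r) fm \<Rightarrow> bool" where
  "sat M e (Eq t u) \<longleftrightarrow> eval_tm M e t = eval_tm M e u"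
| "sat M e (Rel r ts) \<longleftrightarrow> rel_int M r (map (eval_tm M e) ts)"
| "sat M e (Neg p) \<longleftrightarrow> \<not> sat M e p"
| "sat M e (Conj p q) \<longleftrightarrow> sat M e p \<and> sat M e q"
| "sat M e (Exi v p) \<longleftrightarrow> (\<exists>a\<in>univ M (fst v). sat M (e(v := a)) p)"

definition assignment :: "('s, 'f, 'r, 'a) struct \<Rightarrow> ('s \<times> nat \<Rightarrow> 'a) \<Rightarrow> bool" where
  "assignment M e \<longleftrightarrow> (\<forall>s i. e (s, i) \<in> univ M s)"

text \<open>A partitioned formula $\varphi(x;y)$ is a formula together with a set \<open>X\<close> of variables: $x$
  consists of the free variables in \<open>X\<close>, and $y$ of the remaining ones. It has the
  independence property if for every $n$ there are tuples $a_i$ for $i < n$ and $b_I$ for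
  $I \subseteq \{0,\dots,n-1\}$ such that $\varphi(a_i;b_I)$ holds iff $i \in I$. For fixed $n$ this is
  a first-order sentence, so the property only depends on the complete theory of \<open>M\<close>. Assignments
  are total, but only their values at the free variables of the formula matter.\<close>

definition has_IP ::
    "('s, 'f, 'r, 'a) struct \<Rightarrow> ('s, 'f, 'r) fm \<Rightarrow> ('s \<times> nat) set \<Rightarrow> bool" where
  "has_IP M \<phi> X \<longleftrightarrow>
    (\<forall>n. \<exists>(a :: nat \<Rightarrow> 's \<times> nat \<Rightarrow> 'a) (b :: nat set \<Rightarrow> 's \<times> nat \<Rightarrow> 'a).
       (\<forall>i<n. assignment M (a i)) \<and> (\<forall>I\<subseteq>{..<n}. assignment M (b I)) \<and>
       (\<forall>i<n. \<forall>I\<subseteq>{..<n}.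
          sat M (\<lambda>v. if v \<in> X then a i v else b I v) \<phi> \<longleftrightarrow> i \<in> I))"

definition NIP :: "('s, 'f, 'r) lang \<Rightarrow> ('s, 'f, 'r, 'a) struct \<Rightarrow> bool" where
  "NIP L M \<longleftrightarrow> (\<forall>\<phi> X. wf_fm L \<phi> \<longrightarrow> \<not> has_IP M \<phi> X)"


section \<open>Valued vector spaces\<close>

locale valued_vector_space = vector_space scale
  for scale :: "'k::field \<Rightarrow> 'v::ab_group_add \<Rightarrow> 'v" +
  fixes val :: "'v \<Rightarrow> 'g::{linorder, order_top}"
  assumes val_surj: "surj val"
    and val_eq_top_iff: "val x = top \<longleftrightarrow> x = 0"
    and val_diff: "min (val x) (val y) \<le> val (x - y)"
    and val_scale: "c \<noteq> 0 \<Longrightarrow> val (scale c x) = val x"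

text \<open>\<open>B val \<gamma>\<close> is the quotient of \<open>{x. \<gamma> \<le> val x}\<close> by \<open>{x. \<gamma> < val x}\<close>. The explicit 0
  only matters for the value \<open>top\<close>, where it yields the convention $B_\infty = \{0\}$.\<close>

definition res_class :: "('v::ab_group_add \<Rightarrow> 'g::{linorder, order_top}) \<Rightarrow> 'g \<Rightarrow> 'v \<Rightarrow> 'v set" where
  "res_class val \<gamma> x = {y. y - x \<in> insert 0 {z. \<gamma> < val z}}"

definition B :: "('v::ab_group_add \<Rightarrow> 'g::{linorder, order_top}) \<Rightarrow> 'g \<Rightarrow> 'v set set" where
  "B val \<gamma> = res_class val \<gamma> ` {x. \<gamma> \<le> val x}"

text \<open>The classes of the elements of \<open>S\<close> are pairwise distinct and form a basis of \<open>B val \<gamma>\<close>;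
  a linear combination of classes is the class of the linear combination of the representatives.\<close>

definition res_basis :: "('k::field \<Rightarrow> 'v::ab_group_add \<Rightarrow> 'v) \<Rightarrow>
    ('v \<Rightarrow> 'g::{linorder, order_top}) \<Rightarrow> 'g \<Rightarrow> 'v set \<Rightarrow> bool" where
  "res_basis scale val \<gamma> S \<longleftrightarrow>
    finite S \<and> S \<subseteq> {x. \<gamma> \<le> val x} \<and>
    (\<forall>\<beta>\<in>B val \<gamma>. \<exists>c. \<beta> = res_class val \<gamma> (\<Sum>s\<in>S. scale (c s) s)) \<and>
    (\<forall>c. res_class val \<gamma> (\<Sum>s\<in>S. scale (c s) s) = res_class val \<gamma> 0 \<longrightarrow> (\<forall>s\<in>S. c s = 0))"

definition D :: "('k::field \<Rightarrow> 'v::ab_group_add \<Rightarrow> 'v) \<Rightarrow>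
    ('v \<Rightarrow> 'g::{linorder, order_top}) \<Rightarrow> nat \<Rightarrow> 'g set" where
  "D scale val n = {\<gamma>. \<exists>S. res_basis scale val \<gamma> S \<and> card S = n}"


section \<open>The structures\<close>

text \<open>All three structures allow an arbitrary enrichment of the base field (symbols \<open>dom arK\<close> with
  arities \<open>arK\<close> and interpretation \<open>RK\<close>) and of the value set (\<open>arG\<close>, \<open>RG\<close>) by
  relations; additional functions and constants are covered through their graphs. The pure field and
  the value set with only its order and the predicates $D_n$ are the case where \<open>arK\<close> and \<open>arG\<close>
  are \<open>Map.empty\<close>.\<close>

subsection \<open>The base field\<close>

datatype field_fun = FAdd | FMul | FZero | FOne

primrec field_sig :: "field_fun \<Rightarrow> unit list \<times> unit" where
  "field_sig FAdd = ([(), ()], ())"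
| "field_sig FMul = ([(), ()], ())"
| "field_sig FZero = ([], ())"
| "field_sig FOne = ([], ())"

primrec field_int :: "field_fun \<Rightarrow> 'k::field list \<Rightarrow> 'k" where
  "field_int FAdd xs = xs ! 0 + xs ! 1"
| "field_int FMul xs = xs ! 0 * xs ! 1"
| "field_int FZero xs = 0"
| "field_int FOne xs = 1"

definition field_lang :: "('rk \<Rightarrow> nat option) \<Rightarrow> (unit, field_fun, 'rk) lang" where
  "field_lang arK =
    \<lparr>fun_sig = \<lambda>f. Some (field_sig f),
     rel_sig = \<lambda>r. map_option (\<lambda>n. replicate n ()) (arK r)\<rparr>"

definition field_struct ::
    "('rk \<Rightarrow> 'k::field list \<Rightarrow> bool) \<Rightarrow> (unit, field_fun, 'rk, 'k) struct" where
  "field_struct RK = \<lparr>univ = \<lambda>_. UNIV, fun_int = field_int, rel_int = RK\<rparr>"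

subsection \<open>The value set with its induced structure\<close>

datatype value_fun = GInf

datatype 'rg value_rel = GLess | GDim nat | GExtra 'rg

primrec value_rel_sig :: "('rg \<Rightarrow> nat option) \<Rightarrow> 'rg value_rel \<Rightarrow> unit list option" where
  "value_rel_sig arG GLess = Some [(), ()]"
| "value_rel_sig arG (GDim n) = Some [()]"
| "value_rel_sig arG (GExtra r) = map_option (\<lambda>n. replicate n ()) (arG r)"

primrec value_rel_int :: "('k::field \<Rightarrow> 'v::ab_group_add \<Rightarrow> 'v) \<Rightarrow>
    ('v \<Rightarrow> 'g::{linorder, order_top}) \<Rightarrow> ('rg \<Rightarrow> 'g list \<Rightarrow> bool) \<Rightarrow>
    'rg value_rel \<Rightarrow> 'g list \<Rightarrow> bool" where
  "value_rel_int scale val RG GLess xs \<longleftrightarrow> xs ! 0 < xs ! 1"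
| "value_rel_int scale val RG (GDim n) xs \<longleftrightarrow> xs ! 0 \<in> D scale val n"
| "value_rel_int scale val RG (GExtra r) xs \<longleftrightarrow> RG r xs"

definition value_lang :: "('rg \<Rightarrow> nat option) \<Rightarrow> (unit, value_fun, 'rg value_rel) lang" where
  "value_lang arG = \<lparr>fun_sig = \<lambda>_. Some ([], ()), rel_sig = value_rel_sig arG\<rparr>"

definition value_struct :: "('k::field \<Rightarrow> 'v::ab_group_add \<Rightarrow> 'v) \<Rightarrow>
    ('v \<Rightarrow> 'g::{linorder, order_top}) \<Rightarrow> ('rg \<Rightarrow> 'g list \<Rightarrow> bool) \<Rightarrow>
    (unit, value_fun, 'rg value_rel, 'g) struct" where
  "value_struct scale val RG =
    \<lparr>univ = \<lambda>_. UNIV, fun_int = \<lambda>_ _. top, rel_int = value_rel_int scale val RG\<rparr>"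

subsection \<open>The three-sorted valued vector space\<close>

datatype vvs_sort = SK | SV | SG

datatype ('k, 'v, 'g) elem = InK (the_K: 'k) | InV (the_V: 'v) | InG (the_G: 'g)

datatype vvs_fun = VAdd | VZero | KAdd | KMul | KZero | KOne | Inf | Scal | Val

datatype ('rk, 'rg) vvs_rel = Less | ExtraK 'rk | ExtraG 'rg

primrec vvs_fun_sig :: "vvs_fun \<Rightarrow> vvs_sort list \<times> vvs_sort" where
  "vvs_fun_sig VAdd = ([SV, SV], SV)"
| "vvs_fun_sig VZero = ([], SV)"
| "vvs_fun_sig KAdd = ([SK, SK], SK)"
| "vvs_fun_sig KMul = ([SK, SK], SK)"
| "vvs_fun_sig KZero = ([], SK)"
| "vvs_fun_sig KOne = ([], SK)"
| "vvs_fun_sig Inf = ([], SG)"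
| "vvs_fun_sig Scal = ([SK, SV], SV)"
| "vvs_fun_sig Val = ([SV], SG)"

primrec vvs_rel_sig :: "('rk \<Rightarrow> nat option) \<Rightarrow> ('rg \<Rightarrow> nat option) \<Rightarrow>
    ('rk, 'rg) vvs_rel \<Rightarrow> vvs_sort list option" where
  "vvs_rel_sig arK arG Less = Some [SG, SG]"
| "vvs_rel_sig arK arG (ExtraK r) = map_option (\<lambda>n. replicate n SK) (arK r)"
| "vvs_rel_sig arK arG (ExtraG r) = map_option (\<lambda>n. replicate n SG) (arG r)"

primrec vvs_univ :: "vvs_sort \<Rightarrow> ('k, 'v, 'g) elem set" where
  "vvs_univ SK = range InK"
| "vvs_univ SV = range InV"
| "vvs_univ SG = range InG"

primrec vvs_fun_int :: "('k::field \<Rightarrow> 'v::ab_group_add \<Rightarrow> 'v) \<Rightarrow>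
    ('v \<Rightarrow> 'g::{linorder, order_top}) \<Rightarrow> vvs_fun \<Rightarrow> ('k, 'v, 'g) elem list \<Rightarrow> ('k, 'v, 'g) elem" where
  "vvs_fun_int scale val VAdd xs = InV (the_V (xs ! 0) + the_V (xs ! 1))"
| "vvs_fun_int scale val VZero xs = InV 0"
| "vvs_fun_int scale val KAdd xs = InK (the_K (xs ! 0) + the_K (xs ! 1))"
| "vvs_fun_int scale val KMul xs = InK (the_K (xs ! 0) * the_K (xs ! 1))"
| "vvs_fun_int scale val KZero xs = InK 0"
| "vvs_fun_int scale val KOne xs = InK 1"
| "vvs_fun_int scale val Inf xs = InG top"
| "vvs_fun_int scale val Scal xs = InV (scale (the_K (xs ! 0)) (the_V (xs ! 1)))"
| "vvs_fun_int scale val Val xs = InG (val (the_V (xs ! 0)))"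

primrec vvs_rel_int :: "('rk \<Rightarrow> 'k list \<Rightarrow> bool) \<Rightarrow> ('rg \<Rightarrow> 'g::linorder list \<Rightarrow> bool) \<Rightarrow>
    ('rk, 'rg) vvs_rel \<Rightarrow> ('k, 'v, 'g) elem list \<Rightarrow> bool" where
  "vvs_rel_int RK RG Less xs \<longleftrightarrow> the_G (xs ! 0) < the_G (xs ! 1)"
| "vvs_rel_int RK RG (ExtraK r) xs \<longleftrightarrow> RK r (map the_K xs)"
| "vvs_rel_int RK RG (ExtraG r) xs \<longleftrightarrow> RG r (map the_G xs)"

definition vvs_lang :: "('rk \<Rightarrow> nat option) \<Rightarrow> ('rg \<Rightarrow> nat option) \<Rightarrow>
    (vvs_sort, vvs_fun, ('rk, 'rg) vvs_rel) lang" where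
  "vvs_lang arK arG = \<lparr>fun_sig = \<lambda>f. Some (vvs_fun_sig f), rel_sig = vvs_rel_sig arK arG\<rparr>"

definition vvs_struct :: "('k::field \<Rightarrow> 'v::ab_group_add \<Rightarrow> 'v) \<Rightarrow>
    ('v \<Rightarrow> 'g::{linorder, order_top}) \<Rightarrow> ('rk \<Rightarrow> 'k list \<Rightarrow> bool) \<Rightarrow> ('rg \<Rightarrow> 'g list \<Rightarrow> bool) \<Rightarrow>
    (vvs_sort, vvs_fun, ('rk, 'rg) vvs_rel, ('k, 'v, 'g) elem) struct" where
  "vvs_struct scale val RK RG =
    \<lparr>univ = vvs_univ, fun_int = vvs_fun_int scale val, rel_int = vvs_rel_int RK RG\<rparr>"

end

(* Truth of a formula at a tuple of vectors depends only on the isometry type of the tuple. A tuple in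
   a finite-dimensional subspace is coded by its coordinates (in K) with respect to a
   valuation-independent basis and by the values (in the value set) of the basis vectors. A quantifier
   over vectors becomes one over the coordinates and over the value of a single new basis vector, and a
   new vector of value \<gamma> exists unless \<gamma> lies in D_n for n the number of basis vectors of value \<gamma>.
   So every formula is a finite union of products of a formula of K and a formula of the value set.

   For NIP, count the traces that the parameters b leave on finite sets of points. If b has no
   vectors, the product decomposition and the Sauer-Shelah bound for K and the value set give
   polynomial growth. A vector x in b is removed by taking, among the spans of all the points of the
   finite set, the best approximation w of x: over every single point, x has the same type as a
   generic vector at distance val (x - w) from w. This replaces x by elements of K and of the value set
   and by one of the points, and multiplies the number of traces only by the number of points. *)
theory Submission
  imports Defs "HOL-Library.Nat_Bijection"
begin

section \<open>Polynomial growth and the independence property\<close>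

text \<open>Counting traces on finite sets keeps the argument inside the given structure, without
  passing to a saturated extension. The obstacle is a vector parameter: a best approximation of it
  from an infinite-dimensional subspace may not exist, so its position relative to all points at
  once cannot be recorded. Over finitely many points only finitely many finite-dimensional spans
  compete, so a best approximation exists; but which point provides it depends on the parameter, so
  that point has to be adjoined to all the others. This raises the degree of the growth bound by one
  for each vector parameter.

  Valuation-independent families may contain zero vectors. Their length is then the number of vector
  variables, whether or not the vectors are linearly dependent, and one translation serves all
  assignments. In return, the value infinity is always admissible for a new basis vector, whatever
  the predicates \<open>D\<close> say there.\<close>

definition merge :: "'v set \<Rightarrow> ('v \<Rightarrow> 'a) \<Rightarrow> ('v \<Rightarrow> 'a) \<Rightarrow> 'v \<Rightarrow> 'a" where
  "merge X a b = (\<lambda>v. if v \<in> X then a v else b v)"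

text \<open>A single exponent is the only datum: the summand 1 keeps the bound valid for empty
  \<open>A\<close>, and products of bounds add exponents.\<close>

definition poly_growth :: "'p set \<Rightarrow> 'q set \<Rightarrow> ('p \<Rightarrow> 'q \<Rightarrow> bool) \<Rightarrow> bool" where
  "poly_growth P Q R \<longleftrightarrow>
    (\<exists>d. \<forall>A. finite A \<longrightarrow> A \<subseteq> P \<longrightarrow> card ((\<lambda>b. {a \<in> A. R a b}) ` Q) \<le> (card A + 1) ^ d)"

lemma has_IP_iff_merge:
  "has_IP M \<phi> X \<longleftrightarrow>
    (\<forall>n::nat. \<exists>a b. (\<forall>i<n. assignment M (a i)) \<and> (\<forall>I\<subseteq>{..<n}. assignment M (b I)) \<and>
       (\<forall>i<n. \<forall>I\<subseteq>{..<n}. sat M (merge X (a i) (b I)) \<phi> \<longleftrightarrow> i \<in> I))"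
  by (simp only: has_IP_def merge_def)

section \<open>The Sauer-Shelah lemma, and polynomial growth as the negation of the independence
  property\<close>

lemma finite_traces: "finite A \<Longrightarrow> finite ((\<lambda>b. {a \<in> A. R a b}) ` Q)"
  by (rule finite_subset[of _ "Pow A"]) auto

text \<open>Splitting at \<open>x\<close>, the cardinalities of \<open>G\<close> and
  \<open>H\<close> add up to those of \<open>G \<union> H\<close> and \<open>G \<inter> H\<close>. A
  set shattered by \<open>G \<union> H\<close> is shattered by \<open>F\<close>, and one shattered
  by \<open>G \<inter> H\<close> stays shattered by \<open>F\<close> after inserting
  \<open>x\<close>, since both choices at \<open>x\<close> are available. This is Pajor's form of
  the Sauer-Shelah lemma.\<close>

lemma pajor:
  assumes "finite A" "F \<subseteq> Pow A"
  shows "card F \<le> card {S. S \<subseteq> A \<and> (\<forall>T\<subseteq>S. \<exists>f\<in>F. f \<inter> S = T)}"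
  using assms
proof (induction A arbitrary: F rule: finite_induct)
  case empty
  then have "F = {} \<or> F = {{}}" by auto
  then show ?case
  proof
    assume "F = {{}}"
    then have "{S. S \<subseteq> {} \<and> (\<forall>T\<subseteq>S. \<exists>f\<in>F. f \<inter> S = T)} = {{}}" by auto
    then show ?thesis using \<open>F = {{}}\<close> by simp
  qed simp
next
  case (insert x A)
  define G where "G = {f \<in> F. x \<notin> f}"
  define H where "H = {f. x \<notin> f \<and> insert x f \<in> F}"
  let ?sh = "\<lambda>A F. {S. S \<subseteq> A \<and> (\<forall>T\<subseteq>S. \<exists>f\<in>F. f \<inter> S = T)}"
  have GA: "G \<subseteq> Pow A" and HA: "H \<subseteq> Pow A"
    using insert.prems by (auto simp: G_def H_def)
  have fin: "finite G" "finite H"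
    using GA HA insert.hyps by (auto intro: finite_subset[where B = "Pow A"])
  have FGH: "F = G \<union> insert x ` H"
  proof
    show "F \<subseteq> G \<union> insert x ` H"
    proof
      fix f assume f: "f \<in> F"
      show "f \<in> G \<union> insert x ` H"
      proof (cases "x \<in> f")
        case True
        then have "f = insert x (f - {x})" "f - {x} \<in> H" using f by (auto simp: H_def insert_absorb)
        then show ?thesis by blast
      qed (use f in \<open>auto simp: G_def\<close>)
    qed
  qed (auto simp: G_def H_def)
  have inj: "inj_on (insert x) H" by (auto simp: inj_on_def H_def)
  have "card F = card G + card (insert x ` H)"
    unfolding FGH by (rule card_Un_disjoint) (use fin in \<open>auto simp: G_def\<close>)
  also have "\<dots> = card G + card H" by (simp add: card_image inj)
  also have "\<dots> = card (G \<union> H) + card (G \<inter> H)" by (rule card_Un_Int) (use fin in auto)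
  also have "\<dots> \<le> card (?sh A (G \<union> H)) + card (?sh A (G \<inter> H))"
    using insert.IH[of "G \<union> H"] insert.IH[of "G \<inter> H"] GA HA by (intro add_mono) auto
  also have "card (?sh A (G \<inter> H)) = card (insert x ` ?sh A (G \<inter> H))"
  proof (rule card_image[symmetric])
    show "inj_on (insert x) (?sh A (G \<inter> H))"
      by (rule inj_on_subset[of _ "Pow A"]) (use insert.hyps in \<open>auto simp: inj_on_def insert_ident\<close>)
  qed
  also have "card (?sh A (G \<union> H)) + card (insert x ` ?sh A (G \<inter> H)) =
      card (?sh A (G \<union> H) \<union> insert x ` ?sh A (G \<inter> H))"
  proof (rule card_Un_disjoint[symmetric])
    have "?sh A (G \<union> H) \<subseteq> Pow A" by (rule subsetI) simp
    then show "?sh A (G \<union> H) \<inter> insert x ` ?sh A (G \<inter> H) = {}"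
      using \<open>x \<notin> A\<close> by (intro equals0I) (auto simp only: Pow_iff)
  qed (simp_all add: insert.hyps)
  also have "\<dots> \<le> card (?sh (insert x A) F)"
  proof (rule card_mono)
    show "finite (?sh (insert x A) F)" using insert.hyps by simp
    have 1: "\<exists>f\<in>F. f \<inter> S = T"
      if "S \<subseteq> A" and sh: "\<And>T. T \<subseteq> S \<Longrightarrow> \<exists>f\<in>G \<union> H. f \<inter> S = T" and "T \<subseteq> S" for S T
    proof -
      obtain f where f: "f \<in> G \<union> H" "f \<inter> S = T" using sh[OF \<open>T \<subseteq> S\<close>] by blast
      then have "f \<in> F \<or> insert x f \<in> F" by (auto simp: G_def H_def)
      moreover have "insert x f \<inter> S = T" using f \<open>S \<subseteq> A\<close> insert.hyps by auto
      ultimately show ?thesis using f by blast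
    qed
    have 2: "\<exists>f\<in>F. f \<inter> insert x S = T"
      if "S \<subseteq> A" and sh: "\<And>T. T \<subseteq> S \<Longrightarrow> \<exists>f\<in>G \<inter> H. f \<inter> S = T" and "T \<subseteq> insert x S" for S T
    proof -
      have "T - {x} \<subseteq> S" using that by auto
      from sh[OF this] obtain f where f: "f \<in> G" "f \<in> H" "f \<inter> S = T - {x}" by blast
      show ?thesis
      proof (cases "x \<in> T")
        case True
        then have "insert x f \<inter> insert x S = T" using f by auto
        moreover have "insert x f \<in> F" using f by (simp add: H_def)
        ultimately show ?thesis by blast
      next
        case False
        then have "f \<inter> insert x S = T" using f by (auto simp: H_def)
        moreover have "f \<in> F" using f by (simp add: G_def)
        ultimately show ?thesis by blast
      qed
    qed
    have "?sh A (G \<union> H) \<subseteq> ?sh (insert x A) F" using 1 by (auto simp only: mem_Collect_eq)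
    moreover have "insert x ` ?sh A (G \<inter> H) \<subseteq> ?sh (insert x A) F"
      using 2 by (auto simp only: mem_Collect_eq image_subset_iff)
    ultimately show "?sh A (G \<union> H) \<union> insert x ` ?sh A (G \<inter> H) \<subseteq> ?sh (insert x A) F"
      by (rule Un_least)
  qed
  finally show ?case .
qed

text \<open>A nonempty set with fewer than \<open>Suc n\<close> elements arises from one with fewer
  than \<open>n\<close> by inserting at most one element, which leaves \<open>card A + 1\<close>
  choices.\<close>

lemma card_small_subsets:
  assumes "finite A"
  shows "card {S. S \<subseteq> A \<and> card S < n} \<le> (card A + 1) ^ n"
proof (induction n)
  case (Suc n)
  let ?s = "\<lambda>n. {S. S \<subseteq> A \<and> card S < n}"
  let ?f = "\<lambda>(x, S). case x of None \<Rightarrow> S | Some a \<Rightarrow> insert a S"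
  have finO: "finite (insert None (Some ` A))" using assms by simp
  have "?s (Suc n) \<subseteq> insert {} (?f ` (insert None (Some ` A) \<times> ?s n))"
  proof
    fix S assume S: "S \<in> ?s (Suc n)"
    show "S \<in> insert {} (?f ` (insert None (Some ` A) \<times> ?s n))"
    proof (cases "S = {}")
      case False
      then obtain a where a: "a \<in> S" by auto
      have "finite S" using S assms finite_subset by auto
      then have "card (S - {a}) < n" using S a card_gt_0_iff[of S] by auto
      then have "(Some a, S - {a}) \<in> insert None (Some ` A) \<times> ?s n" using S a by auto
      moreover have "S = ?f (Some a, S - {a})" using a by auto
      ultimately show ?thesis by blast
    qed simp
  qed
  then have sub: "?s (Suc n) \<subseteq> insert {} (?f ` (insert None (Some ` A) \<times> ?s n))" .
  show ?case
  proof (cases n)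
    case 0
    have "S = {}" if "S \<subseteq> A" "card S < Suc n" for S
      using that finite_subset[OF that(1) assms] by (simp add: 0)
    then have "?s (Suc n) \<subseteq> {{}}" by blast
    then have "card (?s (Suc n)) \<le> 1" using card_mono[of "{{}}" "?s (Suc n)"] by simp
    then show ?thesis by (simp add: 0)
  next
    case (Suc m)
    have "{} = ?f (None, {})" by simp
    moreover have "(None, {}) \<in> insert None (Some ` A) \<times> ?s n" using Suc by simp
    ultimately have "{} \<in> ?f ` (insert None (Some ` A) \<times> ?s n)" by (rule image_eqI)
    then have "?s (Suc n) \<subseteq> ?f ` (insert None (Some ` A) \<times> ?s n)" using sub by (simp add: insert_absorb)
    then have "card (?s (Suc n)) \<le> card (?f ` (insert None (Some ` A) \<times> ?s n))"
      by (intro card_mono finite_imageI finite_cartesian_product finO) (use assms in auto)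
    also have "\<dots> \<le> card (insert None (Some ` A) \<times> ?s n)"
      by (intro card_image_le finite_cartesian_product finO) (use assms in auto)
    also have "\<dots> = (card A + 1) * card (?s n)"
      using assms by (simp add: card_cartesian_product card_image card_insert_if)
    also have "\<dots> \<le> (card A + 1) * (card A + 1) ^ n" using Suc.IH by (rule mult_left_mono) simp
    finally show ?thesis by simp
  qed
qed simp

text \<open>If \<open>n\<close> points are never shattered, the traces on \<open>A\<close> shatter
  only sets with fewer than \<open>n\<close> elements, and by Pajor's inequality there are no more
  traces than such sets. The exponent is this \<open>n\<close>.\<close>

lemma not_IP_poly_growth:
  assumes "\<not> has_IP M \<phi> X"
  shows "poly_growth (Collect (assignment M)) (Collect (assignment M)) (\<lambda>a b. sat M (merge X a b) \<phi>)"
proof -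
  let ?A = "Collect (assignment M)"
  let ?R = "\<lambda>a b. sat M (merge X a b) \<phi>"
  obtain n :: nat where n: "\<not> (\<exists>a b. (\<forall>i<n. assignment M (a i)) \<and> (\<forall>I\<subseteq>{..<n}. assignment M (b I)) \<and>
       (\<forall>i<n. \<forall>I\<subseteq>{..<n}. sat M (merge X (a i) (b I)) \<phi> \<longleftrightarrow> i \<in> I))"
    using assms unfolding has_IP_iff_merge not_all by (rule exE)
  have "card ((\<lambda>b. {a \<in> A. ?R a b}) ` ?A) \<le> (card A + 1) ^ n" if A: "finite A" "A \<subseteq> ?A" for A
  proof -
    let ?F = "(\<lambda>b. {a \<in> A. ?R a b}) ` ?A"
    let ?S = "{S. S \<subseteq> A \<and> (\<forall>T\<subseteq>S. \<exists>f\<in>?F. f \<inter> S = T)}"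
    have small: "card S < n" if S: "S \<in> ?S" for S
    proof (rule ccontr)
      assume "\<not> card S < n"
      then obtain S' where S': "S' \<subseteq> S" "card S' = n" by (meson not_less obtain_subset_with_card_n)
      have SA: "S \<subseteq> A" and sh: "\<And>T. T \<subseteq> S \<Longrightarrow> \<exists>f\<in>?F. f \<inter> S = T" using S by simp_all
      have "finite S'" using S'(1) SA A(1) by (meson finite_subset)
      then obtain a where a: "bij_betw a {..<n} S'"
        using S' by (metis atLeast0LessThan ex_bij_betw_nat_finite)
      have ex: "\<exists>b. assignment M b \<and> (\<forall>i<n. ?R (a i) b \<longleftrightarrow> i \<in> I)" if I: "I \<subseteq> {..<n}" for I
      proof -
        have "a ` I \<subseteq> S" using I a S' by (auto simp: bij_betw_def)
        from sh[OF this] obtain b where b: "assignment M b" "{a \<in> A. ?R a b} \<inter> S = a ` I" by auto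
        have "?R (a i) b \<longleftrightarrow> i \<in> I" if i: "i < n" for i
        proof -
          have ai: "a i \<in> S" using i a S' by (auto simp: bij_betw_def)
          then have "?R (a i) b \<longleftrightarrow> a i \<in> {a \<in> A. ?R a b} \<inter> S" using SA by auto
          also have "\<dots> \<longleftrightarrow> a i \<in> a ` I" by (simp only: b(2))
          also have "\<dots> \<longleftrightarrow> i \<in> I"
            using a I i by (auto simp: bij_betw_def inj_on_def)
          finally show ?thesis .
        qed
        then show ?thesis using b by blast
      qed
      define b where "b I = (SOME b. assignment M b \<and> (\<forall>i<n. ?R (a i) b \<longleftrightarrow> i \<in> I))" for I
      have "assignment M (b I) \<and> (\<forall>i<n. ?R (a i) (b I) \<longleftrightarrow> i \<in> I)" if "I \<subseteq> {..<n}" for I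
        using someI_ex[OF ex[OF that]] unfolding b_def .
      moreover have "assignment M (a i)" if "i < n" for i
        using bij_betwE[OF a] that S'(1) SA A(2) by blast
      ultimately have "\<exists>a b. (\<forall>i<n. assignment M (a i)) \<and> (\<forall>I\<subseteq>{..<n}. assignment M (b I)) \<and>
          (\<forall>i<n. \<forall>I\<subseteq>{..<n}. ?R (a i) (b I) \<longleftrightarrow> i \<in> I)"
        by (intro exI[of _ a] exI[of _ b]) simp
      with n show False by (rule notE)
    qed
    have "card ?F \<le> card ?S" by (rule pajor) (use A in auto)
    also have "\<dots> \<le> card {S. S \<subseteq> A \<and> card S < n}"
      by (rule card_mono) (use A small in auto)
    also have "\<dots> \<le> (card A + 1) ^ n" by (rule card_small_subsets) (rule A)
    finally show ?thesis .
  qed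
  then show ?thesis unfolding poly_growth_def by blast
qed

lemma ex_power_less_two_power: "\<exists>n::nat. (n + 1) ^ d < 2 ^ n"
proof -
  have *: "m * m < (2::nat) ^ (m + 2)" for m
  proof (induction m)
    case (Suc m)
    have "m < (2::nat) ^ m" by (rule less_exp)
    then have "2 * m + 1 < 4 * 2 ^ m" by linarith
    then show ?case using Suc by simp
  qed simp
  \<comment> \<open>With \<open>n = 2 ^ m - 1\<close> the left side becomes
    \<open>2 ^ (m * d)\<close>, so \<open>m * d < 2 ^ m - 1\<close> suffices. The summand 6 makes
    \<open>m * d + 1\<close> smaller than \<open>(d + 4) * (d + 4)\<close>, which is below
    \<open>2 ^ (d + 6)\<close>.\<close>
  define m where "m = d + 6"
  have "m * d + 1 < 2 ^ m"
  proof -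
    have "(d + 4) * (d + 4) < (2::nat) ^ m" using *[of "d + 4"] by (simp add: m_def add.commute)
    then show ?thesis by (simp add: m_def algebra_simps)
  qed
  then have "m * d < 2 ^ m - 1" by simp
  then have "((2 ^ m - 1 + 1)::nat) ^ d < 2 ^ (2 ^ m - 1)"
    by (simp add: power_mult[symmetric])
  then show ?thesis by blast
qed

lemma poly_growth_not_IP:
  assumes "poly_growth (Collect (assignment M)) (Collect (assignment M)) (\<lambda>a b. sat M (merge X a b) \<phi>)"
  shows "\<not> has_IP M \<phi> X"
proof
  assume IP: "has_IP M \<phi> X"
  let ?A = "Collect (assignment M)"
  let ?R = "\<lambda>a b. sat M (merge X a b) \<phi>"
  obtain d where d: "\<And>A. finite A \<Longrightarrow> A \<subseteq> ?A \<Longrightarrow> card ((\<lambda>b. {a \<in> A. ?R a b}) ` ?A) \<le> (card A + 1) ^ d"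
    using assms unfolding poly_growth_def by blast
  obtain n :: nat where n: "(n + 1) ^ d < 2 ^ n" using ex_power_less_two_power by blast
  obtain a b where *: "(\<forall>i<n. assignment M (a i)) \<and> (\<forall>I\<subseteq>{..<n}. assignment M (b I)) \<and>
      (\<forall>i<n. \<forall>I\<subseteq>{..<n}. ?R (a i) (b I) \<longleftrightarrow> i \<in> I)"
    using spec[OF IP[unfolded has_IP_iff_merge], of n] by (elim exE) (rule that)
  have a: "\<And>i. i < n \<Longrightarrow> assignment M (a i)"
    and b: "\<And>I. I \<subseteq> {..<n} \<Longrightarrow> assignment M (b I)"
    and ab: "\<And>i I. i < n \<Longrightarrow> I \<subseteq> {..<n} \<Longrightarrow> ?R (a i) (b I) \<longleftrightarrow> i \<in> I"
    using * by simp_all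
  define A where "A = a ` {..<n}"
  have A: "finite A" "A \<subseteq> ?A" using a by (auto simp: A_def)
  let ?t = "\<lambda>b. {a \<in> A. ?R a b}"
  have "inj_on (\<lambda>I. ?t (b I)) (Pow {..<n})"
  proof (rule inj_onI)
    fix I J assume IJ: "I \<in> Pow {..<n}" "J \<in> Pow {..<n}" and eq: "?t (b I) = ?t (b J)"
    have "i \<in> I \<longleftrightarrow> i \<in> J" if "i < n" for i
    proof -
      have "a i \<in> ?t (b I) \<longleftrightarrow> a i \<in> ?t (b J)" using eq by simp
      then show ?thesis using ab that IJ by (auto simp: A_def)
    qed
    then show "I = J" using IJ by auto
  qed
  then have "2 ^ n = card ((\<lambda>I. ?t (b I)) ` Pow {..<n})" by (simp add: card_image card_Pow)
  also have "\<dots> \<le> card (?t ` ?A)"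
    by (rule card_mono[OF finite_traces[OF A(1)]]) (use b in auto)
  also have "\<dots> \<le> (card A + 1) ^ d" by (rule d[OF A])
  also have "\<dots> \<le> (n + 1) ^ d"
    by (rule power_mono) (use card_image_le[of "{..<n}" a] in \<open>auto simp: A_def\<close>)
  finally show False using n by simp
qed

section \<open>Closure properties of polynomial growth\<close>

lemma poly_growth_pull:
  assumes R: "poly_growth P Q R"
    and \<kappa>: "\<And>a. a \<in> P' \<Longrightarrow> \<kappa> a \<in> P" and \<mu>: "\<And>b. b \<in> Q' \<Longrightarrow> \<mu> b \<in> Q"
    and eq: "\<And>a b. a \<in> P' \<Longrightarrow> b \<in> Q' \<Longrightarrow> R' a b = R (\<kappa> a) (\<mu> b)"
  shows "poly_growth P' Q' R'"
proof -
  obtain d where d: "\<And>A. finite A \<Longrightarrow> A \<subseteq> P \<Longrightarrow> card ((\<lambda>b. {a \<in> A. R a b}) ` Q) \<le> (card A + 1) ^ d"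
    using R unfolding poly_growth_def by blast
  have "card ((\<lambda>b. {a \<in> A. R' a b}) ` Q') \<le> (card A + 1) ^ d" if A: "finite A" "A \<subseteq> P'" for A
  proof -
    let ?T = "(\<lambda>b. {a \<in> \<kappa> ` A. R a b}) ` Q"
    have "(\<lambda>b. {a \<in> A. R' a b}) ` Q' \<subseteq> (\<lambda>T. {a \<in> A. \<kappa> a \<in> T}) ` ?T"
    proof
      fix t assume "t \<in> (\<lambda>b. {a \<in> A. R' a b}) ` Q'"
      then obtain b where b: "b \<in> Q'" "t = {a \<in> A. R' a b}" by blast
      then have "t = {a \<in> A. \<kappa> a \<in> {a \<in> \<kappa> ` A. R a (\<mu> b)}}" using A eq by auto
      moreover have "{a \<in> \<kappa> ` A. R a (\<mu> b)} \<in> ?T" using \<mu>[OF b(1)] by (rule imageI)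
      ultimately show "t \<in> (\<lambda>T. {a \<in> A. \<kappa> a \<in> T}) ` ?T" by (rule image_eqI)
    qed
    then have "card ((\<lambda>b. {a \<in> A. R' a b}) ` Q') \<le> card ((\<lambda>T. {a \<in> A. \<kappa> a \<in> T}) ` ?T)"
      by (rule card_mono[rotated]) (intro finite_imageI finite_traces A(1))
    also have "\<dots> \<le> card ?T" by (rule card_image_le) (intro finite_imageI finite_traces A(1))
    also have "\<dots> \<le> (card (\<kappa> ` A) + 1) ^ d" by (rule d) (use A \<kappa> in auto)
    also have "\<dots> \<le> (card A + 1) ^ d" by (rule power_mono) (use A card_image_le in auto)
    finally show ?thesis .
  qed
  then show ?thesis unfolding poly_growth_def by blast
qed

lemma poly_growth_const: "poly_growth P Q (\<lambda>a b. c)"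
proof -
  have "card ((\<lambda>b::'b. {a \<in> A. c}) ` Q) \<le> (card A + 1) ^ 0" for A :: "'a set"
    by (cases "Q = {}") (simp_all add: image_constant_conv)
  then show ?thesis unfolding poly_growth_def by blast
qed

text \<open>The trace of a Boolean combination is determined by the pair of traces, so the exponents
  add.\<close>

lemma poly_growth_comb:
  assumes "poly_growth P Q R" "poly_growth P Q R'"
  shows "poly_growth P Q (\<lambda>a b. f (R a b) (R' a b))"
proof -
  obtain d where d: "\<And>A. finite A \<Longrightarrow> A \<subseteq> P \<Longrightarrow> card ((\<lambda>b. {a \<in> A. R a b}) ` Q) \<le> (card A + 1) ^ d"
    using assms(1) unfolding poly_growth_def by blast
  obtain d' where d': "\<And>A. finite A \<Longrightarrow> A \<subseteq> P \<Longrightarrow> card ((\<lambda>b. {a \<in> A. R' a b}) ` Q) \<le> (card A + 1) ^ d'"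
    using assms(2) unfolding poly_growth_def by blast
  have "card ((\<lambda>b. {a \<in> A. f (R a b) (R' a b)}) ` Q) \<le> (card A + 1) ^ (d + d')"
    if A: "finite A" "A \<subseteq> P" for A
  proof -
    let ?T = "(\<lambda>b. {a \<in> A. R a b}) ` Q" and ?T' = "(\<lambda>b. {a \<in> A. R' a b}) ` Q"
    let ?g = "\<lambda>(t, t'). {a \<in> A. f (a \<in> t) (a \<in> t')}"
    have fin: "finite (?T \<times> ?T')" by (intro finite_cartesian_product finite_traces A(1))
    have "(\<lambda>b. {a \<in> A. f (R a b) (R' a b)}) ` Q \<subseteq> ?g ` (?T \<times> ?T')"
    proof
      fix t assume "t \<in> (\<lambda>b. {a \<in> A. f (R a b) (R' a b)}) ` Q"
      then obtain b where b: "b \<in> Q" "t = {a \<in> A. f (R a b) (R' a b)}" by blast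
      then have "t = ?g ({a \<in> A. R a b}, {a \<in> A. R' a b})" by auto
      moreover have "({a \<in> A. R a b}, {a \<in> A. R' a b}) \<in> ?T \<times> ?T'" using b by simp
      ultimately show "t \<in> ?g ` (?T \<times> ?T')" by (rule image_eqI)
    qed
    then have "card ((\<lambda>b. {a \<in> A. f (R a b) (R' a b)}) ` Q) \<le> card (?g ` (?T \<times> ?T'))"
      by (rule card_mono[rotated]) (intro finite_imageI fin)
    also have "\<dots> \<le> card (?T \<times> ?T')" by (rule card_image_le[OF fin])
    also have "\<dots> \<le> (card A + 1) ^ d * (card A + 1) ^ d'"
      unfolding card_cartesian_product by (rule mult_mono) (use d d' A in auto)
    finally show ?thesis by (simp add: power_add)
  qed
  then show ?thesis unfolding poly_growth_def by blast
qed

lemma poly_growth_bex: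
  assumes "finite S" "\<And>s. s \<in> S \<Longrightarrow> poly_growth P Q (R s)"
  shows "poly_growth P Q (\<lambda>a b. \<exists>s\<in>S. R s a b)"
  using assms
proof (induction S rule: finite_induct)
  case empty
  show ?case using poly_growth_const[of P Q False] by simp
next
  case (insert s S)
  then have "poly_growth P Q (\<lambda>a b. R s a b \<or> (\<exists>s\<in>S. R s a b))"
    by (intro poly_growth_comb[where f = "(\<or>)"]) simp_all
  then show ?case by simp
qed

text \<open>The map on points may depend on an element \<open>l\<close> of \<open>A\<close> that is
  chosen after \<open>b\<close>; summing the trace counts over all \<open>l\<close> costs one factor
  \<open>card A\<close>. This is the form in which a best approximation, contained in the span of
  one of the points, can be used.\<close>

lemma poly_growth_choose:
  assumes R': "poly_growth P' Q' R'"
    and h: "\<And>a l. a \<in> P \<Longrightarrow> l \<in> P \<Longrightarrow> h a l \<in> P'"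
    and eq: "\<And>A b. finite A \<Longrightarrow> A \<noteq> {} \<Longrightarrow> A \<subseteq> P \<Longrightarrow> b \<in> Q \<Longrightarrow>
      \<exists>l\<in>A. \<exists>b'\<in>Q'. \<forall>a\<in>A. R a b = R' (h a l) b'"
  shows "poly_growth P Q R"
proof -
  obtain d where d: "\<And>A. finite A \<Longrightarrow> A \<subseteq> P' \<Longrightarrow> card ((\<lambda>b. {a \<in> A. R' a b}) ` Q') \<le> (card A + 1) ^ d"
    using R' unfolding poly_growth_def by blast
  have "card ((\<lambda>b. {a \<in> A. R a b}) ` Q) \<le> (card A + 1) ^ (Suc d)" if A: "finite A" "A \<subseteq> P" for A
  proof (cases "A = {}")
    case True
    then show ?thesis by (cases "Q = {}") (simp_all add: image_constant_conv)
  next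
    case False
    let ?T = "\<lambda>l. (\<lambda>b'. {a \<in> (\<lambda>a. h a l) ` A. R' a b'}) ` Q'"
    let ?g = "\<lambda>l t. {a \<in> A. h a l \<in> t}"
    have "(\<lambda>b. {a \<in> A. R a b}) ` Q \<subseteq> (\<Union>l\<in>A. ?g l ` ?T l)"
    proof
      fix t assume "t \<in> (\<lambda>b. {a \<in> A. R a b}) ` Q"
      then obtain b where b: "b \<in> Q" "t = {a \<in> A. R a b}" by blast
      obtain l b' where l: "l \<in> A" "b' \<in> Q'" "\<forall>a\<in>A. R a b = R' (h a l) b'"
        using eq[OF A(1) False A(2) b(1)] by blast
      have "t = ?g l {a \<in> (\<lambda>a. h a l) ` A. R' a b'}" using b l by auto
      moreover have "{a \<in> (\<lambda>a. h a l) ` A. R' a b'} \<in> ?T l" using l by simp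
      ultimately have "t \<in> ?g l ` ?T l" by (rule image_eqI)
      then show "t \<in> (\<Union>l\<in>A. ?g l ` ?T l)" using l by (intro UN_I)
    qed
    then have "card ((\<lambda>b. {a \<in> A. R a b}) ` Q) \<le> card (\<Union>l\<in>A. ?g l ` ?T l)"
      by (rule card_mono[rotated]) (intro finite_UN_I finite_imageI finite_traces A(1))
    also have "\<dots> \<le> (\<Sum>l\<in>A. card (?g l ` ?T l))" by (rule card_UN_le[OF A(1)])
    also have "\<dots> \<le> (\<Sum>l\<in>A. (card A + 1) ^ d)"
    proof (rule sum_mono)
      fix l assume l: "l \<in> A"
      have "card (?g l ` ?T l) \<le> card (?T l)" by (rule card_image_le) (intro finite_imageI finite_traces A(1))
      also have "\<dots> \<le> (card ((\<lambda>a. h a l) ` A) + 1) ^ d" by (rule d) (use A h l in auto)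
      also have "\<dots> \<le> (card A + 1) ^ d" by (rule power_mono) (use A card_image_le in auto)
      finally show "card (?g l ` ?T l) \<le> (card A + 1) ^ d" .
    qed
    also have "\<dots> = card A * (card A + 1) ^ d" by simp
    finally show ?thesis by simp
  qed
  then show ?thesis unfolding poly_growth_def by blast
qed

section \<open>Definable predicates\<close>

text \<open>Predicates on assignments replace formulas, so that definability is proved by closure
  rules instead of by syntax. Agreement is required at assignments only, since other functions may
  send a variable outside its sort.\<close>

definition definable ::
    "('s, 'f, 'r) lang \<Rightarrow> ('s, 'f, 'r, 'a) struct \<Rightarrow> (('s \<times> nat \<Rightarrow> 'a) \<Rightarrow> bool) \<Rightarrow> bool" where
  "definable L M P \<longleftrightarrow> (\<exists>p. wf_fm L p \<and> (\<forall>e. assignment M e \<longrightarrow> sat M e p = P e))"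

definition tm_definable ::
    "('s, 'f, 'r) lang \<Rightarrow> ('s, 'f, 'r, 'a) struct \<Rightarrow> 's \<Rightarrow> (('s \<times> nat \<Rightarrow> 'a) \<Rightarrow> 'a) \<Rightarrow> bool" where
  "tm_definable L M s f \<longleftrightarrow> (\<exists>t. tm_sort L t s \<and> (\<forall>e. assignment M e \<longrightarrow> eval_tm M e t = f e))"

definition depends_on ::
    "('s, 'f, 'r, 'a) struct \<Rightarrow> ('s \<times> nat) set \<Rightarrow> (('s \<times> nat \<Rightarrow> 'a) \<Rightarrow> bool) \<Rightarrow> bool" where
  "depends_on M F P \<longleftrightarrow>
    (\<forall>e e'. assignment M e \<longrightarrow> assignment M e' \<longrightarrow> (\<forall>v\<in>F. e v = e' v) \<longrightarrow> P e = P e')"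

lemma assignment_upd: "assignment M e \<Longrightarrow> a \<in> univ M s \<Longrightarrow> assignment M (e((s, i) := a))"
  by (auto simp: assignment_def)

lemma assignment_override: "assignment M e \<Longrightarrow> assignment M g \<Longrightarrow> assignment M (override_on e g E)"
  by (auto simp: assignment_def override_on_def)

lemma assignment_merge: "assignment M a \<Longrightarrow> assignment M b \<Longrightarrow> assignment M (merge X a b)"
  by (auto simp: assignment_def merge_def)

lemma definableI: "wf_fm L p \<Longrightarrow> (\<And>e. assignment M e \<Longrightarrow> sat M e p = P e) \<Longrightarrow> definable L M P"
  unfolding definable_def by blast

lemma definableE:
  assumes "definable L M P"
  obtains p where "wf_fm L p" "\<And>e. assignment M e \<Longrightarrow> sat M e p = P e"
  using assms unfolding definable_def by blast

lemma definable_sat: "wf_fm L p \<Longrightarrow> definable L M (\<lambda>e. sat M e p)"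
  by (rule definableI) auto

lemma definable_cong:
  "definable L M P \<Longrightarrow> (\<And>e. assignment M e \<Longrightarrow> Q e = P e) \<Longrightarrow> definable L M Q"
  unfolding definable_def by simp

lemma definable_const: "definable L M (\<lambda>e. c)"
proof -
  let ?p = "Eq (Var (undefined, 0)) (Var (undefined, 0))"
  have "wf_fm L ?p" using tm_sort.intros(1)[of L undefined 0] by auto
  then show ?thesis
    using definableI[of L ?p M "\<lambda>e. True"] definableI[of L "Neg ?p" M "\<lambda>e. False"] by (cases c) simp_all
qed

lemma definable_not: "definable L M P \<Longrightarrow> definable L M (\<lambda>e. \<not> P e)"
  by (elim definableE, rule_tac p = "Neg p" in definableI) auto

lemma definable_and: "definable L M P \<Longrightarrow> definable L M Q \<Longrightarrow> definable L M (\<lambda>e. P e \<and> Q e)"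
  by (elim definableE, rule_tac p = "Conj p pa" in definableI) auto

lemma definable_or: "definable L M P \<Longrightarrow> definable L M Q \<Longrightarrow> definable L M (\<lambda>e. P e \<or> Q e)"
  using definable_not[OF definable_and[OF definable_not[of L M P] definable_not[of L M Q]]] by simp

lemma definable_imp: "definable L M P \<Longrightarrow> definable L M Q \<Longrightarrow> definable L M (\<lambda>e. P e \<longrightarrow> Q e)"
  by (rule definable_cong[OF definable_or[OF definable_not[of L M P], of Q]]) auto

lemma definable_ball:
  assumes "finite S" "\<And>s. s \<in> S \<Longrightarrow> definable L M (P s)"
  shows "definable L M (\<lambda>e. \<forall>s\<in>S. P s e)"
  using assms
proof (induction S rule: finite_induct)
  case empty
  show ?case by (simp add: definable_const)
next
  case (insert x F)
  then show ?case unfolding ball_simps bex_simps by (intro definable_and) simp_all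
qed

lemma definable_ex:
  assumes "definable L M P"
  shows "definable L M (\<lambda>e. \<exists>a\<in>univ M s. P (e((s, i) := a)))"
proof -
  obtain p where "wf_fm L p" "\<And>e. assignment M e \<Longrightarrow> sat M e p = P e" using assms unfolding definable_def by blast
  then show ?thesis by (intro definableI[of L "Exi (s, i) p"]) (auto simp: assignment_upd)
qed

lemma definable_all:
  assumes "definable L M P"
  shows "definable L M (\<lambda>e. \<forall>a\<in>univ M s. P (e((s, i) := a)))"
  by (rule definable_cong[OF definable_not[OF definable_ex[OF definable_not[OF assms], of s i]]]) blast

text \<open>A whole finite block of variables is quantified at once, with the new values read off
  \<open>g\<close>; this serves for tuples of coordinates, whose length varies.\<close>

lemma definable_ex_override:
  assumes "finite E" "definable L M P"
  shows "definable L M (\<lambda>e. \<exists>g. assignment M g \<and> P (override_on e g E))"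
  using assms
proof (induction E arbitrary: P rule: finite_induct)
  case empty
  show ?case by (rule definable_cong[OF empty]) auto
next
  case (insert v E)
  obtain s i where v: "v = (s, i)" by (cases v)
  let ?P = "\<lambda>e. \<exists>a\<in>univ M s. P (e((s, i) := a))"
  show ?case
  proof (rule definable_cong[OF insert.IH[OF definable_ex[OF insert.prems]]])
    fix e :: "'a \<times> nat \<Rightarrow> 'd" assume e: "assignment M e"
    show "(\<exists>g. assignment M g \<and> P (override_on e g (insert v E))) \<longleftrightarrow>
      (\<exists>g. assignment M g \<and> ?P (override_on e g E))"
    proof
      assume "\<exists>g. assignment M g \<and> P (override_on e g (insert v E))"
      then obtain g where g: "assignment M g" "P (override_on e g (insert v E))" by blast
      have "override_on e g (insert v E) = (override_on e g E)((s, i) := g (s, i))"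
        by (auto simp: override_on_def v)
      then show "\<exists>g. assignment M g \<and> ?P (override_on e g E)"
        using g by (auto simp: assignment_def)
    next
      assume "\<exists>g. assignment M g \<and> ?P (override_on e g E)"
      then obtain g a where g: "assignment M g" "a \<in> univ M s" "P ((override_on e g E)((s, i) := a))"
        by blast
      have "override_on e (g((s, i) := a)) (insert v E) = (override_on e g E)((s, i) := a)"
        using insert.hyps by (auto simp: override_on_def v)
      then show "\<exists>g. assignment M g \<and> P (override_on e g (insert v E))"
        using g assignment_upd[OF g(1,2), of i] by metis
    qed
  qed
qed

lemma definable_all_override:
  assumes "finite E" "definable L M P"
  shows "definable L M (\<lambda>e. \<forall>g. assignment M g \<longrightarrow> P (override_on e g E))"
  by (rule definable_cong[OF definable_not[OF definable_ex_override[OF assms(1) definable_not[OF assms(2)]]]]) blast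

lemma tm_definable_var: "tm_definable L M s (\<lambda>e. e (s, i))"
  unfolding tm_definable_def by (rule exI[of _ "Var (s, i)"]) (auto intro: tm_sort.intros)

lemma tm_definable_cong:
  "tm_definable L M s f \<Longrightarrow> (\<And>e. assignment M e \<Longrightarrow> f' e = f e) \<Longrightarrow> tm_definable L M s f'"
  unfolding tm_definable_def by simp

lemma tm_definable_list:
  assumes "list_all2 (tm_definable L M) ss fs"
  shows "\<exists>ts. list_all2 (tm_sort L) ts ss \<and>
    (\<forall>e. assignment M e \<longrightarrow> map (eval_tm M e) ts = map (\<lambda>f. f e) fs)"
  using assms
proof (induction rule: list_all2_induct)
  case (Cons s ss f fs)
  then obtain t ts where "tm_sort L t s" "\<forall>e. assignment M e \<longrightarrow> eval_tm M e t = f e"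
    "list_all2 (tm_sort L) ts ss" "\<forall>e. assignment M e \<longrightarrow> map (eval_tm M e) ts = map (\<lambda>f. f e) fs"
    by (auto simp: tm_definable_def)
  then show ?case by (intro exI[of _ "t # ts"]) simp
qed simp

lemma tm_definable_fn:
  assumes "fun_sig L f = Some (ss, s)" "list_all2 (tm_definable L M) ss fs"
  shows "tm_definable L M s (\<lambda>e. fun_int M f (map (\<lambda>f. f e) fs))"
proof -
  obtain ts where "list_all2 (tm_sort L) ts ss"
    "\<And>e. assignment M e \<Longrightarrow> map (eval_tm M e) ts = map (\<lambda>f. f e) fs"
    using tm_definable_list[OF assms(2)] by blast
  then show ?thesis unfolding tm_definable_def using assms(1)
    by (intro exI[of _ "Fn f ts"]) (auto intro: tm_sort.intros)
qed

lemma definable_rel: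
  assumes "rel_sig L r = Some ss" "list_all2 (tm_definable L M) ss fs"
  shows "definable L M (\<lambda>e. rel_int M r (map (\<lambda>f. f e) fs))"
proof -
  obtain ts where "list_all2 (tm_sort L) ts ss"
    "\<And>e. assignment M e \<Longrightarrow> map (eval_tm M e) ts = map (\<lambda>f. f e) fs"
    using tm_definable_list[OF assms(2)] by blast
  then show ?thesis using assms(1) by (intro definableI[of L "Rel r ts"]) auto
qed

lemma definable_eq:
  assumes "tm_definable L M s f" "tm_definable L M s g"
  shows "definable L M (\<lambda>e. f e = g e)"
proof -
  obtain t u where "tm_sort L t s" "\<And>e. assignment M e \<Longrightarrow> eval_tm M e t = f e"
    "tm_sort L u s" "\<And>e. assignment M e \<Longrightarrow> eval_tm M e u = g e"
    using assms unfolding tm_definable_def by blast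
  then show ?thesis by (intro definableI[of L "Eq t u"]) auto
qed

section \<open>Dependence of formulas on finitely many variables\<close>

lemma eval_tm_depends: "\<exists>F. finite F \<and> (\<forall>e e'. (\<forall>v\<in>F. e v = e' v) \<longrightarrow> eval_tm M e t = eval_tm M e' t)"
proof (induction t)
  case (Var v)
  show ?case by (rule exI[of _ "{v}"]) simp
next
  case (Fn f ts)
  then obtain F where F: "\<And>t. t \<in> set ts \<Longrightarrow> finite (F t)"
    "\<And>t e e'. t \<in> set ts \<Longrightarrow> (\<forall>v\<in>F t. e v = e' v) \<Longrightarrow> eval_tm M e t = eval_tm M e' t"
    by metis
  have "map (eval_tm M e) ts = map (eval_tm M e') ts" if "\<forall>v\<in>\<Union>(F ` set ts). e v = e' v" for e e'
    using F(2) that by auto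
  then have "eval_tm M e (Fn f ts) = eval_tm M e' (Fn f ts)" if "\<forall>v\<in>\<Union>(F ` set ts). e v = e' v" for e e'
    using that by (simp only: eval_tm.simps)
  then show ?case using F(1) by (intro exI[of _ "\<Union>(F ` set ts)"]) blast
qed

lemma eval_tms_depends:
  "\<exists>F. finite F \<and> (\<forall>e e'. (\<forall>v\<in>F. e v = e' v) \<longrightarrow> map (eval_tm M e) ts = map (eval_tm M e') ts)"
proof (induction ts)
  case (Cons t ts)
  then obtain F where F: "finite F" "\<And>e e'. (\<forall>v\<in>F. e v = e' v) \<Longrightarrow> map (eval_tm M e) ts = map (eval_tm M e') ts"
    by blast
  obtain G where G: "finite G" "\<And>e e'. (\<forall>v\<in>G. e v = e' v) \<Longrightarrow> eval_tm M e t = eval_tm M e' t"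
    using eval_tm_depends[of M t] by blast
  have "map (eval_tm M e) (t # ts) = map (eval_tm M e') (t # ts)" if "\<forall>v\<in>F \<union> G. e v = e' v" for e e'
    using F(2)[of e e'] G(2)[of e e'] that by simp
  then show ?case using F(1) G(1) by (intro exI[of _ "F \<union> G"]) blast
qed (rule exI[of _ "{}"], simp)

lemma sat_depends: "\<exists>F. finite F \<and> (\<forall>e e'. (\<forall>v\<in>F. e v = e' v) \<longrightarrow> sat M e p = sat M e' p)"
proof (induction p)
  case (Eq t u)
  obtain F where F: "finite F" "\<And>e e'. (\<forall>v\<in>F. e v = e' v) \<Longrightarrow> map (eval_tm M e) [t, u] = map (eval_tm M e') [t, u]"
    using eval_tms_depends[of M "[t, u]"] by blast
  have "sat M e (Eq t u) = sat M e' (Eq t u)" if "\<forall>v\<in>F. e v = e' v" for e e'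
    using F(2)[OF that] by simp
  then show ?case using F(1) by blast
next
  case (Rel r ts)
  obtain F where F: "finite F" "\<And>e e'. (\<forall>v\<in>F. e v = e' v) \<Longrightarrow> map (eval_tm M e) ts = map (eval_tm M e') ts"
    using eval_tms_depends[of M ts] by blast
  have "sat M e (Rel r ts) = sat M e' (Rel r ts)" if "\<forall>v\<in>F. e v = e' v" for e e'
    unfolding sat.simps F(2)[OF that] ..
  then show ?case using F(1) by blast
next
  case (Neg p)
  then show ?case by simp
next
  case (Conj p q)
  then obtain F G where F: "finite F" "\<And>e e'. (\<forall>v\<in>F. e v = e' v) \<Longrightarrow> sat M e p = sat M e' p"
    and G: "finite G" "\<And>e e'. (\<forall>v\<in>G. e v = e' v) \<Longrightarrow> sat M e q = sat M e' q"
    by blast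
  have "sat M e (Conj p q) = sat M e' (Conj p q)" if "\<forall>v\<in>F \<union> G. e v = e' v" for e e'
    using F(2)[of e e'] G(2)[of e e'] that by simp
  then show ?case using F(1) G(1) by (intro exI[of _ "F \<union> G"]) blast
next
  case (Exi v p)
  then obtain F where F: "finite F" "\<And>e e'. (\<forall>v\<in>F. e v = e' v) \<Longrightarrow> sat M e p = sat M e' p" by blast
  have "sat M e (Exi v p) = sat M e' (Exi v p)" if "\<forall>v\<in>F. e v = e' v" for e e'
  proof -
    have "sat M (e(v := a)) p = sat M (e'(v := a)) p" for a by (rule F(2)) (use that in simp)
    then show ?thesis by simp
  qed
  then show ?case using F(1) by blast
qed

lemma definable_depends_on:
  assumes "definable L M P"
  obtains F where "finite F" "depends_on M F P"
proof -
  obtain p where "wf_fm L p" and p: "\<And>e. assignment M e \<Longrightarrow> sat M e p = P e" using assms unfolding definable_def by blast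
  obtain F where "finite F" "\<And>e e'. (\<forall>v\<in>F. e v = e' v) \<Longrightarrow> sat M e p = sat M e' p"
    using sat_depends[of M p] by blast
  then show ?thesis using p by (intro that[of F]) (auto simp: depends_on_def)
qed

text \<open>Substitution of a definable constant is expressed by
  \<open>\<exists>a. a = c \<and> P\<close>, which avoids substitution in formulas and capture of
  variables.\<close>

lemma definable_upd_const:
  assumes P: "definable L M P" and c: "tm_definable L M s (\<lambda>_. c)" "c \<in> univ M s"
  shows "definable L M (\<lambda>e. P (e((s, i) := c)))"
proof -
  have "definable L M (\<lambda>e. \<exists>a\<in>univ M s. (e((s, i) := a)) (s, i) = c \<and> P (e((s, i) := a)))"
    by (intro definable_ex[of L M "\<lambda>e. e (s, i) = c \<and> P e"] definable_and
        definable_eq[OF tm_definable_var c(1)] P)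
  then show ?thesis by (rule definable_cong) (use c in auto)
qed

text \<open>\<open>Z\<close> may be infinite: only its intersection with a finite support of
  \<open>P\<close> has to be substituted. This matters because a new basis vector adds a coordinate
  to every vector variable.\<close>

lemma definable_override_const:
  assumes P: "definable L M P" and g: "assignment M g"
    and c: "\<And>s i. (s, i) \<in> Z \<Longrightarrow> tm_definable L M s (\<lambda>_. g (s, i))"
  shows "definable L M (\<lambda>e. P (override_on e g Z))"
proof -
  obtain F where F: "finite F" "depends_on M F P" using definable_depends_on[OF P] .
  have "definable L M (\<lambda>e. P (override_on e g Y))" if "finite Y" "Y \<subseteq> Z" for Y
    using that P
  proof (induction Y arbitrary: P rule: finite_induct)
    case (insert v Y)
    obtain s i where v: "v = (s, i)" by (cases v)
    have "definable L M (\<lambda>e. P (e((s, i) := g (s, i))))"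
      by (rule definable_upd_const) (use insert.prems g c v in \<open>auto simp: assignment_def\<close>)
    note IH = insert.IH[OF _ this]
    have eq: "override_on e g (insert v Y) = (override_on e g Y)((s, i) := g (s, i))" for e
      by (auto simp: v override_on_def)
    show ?case unfolding eq by (rule IH) (use insert.prems in blast)
  qed simp
  from this[of "Z \<inter> F"] have "definable L M (\<lambda>e. P (override_on e g (Z \<inter> F)))" using F by simp
  then show ?thesis
  proof (rule definable_cong)
    fix e :: "'a \<times> nat \<Rightarrow> 'd" assume "assignment M e"
    then show "P (override_on e g Z) = P (override_on e g (Z \<inter> F))"
      using F(2)[unfolded depends_on_def, rule_format, of "override_on e g Z" "override_on e g (Z \<inter> F)"] g
      by (simp add: assignment_override) (simp add: override_on_def)
  qed
qed

section \<open>Finite unions of products of definable predicates\<close>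

definition rectangular where
  "rectangular LK K LG G Q \<longleftrightarrow>
    (\<exists>S. finite S \<and> (\<forall>s\<in>S. definable LK K (fst s) \<and> definable LG G (snd s)) \<and>
      (\<forall>k g. assignment K k \<longrightarrow> assignment G g \<longrightarrow> Q k g = (\<exists>s\<in>S. fst s k \<and> snd s g)))"

lemma rectangularE:
  assumes "rectangular LK K LG G Q"
  obtains S where "finite S" "\<And>s. s \<in> S \<Longrightarrow> definable LK K (fst s)" "\<And>s. s \<in> S \<Longrightarrow> definable LG G (snd s)"
    "\<And>k g. assignment K k \<Longrightarrow> assignment G g \<Longrightarrow> Q k g = (\<exists>s\<in>S. fst s k \<and> snd s g)"
proof -
  obtain S where "finite S \<and> (\<forall>s\<in>S. definable LK K (fst s) \<and> definable LG G (snd s)) \<and>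
      (\<forall>k g. assignment K k \<longrightarrow> assignment G g \<longrightarrow> Q k g = (\<exists>s\<in>S. fst s k \<and> snd s g))"
    using assms unfolding rectangular_def by (rule exE)
  then show ?thesis by (intro that[of S]) simp_all
qed

lemma rectangularI:
  assumes "finite S" "\<And>s. s \<in> S \<Longrightarrow> definable LK K (fst s)" "\<And>s. s \<in> S \<Longrightarrow> definable LG G (snd s)"
    "\<And>k g. assignment K k \<Longrightarrow> assignment G g \<Longrightarrow> Q k g = (\<exists>s\<in>S. fst s k \<and> snd s g)"
  shows "rectangular LK K LG G Q"
  unfolding rectangular_def by (intro exI[of _ S] conjI ballI allI impI assms)

lemma rectangular_cong:
  assumes "rectangular LK K LG G Q" "\<And>k g. assignment K k \<Longrightarrow> assignment G g \<Longrightarrow> Q' k g = Q k g"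
  shows "rectangular LK K LG G Q'"
proof (rule rectangularE[OF assms(1)])
  fix S assume S: "finite S" "\<And>s. s \<in> S \<Longrightarrow> definable LK K (fst s)" "\<And>s. s \<in> S \<Longrightarrow> definable LG G (snd s)"
    "\<And>k g. assignment K k \<Longrightarrow> assignment G g \<Longrightarrow> Q k g = (\<exists>s\<in>S. fst s k \<and> snd s g)"
  show ?thesis by (rule rectangularI[OF S(1)]) (simp_all add: S(2-4) assms(2))
qed

lemma rectangular_left: "definable LK K A \<Longrightarrow> rectangular LK K LG G (\<lambda>k g. A k)"
  by (rule rectangularI[of "{(A, \<lambda>_. True)}"]) (auto intro: definable_const)

lemma rectangular_right: "definable LG G C \<Longrightarrow> rectangular LK K LG G (\<lambda>k g. C g)"
  by (rule rectangularI[of "{(\<lambda>_. True, C)}"]) (auto intro: definable_const)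

lemma rectangular_const: "rectangular LK K LG G (\<lambda>k g. c)"
  by (rule rectangular_left) (rule definable_const)

lemma rectangular_or:
  assumes "rectangular LK K LG G Q" "rectangular LK K LG G Q'"
  shows "rectangular LK K LG G (\<lambda>k g. Q k g \<or> Q' k g)"
proof (rule rectangularE[OF assms(1)], rule rectangularE[OF assms(2)])
  fix S S' assume S: "finite S" "\<And>s. s \<in> S \<Longrightarrow> definable LK K (fst s)"
      "\<And>s. s \<in> S \<Longrightarrow> definable LG G (snd s)"
      "\<And>k g. assignment K k \<Longrightarrow> assignment G g \<Longrightarrow> Q k g = (\<exists>s\<in>S. fst s k \<and> snd s g)"
    and S': "finite S'" "\<And>s. s \<in> S' \<Longrightarrow> definable LK K (fst s)"
      "\<And>s. s \<in> S' \<Longrightarrow> definable LG G (snd s)"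
      "\<And>k g. assignment K k \<Longrightarrow> assignment G g \<Longrightarrow> Q' k g = (\<exists>s\<in>S'. fst s k \<and> snd s g)"
  show ?thesis
  proof (rule rectangularI[of "S \<union> S'"])
    fix s assume "s \<in> S \<union> S'"
    then show "definable LK K (fst s)" "definable LG G (snd s)" using S(2,3) S'(2,3) by blast+
  qed (simp_all add: S(1,4) S'(1,4) bex_Un)
qed

lemma rectangular_and:
  assumes "rectangular LK K LG G Q" "rectangular LK K LG G Q'"
  shows "rectangular LK K LG G (\<lambda>k g. Q k g \<and> Q' k g)"
proof (rule rectangularE[OF assms(1)], rule rectangularE[OF assms(2)])
  fix S S' assume S: "finite S" "\<And>s. s \<in> S \<Longrightarrow> definable LK K (fst s)"
      "\<And>s. s \<in> S \<Longrightarrow> definable LG G (snd s)"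
      "\<And>k g. assignment K k \<Longrightarrow> assignment G g \<Longrightarrow> Q k g = (\<exists>s\<in>S. fst s k \<and> snd s g)"
    and S': "finite S'" "\<And>s. s \<in> S' \<Longrightarrow> definable LK K (fst s)"
      "\<And>s. s \<in> S' \<Longrightarrow> definable LG G (snd s)"
      "\<And>k g. assignment K k \<Longrightarrow> assignment G g \<Longrightarrow> Q' k g = (\<exists>s\<in>S'. fst s k \<and> snd s g)"
  let ?f = "\<lambda>(s, s'). (\<lambda>k. fst s k \<and> fst s' k, \<lambda>g. snd s g \<and> snd s' g)"
  show ?thesis
  proof (rule rectangularI[of "?f ` (S \<times> S')"])
    fix s assume "s \<in> ?f ` (S \<times> S')"
    then obtain s1 s2 where "s1 \<in> S" "s2 \<in> S'" "s = ?f (s1, s2)" by blast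
    then show "definable LK K (fst s)" "definable LG G (snd s)"
      by (simp_all add: definable_and S(2,3) S'(2,3))
  qed (auto simp: S(1,4) S'(1,4))
qed

lemma rectangular_bex:
  assumes "finite I" "\<And>i. i \<in> I \<Longrightarrow> rectangular LK K LG G (Q i)"
  shows "rectangular LK K LG G (\<lambda>k g. \<exists>i\<in>I. Q i k g)"
  using assms
proof (induction I rule: finite_induct)
  case empty
  show ?case by (simp add: rectangular_const)
next
  case (insert x F)
  then show ?case unfolding ball_simps bex_simps by (intro rectangular_or) simp_all
qed

lemma rectangular_ball:
  assumes "finite I" "\<And>i. i \<in> I \<Longrightarrow> rectangular LK K LG G (Q i)"
  shows "rectangular LK K LG G (\<lambda>k g. \<forall>i\<in>I. Q i k g)"
  using assms
proof (induction I rule: finite_induct)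
  case empty
  show ?case by (simp add: rectangular_const)
next
  case (insert x F)
  then show ?case unfolding ball_simps bex_simps by (intro rectangular_and) simp_all
qed

text \<open>The complement of a product is a union of two cylinders, so the complement of a finite
  union of products is a finite intersection of such unions, and intersections distribute over
  them.\<close>

lemma rectangular_not:
  assumes "rectangular LK K LG G Q"
  shows "rectangular LK K LG G (\<lambda>k g. \<not> Q k g)"
proof (rule rectangularE[OF assms])
  fix S assume S: "finite S" "\<And>s. s \<in> S \<Longrightarrow> definable LK K (fst s)"
      "\<And>s. s \<in> S \<Longrightarrow> definable LG G (snd s)"
      "\<And>k g. assignment K k \<Longrightarrow> assignment G g \<Longrightarrow> Q k g = (\<exists>s\<in>S. fst s k \<and> snd s g)"
  have "rectangular LK K LG G (\<lambda>k g. \<forall>s\<in>S. \<not> fst s k \<or> \<not> snd s g)"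
    by (intro rectangular_ball S(1) rectangular_or rectangular_left rectangular_right definable_not)
      (auto intro: S(2,3))
  then show ?thesis by (rule rectangular_cong) (auto simp: S(4))
qed

text \<open>Covers operations that act on one factor at a time and commute with finite unions, such
  as quantification or substitution on one side. The hypothesis \<open>eq\<close> is stated for
  every decomposition \<open>S\<close>, because the one that exists is not known explicitly.\<close>

lemma rectangular_map:
  assumes Q: "rectangular LK K LG G Q"
    and \<Phi>: "\<And>A. definable LK K A \<Longrightarrow> definable LK K (\<Phi> A)"
    and \<Psi>: "\<And>C. definable LG G C \<Longrightarrow> definable LG G (\<Psi> C)"
    and eq: "\<And>S k g. assignment K k \<Longrightarrow> assignment G g \<Longrightarrow>
      (\<And>k g. assignment K k \<Longrightarrow> assignment G g \<Longrightarrow> Q k g = (\<exists>s\<in>S. fst s k \<and> snd s g)) \<Longrightarrow>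
      Q' k g = (\<exists>s\<in>S. \<Phi> (fst s) k \<and> \<Psi> (snd s) g)"
  shows "rectangular LK K LG G Q'"
proof (rule rectangularE[OF Q])
  fix S assume S: "finite S" "\<And>s. s \<in> S \<Longrightarrow> definable LK K (fst s)"
      "\<And>s. s \<in> S \<Longrightarrow> definable LG G (snd s)"
      "\<And>k g. assignment K k \<Longrightarrow> assignment G g \<Longrightarrow> Q k g = (\<exists>s\<in>S. fst s k \<and> snd s g)"
  have Q': "Q' k g = (\<exists>s\<in>S. \<Phi> (fst s) k \<and> \<Psi> (snd s) g)" if "assignment K k" "assignment G g" for k g
    by (rule eq[OF that]) (rule S(4))
  show ?thesis
  proof (rule rectangularI[of "map_prod \<Phi> \<Psi> ` S"])
    fix s assume "s \<in> map_prod \<Phi> \<Psi> ` S"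
    then show "definable LK K (fst s)" "definable LG G (snd s)" using \<Phi> \<Psi> S(2,3) by auto
  qed (simp_all add: S(1) Q')
qed

lemma rectangular_ex_left:
  assumes "rectangular LK K LG G Q" "finite E"
  shows "rectangular LK K LG G (\<lambda>k g. \<exists>h. assignment K h \<and> Q (override_on k h E) g)"
proof (rule rectangular_map[OF assms(1)])
  show "definable LK K A \<Longrightarrow> definable LK K (\<lambda>k. \<exists>h. assignment K h \<and> A (override_on k h E))" for A
    by (rule definable_ex_override[OF assms(2)])
  fix S k g
  assume "assignment K k" "assignment G g"
    "\<And>k g. assignment K k \<Longrightarrow> assignment G g \<Longrightarrow> Q k g = (\<exists>s\<in>S. fst s k \<and> snd s g)"
  then show "(\<exists>h. assignment K h \<and> Q (override_on k h E) g) \<longleftrightarrow>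
      (\<exists>s\<in>S. (\<exists>h. assignment K h \<and> fst s (override_on k h E)) \<and> snd s g)"
    by (simp add: assignment_override cong: conj_cong) blast
qed

lemma rectangular_ex_right:
  assumes "rectangular LK K LG G Q"
  shows "rectangular LK K LG G (\<lambda>k g. \<exists>a\<in>univ G s. Q k (g((s, i) := a)))"
proof (rule rectangular_map[OF assms(1)])
  show "definable LG G C \<Longrightarrow> definable LG G (\<lambda>g. \<exists>a\<in>univ G s. C (g((s, i) := a)))" for C
    by (rule definable_ex)
  fix S k g
  assume "assignment K k" "assignment G g"
    "\<And>k g. assignment K k \<Longrightarrow> assignment G g \<Longrightarrow> Q k g = (\<exists>s\<in>S. fst s k \<and> snd s g)"
  then show "(\<exists>a\<in>univ G s. Q k (g((s, i) := a))) \<longleftrightarrow>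
      (\<exists>t\<in>S. fst t k \<and> (\<exists>a\<in>univ G s. snd t (g((s, i) := a))))"
    by (simp add: assignment_upd cong: bex_cong) blast
qed

lemma rectangular_override_const:
  assumes "rectangular LK K LG G Q" "assignment K h"
    "\<And>s i. (s, i) \<in> Z \<Longrightarrow> tm_definable LK K s (\<lambda>_. h (s, i))"
  shows "rectangular LK K LG G (\<lambda>k g. Q (override_on k h Z) g)"
proof (rule rectangular_map[OF assms(1)])
  show "definable LK K A \<Longrightarrow> definable LK K (\<lambda>k. A (override_on k h Z))" for A
    by (rule definable_override_const[OF _ assms(2,3)])
qed (simp_all add: assignment_override assms(2))

section \<open>Growth bounds from NIP, and transfer of NIP along an interpretation\<close>

lemma NIP_poly_growth:
  assumes "NIP L M" "definable L M P"
  shows "poly_growth (Collect (assignment M)) (Collect (assignment M)) (\<lambda>a b. P (merge X a b))"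
proof -
  obtain p where p: "wf_fm L p" "\<forall>e. assignment M e \<longrightarrow> sat M e p = P e"
    using assms(2) unfolding definable_def by blast
  then have "\<not> has_IP M p X" using assms(1) unfolding NIP_def by blast
  from not_IP_poly_growth[OF this] show ?thesis
    by (rule poly_growth_pull[where \<kappa> = "\<lambda>a. a" and \<mu> = "\<lambda>b. b"]) (simp_all add: p(2) assignment_merge)
qed

text \<open>Terms and atomic formulas of \<open>N\<close> have to be interpreted on the sort
  \<open>s0\<close>; connectives and quantifiers follow, since that sort is exactly the range of
  \<open>\<iota>\<close>. Shattered tuples of \<open>N\<close> are then carried over by
  \<open>\<iota>\<close>.\<close>

lemma NIP_interpretation:
  fixes N :: "(unit, 'f, 'r, 'b) struct" and M :: "('s, 'g, 'q, 'a) struct" and \<iota> :: "'b \<Rightarrow> 'a"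
  assumes NIP: "NIP LM M"
    and univ: "univ M s0 = range \<iota>" "\<And>x. \<pi> (\<iota> x) = x" "\<And>s. univ N s = UNIV" "assignment M e0"
    and tm: "\<And>t. tm_sort LN t () \<Longrightarrow> tm_definable LM M s0 (\<lambda>e. \<iota> (eval_tm N (\<lambda>v. \<pi> (e (s0, snd v))) t))"
    and rel: "\<And>r ts. wf_fm LN (Rel r ts) \<Longrightarrow> definable LM M (\<lambda>e. sat N (\<lambda>v. \<pi> (e (s0, snd v))) (Rel r ts))"
  shows "NIP LN N"
  unfolding NIP_def
proof (intro allI impI notI)
  fix p X
  assume p: "wf_fm LN p" and IP: "has_IP N p X"
  let ?\<pi> = "\<lambda>e v. \<pi> (e (s0, snd v))"
  have "definable LM M (\<lambda>e. sat N (?\<pi> e) p)"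
    using p
  proof (induction p)
    case (Eq t u)
    then have "tm_sort LN t ()" "tm_sort LN u ()" by auto
    then have "definable LM M (\<lambda>e. \<iota> (eval_tm N (?\<pi> e) t) = \<iota> (eval_tm N (?\<pi> e) u))"
      by (intro definable_eq[OF tm tm])
    then show ?case by (rule definable_cong) (metis sat.simps(1) univ(2))
  next
    case (Rel r ts)
    then show ?case by (rule rel)
  next
    case (Neg p)
    then show ?case by (simp add: definable_not)
  next
    case (Conj p q)
    then show ?case by (simp add: definable_and)
  next
    case (Exi v p)
    obtain i where v: "v = ((), i)" by (cases v) simp
    have eq: "?\<pi> (e((s0, i) := \<iota> x)) = (?\<pi> e)(v := x)" for e x
      by (auto simp: v univ(2))
    have "definable LM M (\<lambda>e. \<exists>a\<in>univ M s0. sat N (?\<pi> (e((s0, i) := a))) p)"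
      by (rule definable_ex) (use Exi in simp)
    then show ?case
      by (rule definable_cong) (simp only: univ(1) bex_simps(7) eq sat.simps univ(3))
  qed
  then obtain q where q: "wf_fm LM q" "\<forall>e. assignment M e \<longrightarrow> sat M e q = sat N (?\<pi> e) p"
    unfolding definable_def by blast
  define X' where "X' = {(s, i). s = s0 \<and> ((), i) \<in> X}"
  \<comment> \<open>Assignments are total, so the sorts other than \<open>s0\<close> are filled from
    the fixed assignment \<open>e0\<close>.\<close>
  define lift where "lift a = (\<lambda>(s, i). if s = s0 then \<iota> (a ((), i)) else e0 (s, i))" for a :: "unit \<times> nat \<Rightarrow> 'b"
  have lift: "assignment M (lift a)" for a
    using univ(1,4) by (auto simp: assignment_def lift_def)
  have "?\<pi> (merge X' (lift a) (lift b)) = merge X a b" for a b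
    by (auto simp: merge_def X'_def lift_def univ(2))
  then have sat: "sat M (merge X' (lift a) (lift b)) q = sat N (merge X a b) p" for a b
    using q(2) by (simp add: assignment_merge lift)
  have "has_IP M q X'"
    unfolding has_IP_iff_merge
  proof
    fix n :: nat
    obtain a b where "\<forall>i<n. \<forall>I\<subseteq>{..<n}. sat N (merge X (a i) (b I)) p \<longleftrightarrow> i \<in> I"
      using spec[OF IP[unfolded has_IP_iff_merge], of n] by (elim exE conjE) (rule that)
    then show "\<exists>a b. (\<forall>i<n. assignment M (a i)) \<and> (\<forall>I\<subseteq>{..<n}. assignment M (b I)) \<and>
        (\<forall>i<n. \<forall>I\<subseteq>{..<n}. sat M (merge X' (a i) (b I)) q \<longleftrightarrow> i \<in> I)"
      by (intro exI[of _ "\<lambda>i. lift (a i)"] exI[of _ "\<lambda>I. lift (b I)"]) (simp add: lift sat)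
  qed
  then show False using NIP q(1) unfolding NIP_def by blast
qed

section \<open>Valuation-independent families\<close>

context valued_vector_space
begin

section \<open>Ultrametric inequalities and the values on finite-dimensional subspaces\<close>

lemma val_0 [simp]: "val 0 = top"
  by (simp add: val_eq_top_iff)

lemma val_minus [simp]: "val (- x) = val x"
  using val_scale[of "- 1" x] by simp

lemma val_add: "min (val x) (val y) \<le> val (x + y)"
  using val_diff[of x "- y"] by simp

lemma le_val_add: "\<gamma> \<le> val x \<Longrightarrow> \<gamma> \<le> val y \<Longrightarrow> \<gamma> \<le> val (x + y)"
  using val_add[of x y] by (meson min.boundedI order_trans)

lemma le_val_diff: "\<gamma> \<le> val x \<Longrightarrow> \<gamma> \<le> val y \<Longrightarrow> \<gamma> \<le> val (x - y)"
  using val_diff[of x y] by (meson min.boundedI order_trans)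

lemma le_val_scale: "\<gamma> \<le> val x \<Longrightarrow> \<gamma> \<le> val (scale c x)"
  by (cases "c = 0") (simp_all add: val_scale)

lemma le_val_sum: "(\<And>i. i \<in> I \<Longrightarrow> \<gamma> \<le> val (f i)) \<Longrightarrow> \<gamma> \<le> val (sum f I)"
  by (induction I rule: infinite_finite_induct) (auto intro: le_val_add)

lemma val_diff_less:
  assumes "val x < val y"
  shows "val (x - y) = val x"
proof (rule antisym)
  show "val x \<le> val (x - y)" using assms by (intro le_val_diff) auto
  have "min (val (x - y)) (val y) \<le> val x" using val_add[of "x - y" y] by simp
  then show "val (x - y) \<le> val x" using assms by (auto simp: min_def split: if_splits)
qed

text \<open>Of two different values on the coset, the smaller is the value of a difference, hence of
  an element of \<open>W\<close>. So at most one value, the largest, is not a value on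
  \<open>W\<close> itself.\<close>

lemma finite_val_coset:
  assumes "finite (val ` W)" "\<And>w w'. w \<in> W \<Longrightarrow> w' \<in> W \<Longrightarrow> w - w' \<in> W"
  shows "finite ((\<lambda>w. val (x + w)) ` W)"
proof -
  let ?S = "(\<lambda>w. val (x + w)) ` W"
  have *: "s \<in> val ` W" if "s \<in> ?S" "t \<in> ?S" "s < t" for s t
  proof -
    obtain w w' where "w \<in> W" "w' \<in> W" "s = val (x + w)" "t = val (x + w')" using \<open>s \<in> ?S\<close> \<open>t \<in> ?S\<close> by blast
    then have "s = val (w - w')" using val_diff_less[of "x + w" "x + w'"] \<open>s < t\<close> by simp
    then show ?thesis using assms(2)[OF \<open>w \<in> W\<close> \<open>w' \<in> W\<close>] by blast
  qed
  have "s = t" if "s \<in> ?S - val ` W" "t \<in> ?S - val ` W" for s t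
    using that *[of s t] *[of t s] by (meson DiffD1 DiffD2 linorder_neqE)
  then have "finite (?S - val ` W)"
    by (metis finite.simps subsetI subset_singletonD insertI1 finite_subset singletonI)
  then show ?thesis using assms(1) by (meson finite_Diff2)
qed

text \<open>An element of the larger span with nonzero coefficient at \<open>x\<close> can be
  rescaled into the coset of \<open>x\<close> without changing its value.\<close>

lemma finite_val_span: "finite J \<Longrightarrow> finite (val ` span J)"
proof (induction J rule: finite_induct)
  case empty
  show ?case by (simp add: span_empty)
next
  case (insert x J)
  have "val ` span (insert x J) \<subseteq> val ` span J \<union> (\<lambda>w. val (x + w)) ` span J"
  proof
    fix s assume "s \<in> val ` span (insert x J)"
    then obtain y k where y: "s = val y" "y - scale k x \<in> span J" by (auto simp: span_breakdown_eq)
    show "s \<in> val ` span J \<union> (\<lambda>w. val (x + w)) ` span J"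
    proof (cases "k = 0")
      case False
      let ?w = "scale (1 / k) (y - scale k x)"
      have "x + ?w = scale (1 / k) y" using False by (simp add: scale_right_diff_distrib)
      then have "s = val (x + ?w)" using False by (simp add: val_scale y)
      then show ?thesis using span_scale[OF y(2)] by blast
    qed (use y in auto)
  qed
  moreover have "finite ((\<lambda>w. val (x + w)) ` span J)"
    by (rule finite_val_coset[OF insert.IH]) (rule span_diff)
  ultimately show ?case using insert.IH by (meson finite_UnI finite_subset)
qed

text \<open>This replaces spherical completeness: a finite-dimensional subspace has only finitely many values.\<close>

lemma best_approximation:
  assumes "finite J"
  obtains w where "w \<in> span J" "\<And>w'. w' \<in> span J \<Longrightarrow> val (x + w') \<le> val (x + w)"
proof -
  let ?S = "(\<lambda>w. val (x + w)) ` span J"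
  have fin: "finite ?S" by (rule finite_val_coset[OF finite_val_span[OF assms]]) (rule span_diff)
  have "?S \<noteq> {}" using span_zero[of J] by blast
  then have "Max ?S \<in> ?S" by (rule Max_in[OF fin])
  then obtain w where w: "w \<in> span J" "Max ?S = val (x + w)" by blast
  show ?thesis
  proof (rule that[OF w(1)])
    fix w' assume "w' \<in> span J"
    then show "val (x + w') \<le> val (x + w)" unfolding w(2)[symmetric] by (intro Max_ge[OF fin] imageI)
  qed
qed

section \<open>Valuation-independent families and orthogonalisation\<close>

lemma in_span_image_iff:
  assumes "finite J"
  shows "y \<in> span (v ` J) \<longleftrightarrow> (\<exists>c. y = (\<Sum>j\<in>J. scale (c j) (v j)))"
proof
  show "y \<in> span (v ` J) \<Longrightarrow> \<exists>c. y = (\<Sum>j\<in>J. scale (c j) (v j))"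
    using assms
  proof (induction J arbitrary: y rule: finite_induct)
    case (insert i J)
    then obtain k where "y - scale k (v i) \<in> span (v ` J)" by (auto simp: span_breakdown_eq)
    from insert.IH[OF this] obtain c where c: "y - scale k (v i) = (\<Sum>j\<in>J. scale (c j) (v j))" by blast
    have "(\<Sum>j\<in>J. scale ((c(i := k)) j) (v j)) = (\<Sum>j\<in>J. scale (c j) (v j))"
      by (rule sum.cong) (use insert.hyps in auto)
    then have "y = (\<Sum>j\<in>insert i J. scale ((c(i := k)) j) (v j))"
      using insert.hyps c[symmetric] by simp
    then show ?case by blast
  qed (simp add: span_empty)
qed (auto intro: span_sum span_scale span_base)

text \<open>This says that the value of a combination is the least value of a vector with nonzero
  coefficient. The form with \<open>\<gamma>\<close> avoids a minimum over a possibly empty set.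
  Zero vectors are allowed, so \<open>n\<close> may exceed the dimension of the span.\<close>

definition val_indep :: "nat \<Rightarrow> (nat \<Rightarrow> 'v) \<Rightarrow> bool" where
  "val_indep n u \<longleftrightarrow> (\<forall>c \<gamma>. \<gamma> \<le> val (\<Sum>i<n. scale (c i) (u i)) \<longrightarrow> (\<forall>i<n. c i \<noteq> 0 \<longrightarrow> \<gamma> \<le> val (u i)))"

lemma val_indepD: "val_indep n u \<Longrightarrow> \<gamma> \<le> val (\<Sum>i<n. scale (c i) (u i)) \<Longrightarrow> i < n \<Longrightarrow> c i \<noteq> 0 \<Longrightarrow> \<gamma> \<le> val (u i)"
  unfolding val_indep_def by blast

lemma val_indep_le_iff:
  assumes "val_indep n u"
  shows "\<gamma> \<le> val (\<Sum>i<n. scale (c i) (u i)) \<longleftrightarrow> (\<forall>i<n. c i \<noteq> 0 \<longrightarrow> \<gamma> \<le> val (u i))"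
proof
  assume *: "\<forall>i<n. c i \<noteq> 0 \<longrightarrow> \<gamma> \<le> val (u i)"
  show "\<gamma> \<le> val (\<Sum>i<n. scale (c i) (u i))"
  proof (rule le_val_sum)
    fix i assume "i \<in> {..<n}"
    then show "\<gamma> \<le> val (scale (c i) (u i))" using * by (cases "c i = 0") (auto simp: val_scale)
  qed
qed (use assms in \<open>auto dest: val_indepD\<close>)

text \<open>The hypothesis on \<open>u'\<close> says that adding vectors of the span of
  \<open>u\<close> never improves its value. Dividing a combination by its coefficient at
  \<open>u'\<close> therefore bounds \<open>val u'\<close>, and subtracting that term leaves a
  combination of \<open>u\<close>.\<close>

lemma val_indep_SucI:
  assumes u: "val_indep n u"
    and u': "\<And>c. val (u' + (\<Sum>i<n. scale (c i) (u i))) \<le> val u'"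
  shows "val_indep (Suc n) (u(n := u'))"
  unfolding val_indep_def
proof (intro allI impI)
  fix c \<gamma> i
  assume le: "\<gamma> \<le> val (\<Sum>i<Suc n. scale (c i) ((u(n := u')) i))" and i: "i < Suc n" "c i \<noteq> 0"
  let ?S = "\<lambda>c. \<Sum>i<n. scale (c i) (u i)"
  have le: "\<gamma> \<le> val (?S c + scale (c n) u')" using le by simp
  have "\<gamma> \<le> val u'" if "c n \<noteq> 0"
  proof -
    have "scale (1 / c n) (?S c + scale (c n) u') = u' + ?S (\<lambda>i. c i / c n)"
      using that by (simp add: scale_right_distrib scale_sum_right)
    then have "\<gamma> \<le> val (u' + ?S (\<lambda>i. c i / c n))"
      using le that val_scale[of "1 / c n" "?S c + scale (c n) u'"] by simp
    then show ?thesis using u' by (rule order_trans)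
  qed
  then have *: "\<gamma> \<le> val (scale (c n) u')" by (cases "c n = 0") (auto intro: le_val_scale)
  then have "\<gamma> \<le> val (?S c)" using le_val_diff[OF le *] by simp
  then show "\<gamma> \<le> val ((u(n := u')) i)"
    using i \<open>c n \<noteq> 0 \<Longrightarrow> \<gamma> \<le> val u'\<close> val_indepD[OF u] by (cases "i = n") auto
qed

text \<open>A Gram-Schmidt step with best approximation in place of orthogonal projection;
  \<open>u'\<close> is the remainder of \<open>x\<close>.\<close>

lemma val_indep_extend:
  assumes u: "val_indep n u"
  obtains c u' where "x = (\<Sum>i<n. scale (c i) (u i)) + u'" "val_indep (Suc n) (u(n := u'))"
proof -
  obtain w where w: "w \<in> span (u ` {..<n})" "\<And>w'. w' \<in> span (u ` {..<n}) \<Longrightarrow> val (x + w') \<le> val (x + w)"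
    using best_approximation[of "u ` {..<n}" x] by auto
  obtain c where c: "- w = (\<Sum>i<n. scale (c i) (u i))"
    using span_neg[OF w(1)] in_span_image_iff[of "{..<n}" "- w" u] by auto
  show ?thesis
  proof (rule that)
    show "x = (\<Sum>i<n. scale (c i) (u i)) + (x + w)" by (simp add: c[symmetric])
    show "val_indep (Suc n) (u(n := x + w))"
    proof (rule val_indep_SucI[OF u])
      fix d
      have "(\<Sum>i<n. scale (d i) (u i)) \<in> span (u ` {..<n})"
        using in_span_image_iff[of "{..<n}" _ u] by auto
      then have "w + (\<Sum>i<n. scale (d i) (u i)) \<in> span (u ` {..<n})" using w(1) span_add by blast
      from w(2)[OF this] show "val (x + w + (\<Sum>i<n. scale (d i) (u i))) \<le> val (x + w)"
        by (simp add: add.assoc)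
    qed
  qed
qed

text \<open>Iterating the Gram-Schmidt step gives exactly \<open>card J\<close> vectors, with zeros
  where the given ones are dependent. Both inclusions are recorded: one writes the given vectors in
  coordinates, the other transports the basis along an isometry.\<close>

lemma val_indep_generators:
  assumes "finite J"
  obtains u where "val_indep (card J) u" "u ` {..<card J} \<subseteq> span (v ` J)" "v ` J \<subseteq> span (u ` {..<card J})"
proof -
  have "\<exists>u. val_indep (card J) u \<and> u ` {..<card J} \<subseteq> span (v ` J) \<and> v ` J \<subseteq> span (u ` {..<card J})"
    using assms
  proof (induction J rule: finite_induct)
    case empty
    show ?case by (simp add: val_indep_def)
  next
    case (insert j J)
    let ?n = "card J"
    obtain u where u: "val_indep ?n u" "u ` {..<?n} \<subseteq> span (v ` J)" "v ` J \<subseteq> span (u ` {..<?n})"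
      using insert.IH by blast
    obtain c u' where c: "v j = (\<Sum>i<?n. scale (c i) (u i)) + u'" "val_indep (Suc ?n) (u(?n := u'))"
      using val_indep_extend[OF u(1)] .
    let ?u = "u(?n := u')"
    have im: "?u ` {..<Suc ?n} = insert u' (u ` {..<?n})" by (auto simp: lessThan_Suc)
    have sum: "(\<Sum>i<?n. scale (c i) (u i)) \<in> span (u ` {..<?n})"
      using in_span_image_iff[of "{..<?n}" _ u] by auto
    have 1: "span (u ` {..<?n}) \<subseteq> span (v ` insert j J)"
      using span_mono[of "v ` J" "v ` insert j J"] u(2) span_mono[OF u(2)] by (auto simp: span_span)
    have "u' = v j - (\<Sum>i<?n. scale (c i) (u i))" by (simp add: c(1))
    also have "\<dots> \<in> span (v ` insert j J)"
      by (rule span_diff) (use sum 1 in \<open>auto intro: span_base\<close>)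
    finally have 2: "?u ` {..<Suc ?n} \<subseteq> span (v ` insert j J)"
      unfolding im using 1 by (auto intro: span_base)
    have 3: "span (u ` {..<?n}) \<subseteq> span (?u ` {..<Suc ?n})" unfolding im by (rule span_mono) auto
    have "v j \<in> span (?u ` {..<Suc ?n})"
      unfolding c(1) by (rule span_add) (use sum 3 in \<open>auto simp: im intro: span_base\<close>)
    then have 4: "v ` insert j J \<subseteq> span (?u ` {..<Suc ?n})" using u(3) 3 by auto
    have n: "card (insert j J) = Suc ?n" using insert.hyps by simp
    show ?case unfolding n using c(2) 2 4 by blast
  qed
  then show ?thesis by (elim exE conjE) (rule that)
qed

section \<open>Residue spaces and their dimension\<close>

abbreviation N :: "'g \<Rightarrow> 'v set" where
  "N \<gamma> \<equiv> insert 0 {z. \<gamma> < val z}"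

lemma N_diff: "x \<in> N \<gamma> \<Longrightarrow> y \<in> N \<gamma> \<Longrightarrow> x - y \<in> N \<gamma>"
  using val_diff[of x y] by (auto simp: min_def split: if_splits)

lemma N_uminus: "x \<in> N \<gamma> \<Longrightarrow> - x \<in> N \<gamma>"
  by auto

lemma N_add: "x \<in> N \<gamma> \<Longrightarrow> y \<in> N \<gamma> \<Longrightarrow> x + y \<in> N \<gamma>"
  using N_diff[of x \<gamma> "- y"] N_uminus[of y \<gamma>] by simp

lemma N_scale: "x \<in> N \<gamma> \<Longrightarrow> scale c x \<in> N \<gamma>"
  by (cases "c = 0") (auto simp: val_scale)

lemma N_sum: "(\<And>i. i \<in> I \<Longrightarrow> f i \<in> N \<gamma>) \<Longrightarrow> sum f I \<in> N \<gamma>"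
proof (induction I rule: infinite_finite_induct)
  case (insert i I)
  have "f i + sum f I \<in> N \<gamma>" by (rule N_add) (use insert in blast)+
  then show ?case using insert.hyps by simp
qed simp_all

lemma res_class_eq_iff: "res_class val \<gamma> x = res_class val \<gamma> y \<longleftrightarrow> x - y \<in> N \<gamma>"
proof
  assume "res_class val \<gamma> x = res_class val \<gamma> y"
  moreover have "x \<in> res_class val \<gamma> x" by (simp add: res_class_def)
  ultimately show "x - y \<in> N \<gamma>" by (simp add: res_class_def)
next
  assume xy: "x - y \<in> N \<gamma>"
  have "z - x \<in> N \<gamma> \<longleftrightarrow> z - y \<in> N \<gamma>" for z
    using N_add[OF xy, of "z - x"] N_diff[of "z - y" \<gamma>, OF _ xy] by auto
  then show "res_class val \<gamma> x = res_class val \<gamma> y" unfolding res_class_def by blast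
qed

text \<open>An indexed version of \<open>res_basis\<close>, stated with representatives instead of
  classes. A family indexed by \<open>{..<n}\<close> can be quantified by \<open>n\<close> vector
  variables, and repetitions are excluded by independence.\<close>

definition res_family :: "'g \<Rightarrow> 'i set \<Rightarrow> ('i \<Rightarrow> 'v) \<Rightarrow> bool" where
  "res_family \<gamma> J v \<longleftrightarrow> (\<forall>j\<in>J. \<gamma> \<le> val (v j)) \<and>
    (\<forall>x. \<gamma> \<le> val x \<longrightarrow> (\<exists>c. x - (\<Sum>j\<in>J. scale (c j) (v j)) \<in> N \<gamma>)) \<and>
    (\<forall>c. (\<Sum>j\<in>J. scale (c j) (v j)) \<in> N \<gamma> \<longrightarrow> (\<forall>j\<in>J. c j = 0))"

lemma res_basis_iff: "res_basis scale val \<gamma> S \<longleftrightarrow> finite S \<and> res_family \<gamma> S (\<lambda>s. s)"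
  unfolding res_basis_def res_family_def B_def by (auto simp: res_class_eq_iff)

lemma res_family_bij:
  assumes "bij_betw h I J"
  shows "res_family \<gamma> I (\<lambda>i. v (h i)) \<longleftrightarrow> res_family \<gamma> J v"
proof -
  have sum: "(\<Sum>i\<in>I. scale (c (h i)) (v (h i))) = (\<Sum>j\<in>J. scale (c j) (v j))" for c
    using sum.reindex_bij_betw[OF assms] .
  have J: "J = h ` I" using assms by (simp add: bij_betw_def)
  have inv: "(\<Sum>i\<in>I. scale (c i) (v (h i))) = (\<Sum>j\<in>J. scale (c (inv_into I h j)) (v j))" for c
    unfolding sum[symmetric] by (rule sum.cong) (use assms in \<open>auto simp: bij_betw_def\<close>)
  have 1: "(\<exists>c. x - (\<Sum>i\<in>I. scale (c i) (v (h i))) \<in> N \<gamma>) \<longleftrightarrow> (\<exists>c. x - (\<Sum>j\<in>J. scale (c j) (v j)) \<in> N \<gamma>)" for x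
    using sum inv by metis
  have 2: "(\<forall>c. (\<Sum>i\<in>I. scale (c i) (v (h i))) \<in> N \<gamma> \<longrightarrow> (\<forall>i\<in>I. c i = 0)) \<longleftrightarrow>
      (\<forall>c. (\<Sum>j\<in>J. scale (c j) (v j)) \<in> N \<gamma> \<longrightarrow> (\<forall>j\<in>J. c j = 0))" (is "?l = ?r")
  proof
    assume l: ?l
    show ?r
    proof (intro allI impI)
      fix c assume "(\<Sum>j\<in>J. scale (c j) (v j)) \<in> N \<gamma>"
      then have "\<forall>i\<in>I. c (h i) = 0" using spec[OF l, of "\<lambda>i. c (h i)"] unfolding sum by (rule rev_mp)
      then show "\<forall>j\<in>J. c j = 0" by (simp add: J)
    qed
  next
    assume r: ?r
    show ?l
    proof (intro allI impI)
      fix c assume "(\<Sum>i\<in>I. scale (c i) (v (h i))) \<in> N \<gamma>"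
      then have "\<forall>j\<in>J. c (inv_into I h j) = 0"
        using spec[OF r, of "\<lambda>j. c (inv_into I h j)"] unfolding inv by (rule rev_mp)
      then show "\<forall>i\<in>I. c i = 0" using assms by (auto simp: bij_betw_def)
    qed
  qed
  show ?thesis unfolding res_family_def 1 2 by (simp add: J)
qed

lemma D_iff: "\<gamma> \<in> D scale val n \<longleftrightarrow> (\<exists>v. res_family \<gamma> {..<n} v)"
proof
  assume "\<gamma> \<in> D scale val n"
  then obtain S where S: "finite S" "res_family \<gamma> S (\<lambda>s. s)" "card S = n"
    unfolding D_def res_basis_iff by blast
  obtain h where "bij_betw h {..<n} S"
    using ex_bij_betw_nat_finite[OF S(1)] S(3) by (auto simp: atLeast0LessThan)
  then show "\<exists>v. res_family \<gamma> {..<n} v" using res_family_bij S(2) by blast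
next
  assume "\<exists>v. res_family \<gamma> {..<n} v"
  then obtain v where v: "res_family \<gamma> {..<n} v" by blast
  then have ind: "c j = 0" if "(\<Sum>k<n. scale (c k) (v k)) \<in> N \<gamma>" "j \<in> {..<n}" for c j
    using that unfolding res_family_def by blast
  have "inj_on v {..<n}"
  proof (rule inj_onI, rule ccontr)
    fix i j assume ij: "i \<in> {..<n}" "j \<in> {..<n}" "v i = v j" "i \<noteq> j"
    let ?c = "\<lambda>k. if k = i then 1 else if k = j then - 1 else 0"
    have "(\<Sum>k<n. scale (?c k) (v k)) = (\<Sum>k<n. (if k = i then v i else 0) - (if k = j then v j else 0))"
      by (rule sum.cong) (use ij in auto)
    also have "\<dots> = 0" using ij by (simp add: sum_subtractf)
    finally have "(\<Sum>k<n. scale (?c k) (v k)) \<in> N \<gamma>" by (rule ssubst) simp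
    from ind[OF this ij(1)] show False by simp
  qed
  then have "bij_betw v {..<n} (v ` {..<n})" "card (v ` {..<n}) = n"
    by (simp_all add: inj_on_imp_bij_betw card_image)
  moreover from this have "res_family \<gamma> (v ` {..<n}) (\<lambda>s. s)"
    using res_family_bij[of v "{..<n}" "v ` {..<n}" \<gamma> "\<lambda>s. s"] v by simp
  ultimately have "res_basis scale val \<gamma> (v ` {..<n})" "card (v ` {..<n}) = n"
    by (simp_all add: res_basis_iff)
  then show "\<gamma> \<in> D scale val n" unfolding D_def by blast
qed

lemma D_iff_card:
  assumes "finite J"
  shows "\<gamma> \<in> D scale val (card J) \<longleftrightarrow> (\<exists>v. res_family \<gamma> J v)"
proof -
  obtain h where h: "bij_betw h {..<card J} J"
    using ex_bij_betw_nat_finite[OF assms] by (auto simp: atLeast0LessThan)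
  then have h': "bij_betw (inv_into {..<card J} h) J {..<card J}" by (rule bij_betw_inv_into)
  show ?thesis unfolding D_iff
  proof
    assume "\<exists>v. res_family \<gamma> {..<card J} v"
    then show "\<exists>v. res_family \<gamma> J v" using res_family_bij[OF h'] by blast
  next
    assume "\<exists>v. res_family \<gamma> J v"
    then show "\<exists>v. res_family \<gamma> {..<card J} v" using res_family_bij[OF h] by blast
  qed
qed

text \<open>Turns independence of an indexed family into injectivity and independence of its image,
  so that the bound by the size of a spanning set applies.\<close>

lemma independent_family:
  assumes "finite I" "\<And>c i. (\<Sum>i\<in>I. scale (c i) (w i)) = 0 \<Longrightarrow> i \<in> I \<Longrightarrow> c i = 0"
  shows "inj_on w I" "independent (w ` I)"
proof -
  show inj: "inj_on w I"
  proof (rule inj_onI, rule ccontr)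
    fix i j assume ij: "i \<in> I" "j \<in> I" "w i = w j" "i \<noteq> j"
    let ?c = "\<lambda>k. if k = i then 1 else if k = j then - 1 else 0"
    have "(\<Sum>k\<in>I. scale (?c k) (w k)) = (\<Sum>k\<in>I. (if k = i then w i else 0) - (if k = j then w j else 0))"
      by (rule sum.cong) (use ij in auto)
    also have "\<dots> = 0" using ij assms(1) by (simp add: sum_subtractf)
    finally have "(\<Sum>k\<in>I. scale (?c k) (w k)) = 0" .
    from assms(2)[OF this ij(1)] show False by simp
  qed
  show "independent (w ` I)"
  proof (rule independent_if_scalars_zero)
    show "finite (w ` I)" using assms(1) by simp
    fix f x assume f: "(\<Sum>x\<in>w ` I. scale (f x) x) = 0" and x: "x \<in> w ` I"
    from f have "(\<Sum>i\<in>I. scale (f (w i)) (w i)) = 0" by (simp add: sum.reindex[OF inj])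
    then show "f x = 0" using assms(2)[of "\<lambda>i. f (w i)"] x by blast
  qed
qed

text \<open>The residues of the \<open>u i\<close> of value \<open>\<gamma>\<close> are linearly independent in \<open>B val \<gamma>\<close>, so they span it iff
  their number is its dimension.\<close>

lemma val_indep_extend_iff:
  assumes u: "val_indep n u"
  shows "(\<exists>u'. val u' = \<gamma> \<and> val_indep (Suc n) (u(n := u'))) \<longleftrightarrow>
    \<gamma> = top \<or> \<gamma> \<notin> D scale val (card {i. i < n \<and> val (u i) = \<gamma>})" (is "?l \<longleftrightarrow> ?r")
proof -
  define S where "S = {i. i < n \<and> val (u i) = \<gamma>}"
  have finS: "finite S" by (simp add: S_def)
  show ?thesis
  proof
    assume ?l
    then obtain u' where u': "val u' = \<gamma>" "val_indep (Suc n) (u(n := u'))" by blast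
    let ?u = "u(n := u')"
    show ?r
    proof (rule ccontr)
      assume "\<not> ?r"
      then have \<gamma>: "\<gamma> < top" and "\<gamma> \<in> D scale val (card S)"
        by (auto simp: S_def top.not_eq_extremum)
      then obtain T where T: "finite T" "res_family \<gamma> T (\<lambda>s. s)" "card T = card S"
        unfolding D_def res_basis_iff by blast
      let ?I = "insert n S"
      have nS: "n \<notin> S" by (simp add: S_def)
      have valI: "val (?u i) = \<gamma>" if "i \<in> ?I" for i using that u' by (auto simp: S_def)
      \<comment> \<open>Each of the \<open>card S + 1\<close> vectors of value
        \<open>\<gamma>\<close> is replaced by a representative \<open>w i\<close> in the span of
        \<open>T\<close>. A nontrivial relation between the \<open>w i\<close> would give a
        combination of the original vectors of value above \<open>\<gamma>\<close>. So the
        \<open>w i\<close> are independent, which contradicts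
        \<open>card T = card S\<close>.\<close>
      have "\<exists>w\<in>span T. ?u i - w \<in> N \<gamma>" if i: "i \<in> ?I" for i
      proof -
        obtain c where "?u i - (\<Sum>s\<in>T. scale (c s) s) \<in> N \<gamma>"
          using T(2) valI[OF i] unfolding res_family_def by (meson order_refl)
        then show ?thesis by (intro bexI[of _ "\<Sum>s\<in>T. scale (c s) s"]) (auto intro: span_sum span_scale span_base)
      qed
      then obtain w where w: "\<And>i. i \<in> ?I \<Longrightarrow> w i \<in> span T" "\<And>i. i \<in> ?I \<Longrightarrow> ?u i - w i \<in> N \<gamma>"
        by metis
      have zero: "c i = 0" if c: "(\<Sum>i\<in>?I. scale (c i) (w i)) = 0" and i: "i \<in> ?I" for c i
      proof (rule ccontr)
        assume ci: "c i \<noteq> 0"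
        let ?c = "\<lambda>i. if i \<in> ?I then c i else 0"
        have "(\<Sum>i<Suc n. scale (?c i) (?u i)) = (\<Sum>i\<in>?I. scale (?c i) (?u i))"
          by (rule sum.mono_neutral_right) (auto simp: S_def)
        also have "\<dots> = (\<Sum>i\<in>?I. scale (c i) (?u i))" by (rule sum.cong) auto
        also have "\<dots> = (\<Sum>i\<in>?I. scale (c i) (?u i - w i))"
          using c by (simp add: scale_right_diff_distrib sum_subtractf)
        also have "\<dots> \<in> N \<gamma>" by (intro N_sum N_scale w(2))
        finally have *: "\<gamma> < val (\<Sum>i<Suc n. scale (?c i) (?u i))" using \<gamma> by auto
        have "val (\<Sum>i<Suc n. scale (?c i) (?u i)) \<le> val (?u i)"
          by (rule val_indepD[OF u'(2) order_refl]) (use i ci in \<open>auto simp: S_def\<close>)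
        then show False using * valI[OF i] by simp
      qed
      have finI: "finite ?I" using finS by simp
      have ind: "inj_on w ?I" "independent (w ` ?I)"
        by (rule independent_family[OF finI], erule zero, assumption)+
      have "card (w ` ?I) \<le> card T"
        using independent_span_bound[OF T(1) ind(2)] w(1) by blast
      then show False using finS nS T(3) unfolding card_image[OF ind(1)] by simp
    qed
  next
    assume r: ?r
    show ?l
    proof (cases "\<gamma> = top")
      case True
      have "val_indep (Suc n) (u(n := 0))" by (rule val_indep_SucI[OF u]) simp
      then show ?thesis using True by (intro exI[of _ 0]) simp
    next
      case False
      then have \<gamma>: "\<gamma> < top" by (simp add: top.not_eq_extremum)
      have "\<not> res_family \<gamma> S u" using r False D_iff_card[OF finS] by (auto simp: S_def)
      moreover have "c j = 0" if c: "(\<Sum>j\<in>S. scale (c j) (u j)) \<in> N \<gamma>" and j: "j \<in> S" for c j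
      proof (rule ccontr)
        assume cj: "c j \<noteq> 0"
        let ?c = "\<lambda>i. if i \<in> S then c i else 0"
        have "(\<Sum>i<n. scale (?c i) (u i)) = (\<Sum>i\<in>S. scale (?c i) (u i))"
          by (rule sum.mono_neutral_right) (auto simp: S_def)
        also have "\<dots> = (\<Sum>i\<in>S. scale (c i) (u i))" by (rule sum.cong) auto
        finally have *: "\<gamma> < val (\<Sum>i<n. scale (?c i) (u i))" using \<gamma> c by auto
        have "val (\<Sum>i<n. scale (?c i) (u i)) \<le> val (u j)"
          by (rule val_indepD[OF u order_refl]) (use j cj in \<open>auto simp: S_def\<close>)
        then show False using * j by (simp add: S_def)
      qed
      \<comment> \<open>The residues indexed by \<open>S\<close> are independent but are not a
        basis, because \<open>\<gamma>\<close> is not in \<open>D\<close> for their number. Hence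
        they miss the residue of some \<open>x\<close>.\<close>
      ultimately obtain x where x: "\<gamma> \<le> val x" "\<And>c. x - (\<Sum>j\<in>S. scale (c j) (u j)) \<notin> N \<gamma>"
        unfolding res_family_def by (auto simp: S_def)
      have "x \<notin> N \<gamma>" using x(2)[of "\<lambda>_. 0"] by simp
      then have val_x: "val x = \<gamma>" using x(1) by auto
      have "val (x + (\<Sum>i<n. scale (c i) (u i))) \<le> val x" for c
      proof (rule ccontr)
        let ?y = "\<Sum>i<n. scale (c i) (u i)"
        assume "\<not> val (x + ?y) \<le> val x"
        then have less: "\<gamma> < val (x + ?y)" by (simp add: val_x)
        then have "\<gamma> \<le> val ?y" using le_val_diff[of \<gamma> "x + ?y" x] val_x by simp
        then have ge: "\<gamma> \<le> val (u i)" if "i < n" "c i \<noteq> 0" for i using that val_indepD[OF u] by blast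
        \<comment> \<open>A vector outside \<open>S\<close> with nonzero coefficient has value above
          \<open>\<gamma>\<close>, so modulo \<open>N \<gamma>\<close> only the part indexed by
          \<open>S\<close> remains.\<close>
        have "?y = (\<Sum>i\<in>S. scale (c i) (u i)) + (\<Sum>i\<in>{..<n} - S. scale (c i) (u i))"
          using sum.subset_diff[of S "{..<n}" "\<lambda>i. scale (c i) (u i)"] by (auto simp: S_def add.commute)
        moreover have "(\<Sum>i\<in>{..<n} - S. scale (c i) (u i)) \<in> N \<gamma>"
        proof (rule N_sum)
          fix i assume i: "i \<in> {..<n} - S"
          show "scale (c i) (u i) \<in> N \<gamma>"
          proof (cases "c i = 0")
            case False
            then show ?thesis using i ge[of i] by (intro N_scale) (auto simp: S_def)
          qed simp
        qed
        moreover have "x + ?y \<in> N \<gamma>" using less by simp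
        ultimately have "x + (\<Sum>i\<in>S. scale (c i) (u i)) \<in> N \<gamma>"
          using N_diff[of "x + ?y" \<gamma> "\<Sum>i\<in>{..<n} - S. scale (c i) (u i)"]
          by (simp only: add.assoc[symmetric] add_diff_cancel_right')
        then show False using x(2)[of "\<lambda>i. - c i"] by (simp add: sum_negf)
      qed
      then show ?thesis using val_indep_SucI[OF u] val_x by blast
    qed
  qed
qed

end

section \<open>Separating the base field from the value set\<close>

locale vvs_structure = valued_vector_space scale val
  for scale :: "'k::field \<Rightarrow> 'v::ab_group_add \<Rightarrow> 'v" and val :: "'v \<Rightarrow> 'g::{linorder, order_top}" +
  fixes arK :: "'rk \<Rightarrow> nat option" and RK :: "'rk \<Rightarrow> 'k list \<Rightarrow> bool"
    and arG :: "'rg \<Rightarrow> nat option" and RG :: "'rg \<Rightarrow> 'g list \<Rightarrow> bool"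
begin

abbreviation "LV \<equiv> vvs_lang arK arG"
abbreviation "MV \<equiv> vvs_struct scale val RK RG"
abbreviation "LK \<equiv> field_lang arK"
abbreviation "MK \<equiv> field_struct RK"
abbreviation "LG \<equiv> value_lang arG"
abbreviation "MG \<equiv> value_struct scale val RG"

lemma struct_simps [simp]:
  "univ MK s = UNIV" "fun_int MK = field_int" "rel_int MK = RK"
  "univ MG s = UNIV" "fun_int MG f xs = top" "rel_int MG = value_rel_int scale val RG"
  "univ MV s' = vvs_univ s'" "fun_int MV = vvs_fun_int scale val" "rel_int MV = vvs_rel_int RK RG"
  by (simp_all add: field_struct_def value_struct_def vvs_struct_def)

lemma lang_simps [simp]:
  "fun_sig LK f = Some (field_sig f)" "rel_sig LK r = map_option (\<lambda>n. replicate n ()) (arK r)"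
  "fun_sig LG f' = Some ([], ())" "rel_sig LG = value_rel_sig arG"
  "fun_sig LV h = Some (vvs_fun_sig h)" "rel_sig LV = vvs_rel_sig arK arG"
  by (simp_all add: field_lang_def value_lang_def vvs_lang_def)

lemma assignment_simps [simp]: "assignment MK e" "assignment MG e'"
  by (simp_all add: assignment_def)

lemma tmK_add: "tm_definable LK MK () f \<Longrightarrow> tm_definable LK MK () g \<Longrightarrow> tm_definable LK MK () (\<lambda>k. f k + g k)"
  using tm_definable_fn[of LK FAdd "[(), ()]" "()" MK "[f, g]"] by simp

lemma tmK_mult: "tm_definable LK MK () f \<Longrightarrow> tm_definable LK MK () g \<Longrightarrow> tm_definable LK MK () (\<lambda>k. f k * g k)"
  using tm_definable_fn[of LK FMul "[(), ()]" "()" MK "[f, g]"] by simp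

lemma tmK_0: "tm_definable LK MK () (\<lambda>k. 0)"
  using tm_definable_fn[of LK FZero "[]" "()" MK "[]"] by simp

lemma tmK_1: "tm_definable LK MK () (\<lambda>k. 1)"
  using tm_definable_fn[of LK FOne "[]" "()" MK "[]"] by simp

lemma tmG_top: "tm_definable LG MG () (\<lambda>g. top)"
  using tm_definable_fn[of LG GInf "[]" "()" MG "[]"] by simp

lemma definableG_less:
  "tm_definable LG MG () f \<Longrightarrow> tm_definable LG MG () h \<Longrightarrow> definable LG MG (\<lambda>g. f g < h g)"
  using definable_rel[of LG GLess "[(), ()]" MG "[f, h]"] by simp

lemma definableG_le:
  "tm_definable LG MG () f \<Longrightarrow> tm_definable LG MG () h \<Longrightarrow> definable LG MG (\<lambda>g. f g \<le> h g)"
  using definable_not[OF definableG_less[of h f]] by (simp add: not_less)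

lemma definableG_D: "tm_definable LG MG () f \<Longrightarrow> definable LG MG (\<lambda>g. f g \<in> D scale val n)"
  using definable_rel[of LG "GDim n" "[()]" MG "[f]"] by simp

text \<open>Tuples of vectors are represented by their coordinates with respect to a valuation-independent
  family \<open>u\<close>: \<open>kvar i\<close> stands for the field variable \<open>i\<close>, \<open>kcoord j i\<close> for the coordinate at
  \<open>u i\<close> of the vector variable \<open>j\<close>, \<open>gvar i\<close> for the value variable \<open>i\<close>, and \<open>gbas i\<close> for the
  value of \<open>u i\<close>.\<close>

definition kvar :: "nat \<Rightarrow> unit \<times> nat" where "kvar i = ((), 2 * i)"
definition kcoord :: "nat \<Rightarrow> nat \<Rightarrow> unit \<times> nat" where "kcoord j i = ((), 2 * prod_encode (j, i) + 1)"
definition gvar :: "nat \<Rightarrow> unit \<times> nat" where "gvar i = ((), 2 * i)"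
definition gbas :: "nat \<Rightarrow> unit \<times> nat" where "gbas i = ((), 2 * i + 1)"

lemma var_simps [simp]:
  "kvar i = kvar i' \<longleftrightarrow> i = i'" "kcoord j i = kcoord j' i' \<longleftrightarrow> j = j' \<and> i = i'"
  "kvar i \<noteq> kcoord j i'" "kcoord j i' \<noteq> kvar i"
  "gvar i = gvar i' \<longleftrightarrow> i = i'" "gbas i = gbas i' \<longleftrightarrow> i = i'" "gvar i \<noteq> gbas i'" "gbas i' \<noteq> gvar i"
  unfolding kvar_def kcoord_def gvar_def gbas_def by simp_all presburger+

definition asg :: "nat \<Rightarrow> (nat \<Rightarrow> 'v) \<Rightarrow> (unit \<times> nat \<Rightarrow> 'k) \<Rightarrow> (unit \<times> nat \<Rightarrow> 'g) \<Rightarrow>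
    vvs_sort \<times> nat \<Rightarrow> ('k, 'v, 'g) elem" where
  "asg n u k g = (\<lambda>(s, i). case s of
     SK \<Rightarrow> InK (k (kvar i))
   | SV \<Rightarrow> InV (\<Sum>l<n. scale (k (kcoord i l)) (u l))
   | SG \<Rightarrow> InG (g (gvar i)))"

lemma asg_simps [simp]:
  "asg n u k g (SK, i) = InK (k (kvar i))"
  "asg n u k g (SV, i) = InV (\<Sum>l<n. scale (k (kcoord i l)) (u l))"
  "asg n u k g (SG, i) = InG (g (gvar i))"
  by (simp_all add: asg_def)

text \<open>The entries \<open>gbas l\<close> of \<open>g\<close> are not read by
  \<open>asg\<close>; this condition ties them to the values of \<open>u\<close>, so that predicates
  of the value set can refer to the basis.\<close>

definition val_frame :: "nat \<Rightarrow> (nat \<Rightarrow> 'v) \<Rightarrow> (unit \<times> nat \<Rightarrow> 'g) \<Rightarrow> bool" where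
  "val_frame n u g \<longleftrightarrow> val_indep n u \<and> (\<forall>l<n. g (gbas l) = val (u l))"

section \<open>Translation of terms into coordinates and values\<close>

abbreviation "rect \<equiv> rectangular LK MK LG MG"

text \<open>\<open>Q\<close> is the same for all \<open>u\<close>: the basis enters only through its
  length \<open>n\<close> and the values in \<open>g\<close>. This uniformity is what makes truth
  invariant under isometry.\<close>

definition translates :: "nat \<Rightarrow> ((vvs_sort \<times> nat \<Rightarrow> ('k, 'v, 'g) elem) \<Rightarrow> bool) \<Rightarrow> bool" where
  "translates n P \<longleftrightarrow> (\<exists>Q. rect Q \<and> (\<forall>u k g. val_frame n u g \<longrightarrow> P (asg n u k g) = Q k g))"

lemma translatesI: "rect Q \<Longrightarrow> (\<And>u k g. val_frame n u g \<Longrightarrow> P (asg n u k g) = Q k g) \<Longrightarrow> translates n P"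
  unfolding translates_def by blast

lemma translatesD:
  "translates n P \<Longrightarrow> \<exists>Q. rect Q \<and> (\<forall>u k g. val_frame n u g \<longrightarrow> P (asg n u k g) = Q k g)"
  unfolding translates_def .

text \<open>Field terms and the coordinates of vector terms are given by terms of the field,
  whatever \<open>u\<close> is. A value term can be a minimum over the basis vectors with
  nonvanishing coefficient, hence it need not be a single term: it is given by finitely many pairs
  of a condition and a term, which cover everything and agree where they overlap.\<close>

definition tm_translates :: "nat \<Rightarrow> vvs_sort \<Rightarrow> (vvs_sort, vvs_fun) tm \<Rightarrow> bool" where
  "tm_translates n s t \<longleftrightarrow> (case s of
     SK \<Rightarrow> \<exists>f. tm_definable LK MK () f \<and> (\<forall>u k g. eval_tm MV (asg n u k g) t = InK (f k))
   | SV \<Rightarrow> \<exists>c. (\<forall>l. tm_definable LK MK () (c l)) \<and>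
       (\<forall>u k g. eval_tm MV (asg n u k g) t = InV (\<Sum>l<n. scale (c l k) (u l)))
   | SG \<Rightarrow> \<exists>S. finite S \<and> (\<forall>x\<in>S. rect (fst x) \<and> tm_definable LG MG () (snd x)) \<and>
       (\<forall>u k g. val_frame n u g \<longrightarrow> (\<exists>x\<in>S. fst x k g) \<and>
         (\<forall>x\<in>S. fst x k g \<longrightarrow> eval_tm MV (asg n u k g) t = InG (snd x g))))"

lemma tm_translates_SK:
  "tm_definable LK MK () f \<Longrightarrow> (\<And>u k g. eval_tm MV (asg n u k g) t = InK (f k)) \<Longrightarrow> tm_translates n SK t"
  unfolding tm_translates_def by auto

lemma tm_translates_SV:
  "(\<And>l. tm_definable LK MK () (c l)) \<Longrightarrow>
    (\<And>u k g. eval_tm MV (asg n u k g) t = InV (\<Sum>l<n. scale (c l k) (u l))) \<Longrightarrow> tm_translates n SV t"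
  unfolding tm_translates_def by auto

lemma tm_translates_SG_const:
  "tm_definable LG MG () f \<Longrightarrow> (\<And>u k g. eval_tm MV (asg n u k g) t = InG (f g)) \<Longrightarrow> tm_translates n SG t"
  unfolding tm_translates_def
  by (auto intro!: exI[of _ "{(\<lambda>_ _. True, f)}"] simp: rectangular_const)

lemma tm_translates_SKD:
  "tm_translates n SK t \<Longrightarrow>
    \<exists>f. tm_definable LK MK () f \<and> (\<forall>u k g. eval_tm MV (asg n u k g) t = InK (f k))"
  unfolding tm_translates_def by simp

lemma tm_translates_SVD:
  "tm_translates n SV t \<Longrightarrow>
    \<exists>c. (\<forall>l. tm_definable LK MK () (c l)) \<and>
      (\<forall>u k g. eval_tm MV (asg n u k g) t = InV (\<Sum>l<n. scale (c l k) (u l)))"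
  unfolding tm_translates_def by simp

lemma rect_tm_eq: "tm_definable LK MK () f \<Longrightarrow> tm_definable LK MK () h \<Longrightarrow> rect (\<lambda>k g. f k = h k)"
  by (intro rectangular_left definable_eq)

lemma tm_gbas: "tm_definable LG MG () (\<lambda>g. g (gbas l))"
  unfolding gbas_def by (rule tm_definable_var)

text \<open>The value of a linear combination of \<open>u\<close> is the least value of a \<open>u l\<close> with nonzero coefficient.\<close>

lemma tm_translates_Val:
  assumes "tm_translates n SV t"
  shows "tm_translates n SG (Fn Val [t])"
proof -
  obtain c where c: "\<And>l. tm_definable LK MK () (c l)"
    and t: "\<And>u k g. eval_tm MV (asg n u k g) t = InV (\<Sum>l<n. scale (c l k) (u l))"
    using tm_translates_SVD[OF assms] by blast
  let ?top = "\<lambda>k (g :: unit \<times> nat \<Rightarrow> 'g). \<forall>l\<in>{..<n}. c l k = 0"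
  let ?inf = "\<lambda>g :: unit \<times> nat \<Rightarrow> 'g. top :: 'g"
  let ?min = "\<lambda>l k (g :: unit \<times> nat \<Rightarrow> 'g). c l k \<noteq> 0 \<and> (\<forall>m\<in>{..<n}. c m k = 0 \<or> g (gbas l) \<le> g (gbas m))"
  let ?S = "insert (?top, ?inf) ((\<lambda>l. (?min l, \<lambda>g. g (gbas l))) ` {..<n})"
  have r0: "rect (\<lambda>k g. c l k = 0)" for l by (rule rect_tm_eq[OF c tmK_0])
  have rtop: "rect ?top" by (intro rectangular_ball r0) simp
  have rmin: "rect (?min l)" for l
    by (intro rectangular_and rectangular_not r0 rectangular_ball rectangular_or rectangular_right
        definableG_le tm_gbas) simp
  have "(\<exists>x\<in>?S. fst x k g) \<and> (\<forall>x\<in>?S. fst x k g \<longrightarrow> eval_tm MV (asg n u k g) (Fn Val [t]) = InG (snd x g))"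
    if f: "val_frame n u g" for u k g
  proof
    have u: "val_indep n u" "\<And>l. l < n \<Longrightarrow> g (gbas l) = val (u l)" using f by (auto simp: val_frame_def)
    show "\<exists>x\<in>?S. fst x k g"
    proof (cases "\<forall>l<n. c l k = 0")
      case False
      let ?L = "{l. l < n \<and> c l k \<noteq> 0}"
      have "finite ?L" "?L \<noteq> {}" using False by auto
      then have "Min ((\<lambda>l. g (gbas l)) ` ?L) \<in> (\<lambda>l. g (gbas l)) ` ?L" by (intro Min_in) auto
      then obtain l where l: "l \<in> ?L" "Min ((\<lambda>l. g (gbas l)) ` ?L) = g (gbas l)" by blast
      have "g (gbas l) \<le> g (gbas m)" if "m \<in> ?L" for m
        unfolding l(2)[symmetric] by (rule Min_le) (use that in auto)
      then have "?min l k g" using l(1) by blast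
      then show ?thesis using l(1) by auto
    qed auto
    show "\<forall>x\<in>?S. fst x k g \<longrightarrow> eval_tm MV (asg n u k g) (Fn Val [t]) = InG (snd x g)"
    proof (intro ballI impI)
      fix x assume x: "x \<in> ?S" "fst x k g"
      have "val (\<Sum>l<n. scale (c l k) (u l)) = snd x g"
      proof -
        consider "x = (?top, ?inf)" | l where "l < n" "x = (?min l, \<lambda>g. g (gbas l))" using x(1) by auto
        then show ?thesis
        proof cases
          case 1
          then show ?thesis using x(2) by simp
        next
          case 2
          then have l: "c l k \<noteq> 0" "\<And>m. m < n \<Longrightarrow> c m k \<noteq> 0 \<Longrightarrow> val (u l) \<le> val (u m)"
            using x(2) u(2) by auto
          have "val (\<Sum>l<n. scale (c l k) (u l)) = val (u l)"
          proof (rule antisym)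
            show "val (\<Sum>l<n. scale (c l k) (u l)) \<le> val (u l)"
              using l(1) 2(1) by (intro val_indepD[OF u(1) order_refl, of l]) simp_all
            show "val (u l) \<le> val (\<Sum>l<n. scale (c l k) (u l))"
              by (subst val_indep_le_iff[OF u(1)]) (use l(2) in blast)
          qed
          then show ?thesis using 2 u(2) by simp
        qed
      qed
      then show "eval_tm MV (asg n u k g) (Fn Val [t]) = InG (snd x g)" by (simp add: t)
    qed
  qed
  moreover have "\<forall>x\<in>?S. rect (fst x) \<and> tm_definable LG MG () (snd x)"
    using rtop rmin tmG_top tm_gbas by auto
  moreover have "finite ?S" by simp
  ultimately show ?thesis unfolding tm_translates_def vvs_sort.case
    by (intro exI[of _ ?S] conjI) simp_all
qed

lemma tm_sort_translates: "tm_sort LV t s \<Longrightarrow> tm_translates n s t"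
proof (induction rule: tm_sort.induct)
  case (1 s i)
  show ?case
  proof (cases s)
    case SK
    show ?thesis unfolding SK
      by (rule tm_translates_SK[of "\<lambda>k. k (kvar i)"]) (auto simp: kvar_def intro: tm_definable_var)
  next
    case SV
    show ?thesis unfolding SV
      by (rule tm_translates_SV[of "\<lambda>l k. k (kcoord i l)"]) (auto simp: kcoord_def intro: tm_definable_var)
  next
    case SG
    show ?thesis unfolding SG
      by (rule tm_translates_SG_const[of "\<lambda>g. g (gvar i)"]) (auto simp: gvar_def intro: tm_definable_var)
  qed
next
  case (2 f ss s ts)
  then have sig: "vvs_fun_sig f = (ss, s)" and ts: "list_all2 (\<lambda>t s. tm_translates n s t) ts ss"
    by (auto elim: list_all2_mono)
  show ?case
  proof (cases f)
    case VAdd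
    then obtain a b where ab: "ts = [a, b]" "tm_translates n SV a" "tm_translates n SV b" and s: "s = SV"
      using sig ts by (auto simp: list_all2_Cons2)
    obtain c where "\<forall>l. tm_definable LK MK () (c l)"
      "\<forall>u k g. eval_tm MV (asg n u k g) a = InV (\<Sum>l<n. scale (c l k) (u l))"
      using tm_translates_SVD[OF ab(2)] by (elim exE conjE) (rule that)
    note c = this[rule_format]
    obtain d where "\<forall>l. tm_definable LK MK () (d l)"
      "\<forall>u k g. eval_tm MV (asg n u k g) b = InV (\<Sum>l<n. scale (d l k) (u l))"
      using tm_translates_SVD[OF ab(3)] by (elim exE conjE) (rule that)
    note d = this[rule_format]
    show ?thesis unfolding s
      by (rule tm_translates_SV[of "\<lambda>l k. c l k + d l k"])
        (simp_all add: tmK_add c d ab VAdd scale_left_distrib sum.distrib)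
  next
    case VZero
    then have "ts = []" "s = SV" using sig ts by auto
    then show ?thesis using VZero
      by (auto intro!: tm_translates_SV[of "\<lambda>l k. 0"] simp: tmK_0)
  next
    case KAdd
    then obtain a b where ab: "ts = [a, b]" "tm_translates n SK a" "tm_translates n SK b" and s: "s = SK"
      using sig ts by (auto simp: list_all2_Cons2)
    obtain c where "tm_definable LK MK () c" "\<forall>u k g. eval_tm MV (asg n u k g) a = InK (c k)"
      using tm_translates_SKD[OF ab(2)] by (elim exE conjE) (rule that)
    note c = this[rule_format]
    obtain d where "tm_definable LK MK () d" "\<forall>u k g. eval_tm MV (asg n u k g) b = InK (d k)"
      using tm_translates_SKD[OF ab(3)] by (elim exE conjE) (rule that)
    note d = this[rule_format]
    show ?thesis unfolding s
      by (rule tm_translates_SK[of "\<lambda>k. c k + d k"]) (simp_all add: tmK_add c d ab KAdd)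
  next
    case KMul
    then obtain a b where ab: "ts = [a, b]" "tm_translates n SK a" "tm_translates n SK b" and s: "s = SK"
      using sig ts by (auto simp: list_all2_Cons2)
    obtain c where "tm_definable LK MK () c" "\<forall>u k g. eval_tm MV (asg n u k g) a = InK (c k)"
      using tm_translates_SKD[OF ab(2)] by (elim exE conjE) (rule that)
    note c = this[rule_format]
    obtain d where "tm_definable LK MK () d" "\<forall>u k g. eval_tm MV (asg n u k g) b = InK (d k)"
      using tm_translates_SKD[OF ab(3)] by (elim exE conjE) (rule that)
    note d = this[rule_format]
    show ?thesis unfolding s
      by (rule tm_translates_SK[of "\<lambda>k. c k * d k"]) (simp_all add: tmK_mult c d ab KMul)
  next
    case KZero
    then have "ts = []" "s = SK" using sig ts by auto
    then show ?thesis using KZero by (auto intro!: tm_translates_SK[of "\<lambda>k. 0"] simp: tmK_0)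
  next
    case KOne
    then have "ts = []" "s = SK" using sig ts by auto
    then show ?thesis using KOne by (auto intro!: tm_translates_SK[of "\<lambda>k. 1"] simp: tmK_1)
  next
    case Inf
    then have "ts = []" "s = SG" using sig ts by auto
    then show ?thesis using Inf by (auto intro!: tm_translates_SG_const[of "\<lambda>g. top"] simp: tmG_top)
  next
    case Scal
    then obtain a b where ab: "ts = [a, b]" "tm_translates n SK a" "tm_translates n SV b" and s: "s = SV"
      using sig ts by (auto simp: list_all2_Cons2)
    obtain c where "tm_definable LK MK () c" "\<forall>u k g. eval_tm MV (asg n u k g) a = InK (c k)"
      using tm_translates_SKD[OF ab(2)] by (elim exE conjE) (rule that)
    note c = this[rule_format]
    obtain d where "\<forall>l. tm_definable LK MK () (d l)"
      "\<forall>u k g. eval_tm MV (asg n u k g) b = InV (\<Sum>l<n. scale (d l k) (u l))"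
      using tm_translates_SVD[OF ab(3)] by (elim exE conjE) (rule that)
    note d = this[rule_format]
    show ?thesis unfolding s
      by (rule tm_translates_SV[of "\<lambda>l k. c k * d l k"])
        (simp_all add: tmK_mult c d ab Scal scale_sum_right)
  next
    case Val
    then obtain a where "ts = [a]" "tm_translates n SV a" "s = SG"
      using sig ts by (auto simp: list_all2_Cons2)
    then show ?thesis using Val tm_translates_Val by simp
  qed
qed

lemma SG_terms_translate:
  assumes "\<And>t. t \<in> set ts \<Longrightarrow> tm_sort LV t SG"
  shows "\<exists>S. finite S \<and>
    (\<forall>x\<in>S. rect (fst x) \<and> list_all2 (tm_definable LG MG) (replicate (length ts) ()) (snd x)) \<and>
    (\<forall>u k g. val_frame n u g \<longrightarrow> (\<exists>x\<in>S. fst x k g) \<and>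
      (\<forall>x\<in>S. fst x k g \<longrightarrow> map (\<lambda>t. the_G (eval_tm MV (asg n u k g) t)) ts = map (\<lambda>f. f g) (snd x)))"
  using assms
proof (induction ts)
  case Nil
  show ?case by (rule exI[of _ "{(\<lambda>_ _. True, [])}"]) (simp add: rectangular_const)
next
  case (Cons t ts)
  obtain S where "finite S \<and>
    (\<forall>x\<in>S. rect (fst x) \<and> list_all2 (tm_definable LG MG) (replicate (length ts) ()) (snd x)) \<and>
    (\<forall>u k g. val_frame n u g \<longrightarrow> (\<exists>x\<in>S. fst x k g) \<and>
      (\<forall>x\<in>S. fst x k g \<longrightarrow> map (\<lambda>t. the_G (eval_tm MV (asg n u k g) t)) ts = map (\<lambda>f. f g) (snd x)))"
    using Cons.IH[OF Cons.prems[OF list.set_intros(2)]] by (rule exE)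
  then have S: "finite S"
    "\<And>x. x \<in> S \<Longrightarrow> rect (fst x)"
    "\<And>x. x \<in> S \<Longrightarrow> list_all2 (tm_definable LG MG) (replicate (length ts) ()) (snd x)"
    "\<And>u k g. val_frame n u g \<Longrightarrow> \<exists>x\<in>S. fst x k g"
    "\<And>u k g x. val_frame n u g \<Longrightarrow> x \<in> S \<Longrightarrow> fst x k g \<Longrightarrow>
      map (\<lambda>t. the_G (eval_tm MV (asg n u k g) t)) ts = map (\<lambda>f. f g) (snd x)"
    by (simp_all del: map_eq_conv)
  have "tm_translates n SG t" using Cons.prems by (simp add: tm_sort_translates)
  then obtain T where "finite T \<and> (\<forall>x\<in>T. rect (fst x) \<and> tm_definable LG MG () (snd x)) \<and>
      (\<forall>u k g. val_frame n u g \<longrightarrow> (\<exists>x\<in>T. fst x k g) \<and>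
        (\<forall>x\<in>T. fst x k g \<longrightarrow> eval_tm MV (asg n u k g) t = InG (snd x g)))"
    unfolding tm_translates_def vvs_sort.case by (rule exE)
  then have T: "finite T"
    "\<And>x. x \<in> T \<Longrightarrow> rect (fst x)"
    "\<And>x. x \<in> T \<Longrightarrow> tm_definable LG MG () (snd x)"
    "\<And>u k g. val_frame n u g \<Longrightarrow> \<exists>x\<in>T. fst x k g"
    "\<And>u k g x. val_frame n u g \<Longrightarrow> x \<in> T \<Longrightarrow> fst x k g \<Longrightarrow> eval_tm MV (asg n u k g) t = InG (snd x g)"
    by simp_all
  let ?f = "\<lambda>(y, x). (\<lambda>k g. fst y k g \<and> fst x k g, snd y # snd x)"
  let ?S = "?f ` (T \<times> S)"
  have 1: "\<exists>z\<in>?S. fst z k g" if f: "val_frame n u g" for u k g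
  proof -
    obtain y x where "y \<in> T" "fst y k g" "x \<in> S" "fst x k g" using S(4)[OF f] T(4)[OF f] by blast
    then show ?thesis by (intro bexI[of _ "?f (y, x)"]) auto
  qed
  have 2: "map (\<lambda>t. the_G (eval_tm MV (asg n u k g) t)) (t # ts) = map (\<lambda>f. f g) (snd z)"
    if f: "val_frame n u g" and z: "z \<in> ?S" "fst z k g" for u k g z
  proof -
    obtain y x where "y \<in> T" "x \<in> S" and z': "z = ?f (y, x)" using z by blast
    then show ?thesis using S(5)[OF f, of x k] T(5)[OF f, of y k] z(2) by simp
  qed
  have 3: "rect (fst z)" "list_all2 (tm_definable LG MG) (replicate (length (t # ts)) ()) (snd z)"
    if z: "z \<in> ?S" for z
  proof -
    obtain y x where "y \<in> T" "x \<in> S" "z = ?f (y, x)" using z by blast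
    then show "rect (fst z)" "list_all2 (tm_definable LG MG) (replicate (length (t # ts)) ()) (snd z)"
      using S(2,3) T(2,3) by (simp_all add: rectangular_and)
  qed
  have "finite ?S" using S(1) T(1) by simp
  with 1 2 3 show ?case by (intro exI[of _ ?S] conjI ballI allI impI) (simp_all only:)
qed

text \<open>At least one case applies and every applicable case yields the true values, so the
  predicate may be tested in any of them. The finite union over the cases stays rectangular.\<close>

lemma SG_predicate_translates:
  assumes ts: "\<And>t. t \<in> set ts \<Longrightarrow> tm_sort LV t SG"
    and P: "\<And>fs. list_all2 (tm_definable LG MG) (replicate (length ts) ()) fs \<Longrightarrow>
      definable LG MG (\<lambda>g. P (map (\<lambda>f. f g) fs))"
  shows "translates n (\<lambda>e. P (map (\<lambda>t. the_G (eval_tm MV e t)) ts))"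
proof -
  obtain S where "finite S \<and>
    (\<forall>x\<in>S. rect (fst x) \<and> list_all2 (tm_definable LG MG) (replicate (length ts) ()) (snd x)) \<and>
    (\<forall>u k g. val_frame n u g \<longrightarrow> (\<exists>x\<in>S. fst x k g) \<and>
      (\<forall>x\<in>S. fst x k g \<longrightarrow> map (\<lambda>t. the_G (eval_tm MV (asg n u k g) t)) ts = map (\<lambda>f. f g) (snd x)))"
    using SG_terms_translate[of ts n, OF ts] by (rule exE)
  then have S: "finite S"
    "\<And>x. x \<in> S \<Longrightarrow> rect (fst x)"
    "\<And>x. x \<in> S \<Longrightarrow> list_all2 (tm_definable LG MG) (replicate (length ts) ()) (snd x)"
    "\<And>u k g. val_frame n u g \<Longrightarrow> \<exists>x\<in>S. fst x k g"
    "\<And>u k g x. val_frame n u g \<Longrightarrow> x \<in> S \<Longrightarrow> fst x k g \<Longrightarrow>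
      map (\<lambda>t. the_G (eval_tm MV (asg n u k g) t)) ts = map (\<lambda>f. f g) (snd x)"
    by (simp_all del: map_eq_conv)
  show ?thesis
  proof (rule translatesI)
    show "rect (\<lambda>k g. \<exists>x\<in>S. fst x k g \<and> P (map (\<lambda>f. f g) (snd x)))"
      by (intro rectangular_bex S(1) rectangular_and S(2) rectangular_right P S(3))
    fix u k g assume f: "val_frame n u g"
    show "P (map (\<lambda>t. the_G (eval_tm MV (asg n u k g) t)) ts) \<longleftrightarrow>
        (\<exists>x\<in>S. fst x k g \<and> P (map (\<lambda>f. f g) (snd x)))"
      using S(4)[OF f, of k] S(5)[OF f, of _ k] by metis
  qed
qed

lemma SK_terms_translate:
  assumes "\<And>t. t \<in> set ts \<Longrightarrow> tm_sort LV t SK"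
  shows "\<exists>fs. list_all2 (tm_definable LK MK) (replicate (length ts) ()) fs \<and>
    (\<forall>u k g. map (\<lambda>t. the_K (eval_tm MV (asg n u k g) t)) ts = map (\<lambda>f. f k) fs)"
  using assms
proof (induction ts)
  case (Cons t ts)
  then obtain fs where fs: "list_all2 (tm_definable LK MK) (replicate (length ts) ()) fs"
    "\<And>u k g. map (\<lambda>t. the_K (eval_tm MV (asg n u k g) t)) ts = map (\<lambda>f. f k) fs" by auto
  have "tm_translates n SK t" using Cons.prems by (simp add: tm_sort_translates)
  then obtain f where f: "tm_definable LK MK () f" "\<And>u k g. eval_tm MV (asg n u k g) t = InK (f k)"
    using tm_translates_SKD by metis
  show ?case by (rule exI[of _ "f # fs"]) (use f fs in \<open>simp del: map_eq_conv\<close>)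
qed simp

section \<open>Translation of connectives and quantifiers\<close>

lemma translates_not:
  assumes "translates n P"
  shows "translates n (\<lambda>e. \<not> P e)"
proof -
  obtain Q where "rect Q" "\<forall>u k g. val_frame n u g \<longrightarrow> P (asg n u k g) = Q k g"
    using translatesD[OF assms] by (elim exE conjE) (rule that)
    note Q = this[rule_format]
  show ?thesis by (rule translatesI[OF rectangular_not[OF Q(1)]]) (simp add: Q(2))
qed

lemma translates_and:
  assumes "translates n P" "translates n P'"
  shows "translates n (\<lambda>e. P e \<and> P' e)"
proof -
  obtain Q where "rect Q" "\<forall>u k g. val_frame n u g \<longrightarrow> P (asg n u k g) = Q k g"
    using translatesD[OF assms(1)] by (elim exE conjE) (rule that)
    note Q = this[rule_format]
  obtain Q1 where "rect Q1" "\<forall>u k g. val_frame n u g \<longrightarrow> P' (asg n u k g) = Q1 k g"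
    using translatesD[OF assms(2)] by (elim exE conjE) (rule that)
    note Q1 = this[rule_format]
  show ?thesis by (rule translatesI[OF rectangular_and[OF Q(1) Q1(1)]]) (simp add: Q(2) Q1(2))
qed

lemma translates_Ex_K:
  assumes "translates n P"
  shows "translates n (\<lambda>e. \<exists>a\<in>range InK. P (e((SK, i) := a)))"
proof -
  obtain Q where "rect Q" "\<forall>u k g. val_frame n u g \<longrightarrow> P (asg n u k g) = Q k g"
    using translatesD[OF assms] by (elim exE conjE) (rule that)
    note Q = this[rule_format]
  show ?thesis
  proof (rule translatesI)
    show "rect (\<lambda>k g. \<exists>h. assignment MK h \<and> Q (override_on k h {kvar i}) g)"
      by (rule rectangular_ex_left[OF Q(1)]) simp
    fix u k g assume f: "val_frame n u g"
    have eq: "(asg n u k g)((SK, i) := InK a) = asg n u (k(kvar i := a)) g" for a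
      by (auto simp: asg_def fun_eq_iff split: vvs_sort.split)
    have "(\<exists>a\<in>range InK. P ((asg n u k g)((SK, i) := a))) \<longleftrightarrow> (\<exists>a. Q (k(kvar i := a)) g)"
      by (simp add: eq Q(2)[OF f])
    also have "\<dots> \<longleftrightarrow> (\<exists>h. Q (override_on k h {kvar i}) g)"
    proof
      assume "\<exists>a. Q (k(kvar i := a)) g"
      then obtain a where "Q (k(kvar i := a)) g" by blast
      then have "Q (override_on k (\<lambda>_. a) {kvar i}) g" by (simp add: override_on_insert)
      then show "\<exists>h. Q (override_on k h {kvar i}) g" by blast
    qed (auto simp: override_on_insert)
    finally show "(\<exists>a\<in>range InK. P ((asg n u k g)((SK, i) := a))) \<longleftrightarrow>
      (\<exists>h. assignment MK h \<and> Q (override_on k h {kvar i}) g)" by simp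
  qed
qed

lemma val_frame_upd_gvar: "val_frame n u (g(gvar i := a)) = val_frame n u g"
  by (simp add: val_frame_def)

lemma translates_Ex_G:
  assumes "translates n P"
  shows "translates n (\<lambda>e. \<exists>a\<in>range InG. P (e((SG, i) := a)))"
proof -
  obtain Q where "rect Q" "\<forall>u k g. val_frame n u g \<longrightarrow> P (asg n u k g) = Q k g"
    using translatesD[OF assms] by (elim exE conjE) (rule that)
    note Q = this[rule_format]
  show ?thesis
  proof (rule translatesI)
    show "rect (\<lambda>k g. \<exists>a. Q k (g(gvar i := a)))"
      using rectangular_ex_right[OF Q(1), of "()" "2 * i"] by (simp add: gvar_def)
    fix u k g assume f: "val_frame n u g"
    have eq: "(asg n u k g)((SG, i) := InG a) = asg n u k (g(gvar i := a))" for a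
      by (auto simp: asg_def fun_eq_iff split: vvs_sort.split)
    show "(\<exists>a\<in>range InG. P ((asg n u k g)((SG, i) := a))) \<longleftrightarrow> (\<exists>a. Q k (g(gvar i := a)))"
      by (simp add: eq Q(2) f val_frame_upd_gvar)
  qed
qed

text \<open>Every vector is a combination of \<open>u\<close> plus a vector that extends the frame.
  So the quantifier splits into one over the coordinates of the combination, in the base field, and
  one over the value of the new basis vector. Which values occur depends only on the values of
  \<open>u\<close> and the residue dimensions, so the condition \<open>adm\<close> concerns the
  value set alone.\<close>

lemma translates_Ex_V:
  assumes "translates (Suc n) P"
  shows "translates n (\<lambda>e. \<exists>a\<in>range InV. P (e((SV, j) := a)))"
proof -
  obtain Q where "rect Q" "\<forall>u k g. val_frame (Suc n) u g \<longrightarrow> P (asg (Suc n) u k g) = Q k g"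
    using translatesD[OF assms] by (elim exE conjE) (rule that)
    note Q = this[rule_format]
  define E where "E = kcoord j ` {..<n}"
  \<comment> \<open>At the new basis vector the quantified variable \<open>j\<close> has coordinate
    1 and every other vector variable has coordinate 0, as prescribed by \<open>one\<close>.\<close>
  define Z where "Z = (\<lambda>i. kcoord i n) ` UNIV"
  define one where "one = (\<lambda>v. if v = kcoord j n then 1 else 0 :: 'k)"
  \<comment> \<open>The number of basis vectors of the new value is made definable by running
    through the possible sets \<open>S\<close> of their indices; \<open>D\<close> is then applied
    with the fixed number \<open>card S\<close>.\<close>
  define adm where "adm g \<longleftrightarrow> g (gbas n) = top \<or>
    (\<forall>S\<in>Pow {..<n}. (\<forall>l\<in>{..<n}. (l \<in> S \<longrightarrow> g (gbas l) = g (gbas n)) \<and> (l \<notin> S \<longrightarrow> g (gbas l) \<noteq> g (gbas n))) \<longrightarrow>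
      g (gbas n) \<notin> D scale val (card S))" for g
  define Q1 where "Q1 k g \<longleftrightarrow> adm g \<and> (\<exists>h. assignment MK h \<and> Q (override_on (override_on k h E) one Z) g)" for k g
  have adm_iff: "adm g \<longleftrightarrow> g (gbas n) = top \<or> g (gbas n) \<notin> D scale val (card {l. l < n \<and> g (gbas l) = g (gbas n)})" for g
  proof -
    let ?S = "{l. l < n \<and> g (gbas l) = g (gbas n)}"
    have "(\<forall>l\<in>{..<n}. (l \<in> S \<longrightarrow> g (gbas l) = g (gbas n)) \<and> (l \<notin> S \<longrightarrow> g (gbas l) \<noteq> g (gbas n))) \<longleftrightarrow> S = ?S"
      if "S \<in> Pow {..<n}" for S using that by auto
    moreover have "?S \<in> Pow {..<n}" by auto
    ultimately show ?thesis unfolding adm_def by (simp cong: ball_cong) blast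
  qed
  have "definable LG MG adm"
    unfolding adm_def
    by (intro definable_or definable_ball definable_imp definable_and definable_not definable_const
        definable_eq[OF tm_gbas tm_gbas] definable_eq[OF tm_gbas tmG_top] definableG_D tm_gbas) auto
  moreover have "rect (\<lambda>k g. Q (override_on k one Z) g)"
    by (rule rectangular_override_const[OF Q(1)]) (auto simp: one_def tmK_0 tmK_1)
  then have "rect (\<lambda>k g. \<exists>h. assignment MK h \<and> Q (override_on (override_on k h E) one Z) g)"
    by (rule rectangular_ex_left) (simp add: E_def)
  ultimately have "rect Q1"
    unfolding Q1_def by (intro rectangular_and rectangular_right) auto
  then have rect: "rect (\<lambda>k g. \<exists>a. Q1 k (g(gbas n := a)))"
    using rectangular_ex_right[of LK MK LG MG Q1 "()" "2 * n + 1"] by (simp add: gbas_def)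
  show ?thesis
  proof (rule translatesI[OF rect])
    fix u k g assume f: "val_frame n u g"
    then have u: "val_indep n u" and g: "\<And>l. l < n \<Longrightarrow> g (gbas l) = val (u l)" by (auto simp: val_frame_def)
    let ?k = "\<lambda>h. override_on (override_on k h E) one Z"
    have asg_eq: "asg (Suc n) (u(n := u')) (?k h) (g(gbas n := a)) =
        (asg n u k g)((SV, j) := InV ((\<Sum>l<n. scale (h (kcoord j l)) (u l)) + u'))" for h u' a
    proof (rule ext)
      fix v :: "vvs_sort \<times> nat"
      obtain s i where v: "v = (s, i)" by (cases v)
      show "asg (Suc n) (u(n := u')) (?k h) (g(gbas n := a)) v =
        ((asg n u k g)((SV, j) := InV ((\<Sum>l<n. scale (h (kcoord j l)) (u l)) + u'))) v"
      proof (cases s)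
        case SK
        then show ?thesis by (auto simp: v override_on_def E_def Z_def)
      next
        case SG
        then show ?thesis by (simp add: v)
      next
        case SV
        have "?k h (kcoord i l) = (if i = j then h (kcoord j l) else k (kcoord i l))" if "l < n" for l
          using that by (auto simp: override_on_def E_def Z_def)
        then have "(\<Sum>l<n. scale (?k h (kcoord i l)) ((u(n := u')) l)) =
            (\<Sum>l<n. scale (if i = j then h (kcoord j l) else k (kcoord i l)) (u l))"
          by (intro sum.cong) auto
        moreover have "?k h (kcoord i n) = (if i = j then 1 else 0)"
          by (auto simp: override_on_def Z_def one_def)
        ultimately show ?thesis using SV by (simp add: v)
      qed
    qed
    have adm: "adm (g(gbas n := a)) \<longleftrightarrow> (\<exists>u'. val u' = a \<and> val_indep (Suc n) (u(n := u')))" for a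
    proof -
      have "{l. l < n \<and> (g(gbas n := a)) (gbas l) = a} = {l. l < n \<and> val (u l) = a}" using g by auto
      then show ?thesis unfolding adm_iff val_indep_extend_iff[OF u] by simp
    qed
    have frame: "val_frame (Suc n) (u(n := u')) (g(gbas n := val u'))" if "val_indep (Suc n) (u(n := u'))" for u'
      using that g by (auto simp: val_frame_def less_Suc_eq)
    show "(\<exists>a\<in>range InV. P ((asg n u k g)((SV, j) := a))) \<longleftrightarrow> (\<exists>a. Q1 k (g(gbas n := a)))"
    proof
      assume "\<exists>a\<in>range InV. P ((asg n u k g)((SV, j) := a))"
      then obtain x where x: "P ((asg n u k g)((SV, j) := InV x))" by blast
      obtain c u' where c: "x = (\<Sum>l<n. scale (c l) (u l)) + u'" "val_indep (Suc n) (u(n := u'))"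
        using val_indep_extend[OF u] .
      define h where "h v = c (inv (kcoord j) v)" for v
      have "inj (kcoord j)" by (simp add: inj_on_def)
      then have "h (kcoord j l) = c l" for l by (simp add: h_def)
      then have "P (asg (Suc n) (u(n := u')) (?k h) (g(gbas n := val u')))"
        using x by (simp add: asg_eq c(1))
      then have "Q (?k h) (g(gbas n := val u'))" by (simp add: Q(2)[OF frame[OF c(2)]])
      moreover have "adm (g(gbas n := val u'))" using adm c(2) by blast
      ultimately have "Q1 k (g(gbas n := val u'))" unfolding Q1_def by auto
      then show "\<exists>a. Q1 k (g(gbas n := a))" by blast
    next
      assume "\<exists>a. Q1 k (g(gbas n := a))"
      then obtain a h where a: "adm (g(gbas n := a))" "Q (?k h) (g(gbas n := a))" unfolding Q1_def by blast
      then obtain u' where u': "val u' = a" "val_indep (Suc n) (u(n := u'))" using adm by blast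
      have "P (asg (Suc n) (u(n := u')) (?k h) (g(gbas n := a)))"
        using a(2) Q(2)[OF frame[OF u'(2)], of "?k h"] u'(1) by simp
      then show "\<exists>a\<in>range InV. P ((asg n u k g)((SV, j) := a))" unfolding asg_eq by blast
    qed
  qed
qed

text \<open>The length \<open>n\<close> is arbitrary in the induction, because a vector quantifier
  over a frame of length \<open>n\<close> uses the translation of its body for length
  \<open>Suc n\<close>.\<close>

lemma sat_translates: "wf_fm LV p \<Longrightarrow> translates n (\<lambda>e. sat MV e p)"
proof (induction p arbitrary: n)
  case (Eq t t')
  then obtain s where s: "tm_sort LV t s" "tm_sort LV t' s" by auto
  note tr = s[THEN tm_sort_translates, of n]
  show ?case
  proof (cases s)
    case SK
    obtain c where "tm_definable LK MK () c" "\<forall>u k g. eval_tm MV (asg n u k g) t = InK (c k)"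
      using tm_translates_SKD[OF tr(1)[unfolded SK]] by (elim exE conjE) (rule that)
    note c = this[rule_format]
    obtain d where "tm_definable LK MK () d" "\<forall>u k g. eval_tm MV (asg n u k g) t' = InK (d k)"
      using tm_translates_SKD[OF tr(2)[unfolded SK]] by (elim exE conjE) (rule that)
    note d = this[rule_format]
    show ?thesis by (rule translatesI[OF rect_tm_eq[OF c(1) d(1)]]) (simp add: c d)
  next
    case SV
    obtain c where "\<forall>l. tm_definable LK MK () (c l)"
      "\<forall>u k g. eval_tm MV (asg n u k g) t = InV (\<Sum>l<n. scale (c l k) (u l))"
      using tm_translates_SVD[OF tr(1)[unfolded SV]] by (elim exE conjE) (rule that)
    note c = this[rule_format]
    obtain d where "\<forall>l. tm_definable LK MK () (d l)"
      "\<forall>u k g. eval_tm MV (asg n u k g) t' = InV (\<Sum>l<n. scale (d l k) (u l))"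
      using tm_translates_SVD[OF tr(2)[unfolded SV]] by (elim exE conjE) (rule that)
    note d = this[rule_format]
    show ?thesis
    proof (rule translatesI)
      \<comment> \<open>Coefficients may differ at a basis vector that is zero, that is, of value
        \<open>top\<close>.\<close>
      show "rect (\<lambda>k g. \<forall>l\<in>{..<n}. c l k = d l k \<or> g (gbas l) = top)"
        by (intro rectangular_ball rectangular_or rect_tm_eq c d rectangular_right
            definable_eq[OF tm_gbas tmG_top]) simp
      fix u k g assume f: "val_frame n u g"
      then have u: "val_indep n u" and g: "\<And>l. l < n \<Longrightarrow> g (gbas l) = val (u l)" by (auto simp: val_frame_def)
      have "sat MV (asg n u k g) (Eq t t') \<longleftrightarrow> (\<Sum>l<n. scale (c l k) (u l)) - (\<Sum>l<n. scale (d l k) (u l)) = 0"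
        by (simp add: c d)
      also have "(\<Sum>l<n. scale (c l k) (u l)) - (\<Sum>l<n. scale (d l k) (u l)) = (\<Sum>l<n. scale (c l k - d l k) (u l))"
        by (simp add: scale_left_diff_distrib sum_subtractf)
      also have "\<dots> = 0 \<longleftrightarrow> top \<le> val \<dots>" by (simp add: top_unique val_eq_top_iff)
      also have "\<dots> \<longleftrightarrow> (\<forall>l\<in>{..<n}. c l k = d l k \<or> g (gbas l) = top)"
        unfolding val_indep_le_iff[OF u] using g by (auto simp: top_unique)
      finally show "sat MV (asg n u k g) (Eq t t') \<longleftrightarrow> (\<forall>l\<in>{..<n}. c l k = d l k \<or> g (gbas l) = top)" .
    qed
  next
    case SG
    have "translates n (\<lambda>e. (\<lambda>xs. xs ! 0 = xs ! 1) (map (\<lambda>t. the_G (eval_tm MV e t)) [t, t']))"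
    proof (rule SG_predicate_translates)
      show "tm_sort LV r SG" if "r \<in> set [t, t']" for r using that s SG by auto
      fix fs :: "((unit \<times> nat \<Rightarrow> 'g) \<Rightarrow> 'g) list"
      assume "list_all2 (tm_definable LG MG) (replicate (length [t, t']) ()) fs"
      then obtain f f' where "fs = [f, f']" "tm_definable LG MG () f" "tm_definable LG MG () f'"
        by (auto simp: list_all2_Cons1)
      then show "definable LG MG (\<lambda>g. map (\<lambda>f. f g) fs ! 0 = map (\<lambda>f. f g) fs ! 1)"
        by (simp add: definable_eq)
    qed
    then obtain Q where Q: "rect Q" "\<And>u k g. val_frame n u g \<Longrightarrow>
        (the_G (eval_tm MV (asg n u k g) t) = the_G (eval_tm MV (asg n u k g) t')) = Q k g"
      using translatesD by fastforce
    \<comment> \<open>\<open>the_G\<close> compares faithfully only elements of the form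
      \<open>InG x\<close>, so both terms are shown to evaluate to such elements.\<close>
    have inG: "\<exists>x. eval_tm MV (asg n u k g) r = InG x" if "tm_translates n SG r" "val_frame n u g" for r u k g
      using that unfolding tm_translates_def vvs_sort.case by blast
    show ?thesis
    proof (rule translatesI[OF Q(1)])
      fix u k g assume f: "val_frame n u g"
      obtain x x' where "eval_tm MV (asg n u k g) t = InG x" "eval_tm MV (asg n u k g) t' = InG x'"
        using inG f tr SG by meson
      then show "sat MV (asg n u k g) (Eq t t') = Q k g" using Q(2)[OF f, of k] by simp
    qed
  qed
next
  case (Rel r ts)
  then obtain ss where ss: "vvs_rel_sig arK arG r = Some ss" "list_all2 (tm_sort LV) ts ss" by auto
  have G: "translates n (\<lambda>e. sat MV e (Rel r ts))"
    if rep: "ss = replicate m SG" and r': "value_rel_sig arG r' = Some (replicate m ())"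
      and eq: "\<And>xs :: ('k, 'v, 'g) elem list. length xs = m \<Longrightarrow> vvs_rel_int RK RG r xs = value_rel_int scale val RG r' (map the_G xs)" for m r'
  proof -
    have len: "length ts = m" using ss(2) rep by (auto dest: list_all2_lengthD)
    have "translates n (\<lambda>e. value_rel_int scale val RG r' (map (\<lambda>t. the_G (eval_tm MV e t)) ts))"
    proof (rule SG_predicate_translates)
      show "tm_sort LV t SG" if "t \<in> set ts" for t
        using ss(2) that by (auto simp: rep list_all2_conv_all_nth in_set_conv_nth)
      show "definable LG MG (\<lambda>g. value_rel_int scale val RG r' (map (\<lambda>f. f g) fs))"
        if "list_all2 (tm_definable LG MG) (replicate (length ts) ()) fs" for fs
        using definable_rel[of LG r' "replicate m ()" MG fs] that r' len by simp
    qed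
    moreover have "sat MV e (Rel r ts) = value_rel_int scale val RG r' (map (\<lambda>t. the_G (eval_tm MV e t)) ts)" for e
      using eq[of "map (eval_tm MV e) ts"] by (simp add: len comp_def)
    ultimately show ?thesis by (simp only:)
  qed
  show ?case
  proof (cases r)
    case Less
    then show ?thesis using ss(1) by (intro G[of 2 GLess]) (auto simp: numeral_2_eq_2)
  next
    case (ExtraK q)
    then obtain m where m: "arK q = Some m" "ss = replicate m SK" using ss(1) by auto
    have len: "length ts = m" using ss(2) m by (auto dest: list_all2_lengthD)
    have "tm_sort LV t SK" if "t \<in> set ts" for t
      using ss(2) that by (auto simp: m list_all2_conv_all_nth in_set_conv_nth)
    then obtain fs where fs: "list_all2 (tm_definable LK MK) (replicate (length ts) ()) fs"
      "\<And>u k g. map (\<lambda>t. the_K (eval_tm MV (asg n u k g) t)) ts = map (\<lambda>f. f k) fs"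
      using SK_terms_translate[of ts n] by blast
    show ?thesis
    proof (rule translatesI)
      show "rect (\<lambda>k g. RK q (map (\<lambda>f. f k) fs))"
        using definable_rel[of LK q "replicate m ()" MK fs] fs(1) m len by (intro rectangular_left) simp
      fix u k g
      show "sat MV (asg n u k g) (Rel r ts) = RK q (map (\<lambda>f. f k) fs)"
        using fs(2)[of u k g] by (simp add: ExtraK comp_def del: map_eq_conv)
    qed
  next
    case (ExtraG q)
    then obtain m where m: "arG q = Some m" "ss = replicate m SG" using ss(1) by auto
    then show ?thesis using ExtraG by (intro G[of m "GExtra q"]) auto
  qed
next
  case (Neg p)
  then show ?case by (simp add: translates_not)
next
  case (Conj p q)
  then show ?case by (simp add: translates_and)
next
  case (Exi v p)
  obtain s i where v: "v = (s, i)" by (cases v)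
  have IH: "translates m (\<lambda>e. sat MV e p)" for m using Exi by simp
  show ?case
    using translates_Ex_K[OF IH] translates_Ex_G[OF IH] translates_Ex_V[OF IH] by (cases s) (simp_all add: v)
qed

section \<open>Frames of assignments and invariance under isometry\<close>

abbreviation kk :: "(vvs_sort \<times> nat \<Rightarrow> ('k, 'v, 'g) elem) \<Rightarrow> nat \<Rightarrow> 'k" where "kk e i \<equiv> the_K (e (SK, i))"
abbreviation vv :: "(vvs_sort \<times> nat \<Rightarrow> ('k, 'v, 'g) elem) \<Rightarrow> nat \<Rightarrow> 'v" where "vv e i \<equiv> the_V (e (SV, i))"
abbreviation gg :: "(vvs_sort \<times> nat \<Rightarrow> ('k, 'v, 'g) elem) \<Rightarrow> nat \<Rightarrow> 'g" where "gg e i \<equiv> the_G (e (SG, i))"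

lemma assignment_asg [simp]: "assignment MV (asg n u k g)"
  by (auto simp: assignment_def asg_def split: vvs_sort.split)

lemma assignmentD:
  assumes "assignment MV e"
  shows "e (SK, i) = InK (kk e i)" "e (SV, i) = InV (vv e i)" "e (SG, i) = InG (gg e i)"
proof -
  have "e (s, i) \<in> vvs_univ s" for s using assms by (simp add: assignment_def)
  from this[of SK] this[of SV] this[of SG]
  show "e (SK, i) = InK (kk e i)" "e (SV, i) = InV (vv e i)" "e (SG, i) = InG (gg e i)" by auto
qed

lemma assignment_eqI:
  assumes "assignment MV e" "assignment MV e'"
    and "s = SK \<Longrightarrow> kk e i = kk e' i" "s = SV \<Longrightarrow> vv e i = vv e' i" "s = SG \<Longrightarrow> gg e i = gg e' i"
  shows "e (s, i) = e' (s, i)"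
  using assignmentD[OF assms(1), of i] assignmentD[OF assms(2), of i] assms(3-5)
  by (cases s) metis+

lemma definable_translates:
  assumes "definable LV MV P"
  shows "translates n P"
proof -
  obtain p where p: "wf_fm LV p" "\<forall>e. assignment MV e \<longrightarrow> sat MV e p = P e"
    using assms unfolding definable_def by blast
  have "translates n (\<lambda>e. sat MV e p)" by (rule sat_translates[OF p(1)])
  then show ?thesis unfolding translates_def by (simp add: p(2))
qed

lemma ex_coords: "\<exists>k. (\<forall>i. k (kvar i) = a i) \<and> (\<forall>j l. k (kcoord j l) = c j l)"
  by (rule exI[of _ "\<lambda>(_, m). if even m then a (m div 2) else case_prod c (prod_decode (m div 2))"])
    (simp add: kvar_def kcoord_def)

lemma ex_values: "\<exists>g. (\<forall>i. g (gvar i) = a i) \<and> (\<forall>l. g (gbas l) = c l)"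
  by (rule exI[of _ "\<lambda>(_, m). if even m then a (m div 2) else c (m div 2)"])
    (simp add: gvar_def gbas_def)

text \<open>The frame always has \<open>card J\<close> members, so the translation for this one
  length applies to every assignment. The last condition allows the basis to be expressed by the
  vectors themselves.\<close>

definition frame where
  "frame J e u k g \<longleftrightarrow> val_frame (card J) u g \<and> (\<forall>i. k (kvar i) = kk e i) \<and> (\<forall>i. g (gvar i) = gg e i) \<and>
    (\<forall>j\<in>J. vv e j = (\<Sum>l<card J. scale (k (kcoord j l)) (u l))) \<and> u ` {..<card J} \<subseteq> span (vv e ` J)"

lemma ex_frame:
  assumes "finite J"
  shows "\<exists>u k g. frame J e u k g"
proof -
  let ?n = "card J"
  obtain u where u: "val_indep ?n u" "u ` {..<?n} \<subseteq> span (vv e ` J)" "vv e ` J \<subseteq> span (u ` {..<?n})"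
    using val_indep_generators[OF assms] .
  have "\<forall>j\<in>J. \<exists>c. vv e j = (\<Sum>l<?n. scale (c l) (u l))"
    using u(3) in_span_image_iff[of "{..<?n}" _ u] by blast
  then obtain c where c: "\<forall>j\<in>J. vv e j = (\<Sum>l<?n. scale (c j l) (u l))" by metis
  obtain k where k: "\<forall>i. k (kvar i) = kk e i" "\<forall>j l. k (kcoord j l) = c j l"
    using ex_coords[of "kk e" c] by (elim exE conjE) (rule that)
  obtain g where g: "\<forall>i. g (gvar i) = gg e i" "\<forall>l. g (gbas l) = val (u l)"
    using ex_values[of "gg e" "\<lambda>l. val (u l)"] by (elim exE conjE) (rule that)
  show ?thesis
    by (rule exI[of _ u], rule exI[of _ k], rule exI[of _ g]) (use u c k g in \<open>simp add: frame_def val_frame_def\<close>)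
qed

text \<open>Transporting a frame of \<open>e\<close> along the isometry gives a frame of \<open>e'\<close> with the same coordinates and
  values.\<close>

lemma isometric_equivalent:
  assumes P: "definable LV MV P" and F: "finite F" "depends_on MV F P"
    and e: "assignment MV e" "assignment MV e'"
    and J: "J = {i. (SV, i) \<in> F}"
    and KG: "\<And>s i. (s, i) \<in> F \<Longrightarrow> s \<noteq> SV \<Longrightarrow> e (s, i) = e' (s, i)"
    and iso: "\<And>c. val (\<Sum>i\<in>J. scale (c i) (vv e i)) = val (\<Sum>i\<in>J. scale (c i) (vv e' i))"
  shows "P e = P e'"
proof -
  have "J = snd ` (F \<inter> {SV} \<times> UNIV)" unfolding J by force
  then have finJ: "finite J" using F(1) by simp
  let ?n = "card J"
  obtain u k g where f: "val_frame ?n u g" and k: "\<forall>i. k (kvar i) = kk e i" and g: "\<forall>i. g (gvar i) = gg e i"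
    and coord: "\<forall>j\<in>J. vv e j = (\<Sum>l<?n. scale (k (kcoord j l)) (u l))" and span: "u ` {..<?n} \<subseteq> span (vv e ` J)"
    using ex_frame[OF finJ, of e] unfolding frame_def by (elim exE conjE) (rule that)
  have "\<forall>l\<in>{..<?n}. \<exists>d. u l = (\<Sum>j\<in>J. scale (d j) (vv e j))"
    using span in_span_image_iff[OF finJ, of _ "vv e"] by blast
  then obtain d where d: "\<forall>l\<in>{..<?n}. u l = (\<Sum>j\<in>J. scale (d l j) (vv e j))" by metis
  define u' where "u' l = (\<Sum>j\<in>J. scale (d l j) (vv e' j))" for l
  have comb: "(\<Sum>l<?n. scale (c l) (\<Sum>j\<in>J. scale (d l j) (w j))) = (\<Sum>j\<in>J. scale (\<Sum>l<?n. c l * d l j) (w j))"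
    for c w
    by (simp add: scale_sum_right scale_sum_left) (rule sum.swap)
  have "(\<Sum>l<?n. scale (c l) (u l)) = (\<Sum>j\<in>J. scale (\<Sum>l<?n. c l * d l j) (vv e j))" for c
    unfolding comb[symmetric] by (rule sum.cong) (use d in auto)
  moreover have comb': "(\<Sum>l<?n. scale (c l) (u' l)) = (\<Sum>j\<in>J. scale (\<Sum>l<?n. c l * d l j) (vv e' j))" for c
    unfolding u'_def comb ..
  ultimately have val_eq: "val (\<Sum>l<?n. scale (c l) (u' l)) = val (\<Sum>l<?n. scale (c l) (u l))" for c
    by (simp only: iso)
  have val_u: "val (u' l) = val (u l)" if "l < ?n" for l
    using iso[of "d l"] d that by (simp add: u'_def)
  have f': "val_frame ?n u' g"
    using f val_u unfolding val_frame_def val_indep_def val_eq by simp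
  have coord': "vv e' j = (\<Sum>l<?n. scale (k (kcoord j l)) (u' l))" if j: "j \<in> J" for j
  proof -
    \<comment> \<open>Expanding \<open>vv e j\<close> in the basis, and the basis in the vectors of
      \<open>e\<close>, gives a relation with these coefficients. Its value is \<open>top\<close>,
      so by the isometry the same relation holds between the vectors of \<open>e'\<close>.\<close>
    let ?c = "\<lambda>j'. (if j' = j then 1 else 0) - (\<Sum>l<?n. k (kcoord j l) * d l j')"
    have c: "(\<Sum>j'\<in>J. scale (?c j') (w j')) = w j - (\<Sum>j'\<in>J. scale (\<Sum>l<?n. k (kcoord j l) * d l j') (w j'))" for w
    proof -
      have "(\<Sum>j'\<in>J. scale (?c j') (w j')) = (\<Sum>j'\<in>J. (if j' = j then w j else 0) - scale (\<Sum>l<?n. k (kcoord j l) * d l j') (w j'))"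
        by (rule sum.cong) (auto simp: scale_left_diff_distrib)
      then show ?thesis using j finJ by (simp add: sum_subtractf)
    qed
    have "(\<Sum>j'\<in>J. scale (?c j') (vv e j')) = 0"
      unfolding c comb[symmetric] using coord[rule_format, OF j] d by simp
    then have "val (\<Sum>j'\<in>J. scale (?c j') (vv e' j')) = top" using iso[of ?c] by simp
    then have "(\<Sum>j'\<in>J. scale (?c j') (vv e' j')) = 0" by (simp only: val_eq_top_iff)
    then show ?thesis unfolding c comb' by simp
  qed
  obtain Q where Q: "\<forall>u k g. val_frame ?n u g \<longrightarrow> P (asg ?n u k g) = Q k g"
    using definable_translates[OF P, of ?n] unfolding translates_def by (elim exE conjE) (rule that)
  have "P e = P (asg ?n u k g)"
  proof (rule F(2)[unfolded depends_on_def, rule_format, OF e(1) assignment_asg])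
    fix v assume v: "v \<in> F"
    obtain s i where vs: "v = (s, i)" by (cases v)
    show "e v = asg ?n u k g v"
      unfolding vs by (rule assignment_eqI[OF e(1) assignment_asg]) (use v vs k g coord in \<open>auto simp: J\<close>)
  qed
  moreover have "P e' = P (asg ?n u' k g)"
  proof (rule F(2)[unfolded depends_on_def, rule_format, OF e(2) assignment_asg])
    fix v assume v: "v \<in> F"
    obtain s i where vs: "v = (s, i)" by (cases v)
    show "e' v = asg ?n u' k g v"
      unfolding vs
    proof (rule assignment_eqI[OF e(2) assignment_asg])
      assume "s = SK"
      then show "kk e' i = kk (asg ?n u' k g) i" using k KG[of SK i] v vs by simp
    next
      assume "s = SV"
      then have "i \<in> J" using v vs J by simp
      then show "vv e' i = vv (asg ?n u' k g) i" using coord' by simp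
    next
      assume "s = SG"
      then show "gg e' i = gg (asg ?n u' k g) i" using g KG[of SG i] v vs by simp
    qed
  qed
  ultimately show ?thesis using Q f f' by simp
qed

text \<open>All vectors that matter belong to the points, so a frame chosen for each point serves
  for all parameters, and a parameter contributes only elements of the base field and the value set.
  Each factor of the finite union of products then has polynomial growth by NIP of its own
  sort.\<close>

lemma poly_growth_no_vector_parameters:
  assumes NIP: "NIP LK MK" "NIP LG MG"
    and P: "definable LV MV P" and F: "finite F" "depends_on MV F P"
    and X: "\<And>j. (SV, j) \<in> F \<Longrightarrow> (SV, j) \<in> X"
  shows "poly_growth (Collect (assignment MV)) (Collect (assignment MV)) (\<lambda>a b. P (merge X a b))"
proof -
  define J where "J = {i. (SV, i) \<in> F}"
  have "J = snd ` (F \<inter> {SV} \<times> UNIV)" unfolding J_def by force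
  then have finJ: "finite J" using F(1) by simp
  let ?n = "card J"
  let ?A = "Collect (assignment MV)"
  obtain u \<kappa> \<gamma> where "\<And>e. frame J e (u e) (\<kappa> e) (\<gamma> e)" using ex_frame[OF finJ] by metis
  then have fr: "\<And>e. val_frame ?n (u e) (\<gamma> e)" and k: "\<And>e i. \<kappa> e (kvar i) = kk e i"
    and g: "\<And>e i. \<gamma> e (gvar i) = gg e i"
    and coord: "\<And>e j. j \<in> J \<Longrightarrow> vv e j = (\<Sum>l<?n. scale (\<kappa> e (kcoord j l)) (u e l))"
    unfolding frame_def by blast+
  define \<mu> where "\<mu> b = (\<lambda>(_ :: unit, m). kk b (m div 2))" for b
  define \<nu> where "\<nu> b = (\<lambda>(_ :: unit, m). gg b (m div 2))" for b
  have \<mu>: "\<mu> b (kvar i) = kk b i" and \<nu>: "\<nu> b (gvar i) = gg b i" for b i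
    by (simp_all add: \<mu>_def \<nu>_def kvar_def gvar_def)
  \<comment> \<open>All coordinates and basis values are put on the side of the points; only the
    field and value variables are divided according to \<open>X\<close>.\<close>
  define XK where "XK = {kvar i | i. (SK, i) \<in> X} \<union> {kcoord j l | j l. True}"
  define XG where "XG = {gvar i | i. (SG, i) \<in> X} \<union> range gbas"
  obtain Q where Q: "rect Q" "\<forall>u k g. val_frame ?n u g \<longrightarrow> P (asg ?n u k g) = Q k g"
    using definable_translates[OF P, of ?n] unfolding translates_def by (elim exE conjE) (rule that)
  obtain S where S: "finite S" "\<forall>s\<in>S. definable LK MK (fst s) \<and> definable LG MG (snd s)"
    "\<forall>k g. assignment MK k \<longrightarrow> assignment MG g \<longrightarrow> Q k g = (\<exists>s\<in>S. fst s k \<and> snd s g)"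
    using Q(1) unfolding rectangular_def by (elim exE conjE) (rule that)
  have eq: "P (merge X a b) = (\<exists>s\<in>S. fst s (merge XK (\<kappa> a) (\<mu> b)) \<and> snd s (merge XG (\<gamma> a) (\<nu> b)))"
    if ab: "a \<in> ?A" "b \<in> ?A" for a b
  proof -
    let ?k = "merge XK (\<kappa> a) (\<mu> b)" and ?g = "merge XG (\<gamma> a) (\<nu> b)"
    have "val_frame ?n (u a) ?g"
      using fr[of a] by (auto simp: val_frame_def merge_def XG_def)
    moreover have "P (merge X a b) = P (asg ?n (u a) ?k ?g)"
    proof (rule F(2)[unfolded depends_on_def, rule_format, OF _ assignment_asg])
      show "assignment MV (merge X a b)" using ab by (simp add: assignment_merge)
      fix v assume v: "v \<in> F"
      obtain s i where vs: "v = (s, i)" by (cases v)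
      show "merge X a b v = asg ?n (u a) ?k ?g v"
        unfolding vs
      proof (rule assignment_eqI[OF _ assignment_asg])
        show "assignment MV (merge X a b)" using ab by (simp add: assignment_merge)
        show "kk (merge X a b) i = kk (asg ?n (u a) ?k ?g) i"
          by (auto simp: merge_def XK_def k \<mu>)
        show "gg (merge X a b) i = gg (asg ?n (u a) ?k ?g) i"
          by (auto simp: merge_def XG_def g \<nu>)
        assume "s = SV"
        then have "i \<in> J" "(SV, i) \<in> X" using v vs X by (auto simp: J_def)
        moreover have "?k (kcoord i l) = \<kappa> a (kcoord i l)" for l by (auto simp: merge_def XK_def)
        ultimately show "vv (merge X a b) i = vv (asg ?n (u a) ?k ?g) i"
          using coord[of i a] by (simp add: merge_def[of X])
      qed
    qed
    ultimately show ?thesis using Q(2) S(3) by simp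
  qed
  have gK: "poly_growth ?A ?A (\<lambda>a b. fst s (merge XK (\<kappa> a) (\<mu> b)))" if "s \<in> S" for s
  proof -
    have "poly_growth (Collect (assignment MK)) (Collect (assignment MK)) (\<lambda>a b. fst s (merge XK a b))"
      by (rule NIP_poly_growth[OF NIP(1)]) (use S(2) that in simp)
    then show ?thesis by (rule poly_growth_pull[where \<kappa> = \<kappa> and \<mu> = \<mu>]) simp_all
  qed
  have gG: "poly_growth ?A ?A (\<lambda>a b. snd s (merge XG (\<gamma> a) (\<nu> b)))" if "s \<in> S" for s
  proof -
    have "poly_growth (Collect (assignment MG)) (Collect (assignment MG)) (\<lambda>a b. snd s (merge XG a b))"
      by (rule NIP_poly_growth[OF NIP(2)]) (use S(2) that in simp)
    then show ?thesis by (rule poly_growth_pull[where \<kappa> = \<gamma> and \<mu> = \<nu>]) simp_all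
  qed
  have "poly_growth ?A ?A (\<lambda>a b. \<exists>s\<in>S. fst s (merge XK (\<kappa> a) (\<mu> b)) \<and> snd s (merge XG (\<gamma> a) (\<nu> b)))"
    by (intro poly_growth_bex[OF S(1)] poly_growth_comb[where f = "(\<and>)"] gK gG)
  then show ?thesis
    by (rule poly_growth_pull[where \<kappa> = "\<lambda>a. a" and \<mu> = "\<lambda>b. b"]) (simp_all add: eq)
qed

section \<open>Definability in the three-sorted structure\<close>

lemma tmV_k: "tm_definable LV MV SK (\<lambda>e. InK (kk e i))"
  by (rule tm_definable_cong[OF tm_definable_var[of LV MV SK i]]) (simp only: assignmentD[symmetric])

lemma tmV_v: "tm_definable LV MV SV (\<lambda>e. InV (vv e i))"
  by (rule tm_definable_cong[OF tm_definable_var[of LV MV SV i]]) (simp only: assignmentD[symmetric])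

lemma tmV_g: "tm_definable LV MV SG (\<lambda>e. InG (gg e i))"
  by (rule tm_definable_cong[OF tm_definable_var[of LV MV SG i]]) (simp only: assignmentD[symmetric])

lemma tmV_add:
  "tm_definable LV MV SV (\<lambda>e. InV (f e)) \<Longrightarrow> tm_definable LV MV SV (\<lambda>e. InV (h e)) \<Longrightarrow>
    tm_definable LV MV SV (\<lambda>e. InV (f e + h e))"
  using tm_definable_fn[of LV VAdd "[SV, SV]" SV MV "[\<lambda>e. InV (f e), \<lambda>e. InV (h e)]"] by simp

lemma tmV_scale:
  "tm_definable LV MV SK (\<lambda>e. InK (f e)) \<Longrightarrow> tm_definable LV MV SV (\<lambda>e. InV (h e)) \<Longrightarrow>
    tm_definable LV MV SV (\<lambda>e. InV (scale (f e) (h e)))"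
  using tm_definable_fn[of LV Scal "[SK, SV]" SV MV "[\<lambda>e. InK (f e), \<lambda>e. InV (h e)]"] by simp

lemma tmV_0: "tm_definable LV MV SV (\<lambda>e. InV 0)"
  using tm_definable_fn[of LV VZero "[]" SV MV "[]"] by simp

lemma tmV_val: "tm_definable LV MV SV (\<lambda>e. InV (f e)) \<Longrightarrow> tm_definable LV MV SG (\<lambda>e. InG (val (f e)))"
  using tm_definable_fn[of LV Val "[SV]" SG MV "[\<lambda>e. InV (f e)]"] by simp

lemma tmV_lincomb:
  "finite J \<Longrightarrow> tm_definable LV MV SV (\<lambda>e. InV (\<Sum>i\<in>J. scale (kk e (f i)) (vv e (h i))))"
  by (induction J rule: finite_induct) (simp_all add: tmV_0 tmV_add tmV_scale tmV_k tmV_v)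

lemma definableV_less:
  "tm_definable LV MV SG (\<lambda>e. InG (f e)) \<Longrightarrow> tm_definable LV MV SG (\<lambda>e. InG (h e)) \<Longrightarrow>
    definable LV MV (\<lambda>e. f e < h e)"
  using definable_rel[of LV Less "[SG, SG]" MV "[\<lambda>e. InG (f e), \<lambda>e. InG (h e)]"] by simp

lemma definableV_le:
  "tm_definable LV MV SG (\<lambda>e. InG (f e)) \<Longrightarrow> tm_definable LV MV SG (\<lambda>e. InG (h e)) \<Longrightarrow>
    definable LV MV (\<lambda>e. f e \<le> h e)"
  using definable_not[OF definableV_less[of h f]] by (simp add: not_less)

lemma definableV_eq_min:
  assumes "tm_definable LV MV SG (\<lambda>e. InG (f e))" "tm_definable LV MV SG (\<lambda>e. InG (h e))"
    "tm_definable LV MV SG (\<lambda>e. InG (h' e))"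
  shows "definable LV MV (\<lambda>e. f e = min (h e) (h' e))"
proof -
  have "definable LV MV (\<lambda>e. (h e \<le> h' e \<and> f e \<le> h e \<and> h e \<le> f e) \<or> (\<not> h e \<le> h' e \<and> f e \<le> h' e \<and> h' e \<le> f e))"
    by (intro definable_or definable_and definable_not definableV_le assms)
  then show ?thesis by (rule definable_cong) auto
qed

section \<open>Eliminating vector parameters\<close>

text \<open>Since \<open>x + z = (x - w) + (w + z)\<close>, the ultrametric inequality gives one
  direction. The other applies it to \<open>w + z = (x + z) - (x - w)\<close>, where the bound by
  \<open>\<delta>\<close> makes the minimum equal to \<open>val (x + z)\<close>.\<close>

lemma val_translate_eq_min:
  assumes "val (x + z) \<le> \<delta>" "val (x - w) = \<delta>"
  shows "val (x + z) = min \<delta> (val (w + z))"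
proof (rule antisym)
  have "min (val (x + z)) \<delta> \<le> val (w + z)" using val_diff[of "x + z" "x - w"] assms(2)
    by (simp add: add.commute)
  then show "val (x + z) \<le> min \<delta> (val (w + z))" using assms(1) by (simp add: min_absorb1)
  show "min \<delta> (val (w + z)) \<le> val (x + z)" using val_add[of "x - w" "w + z"] assms(2) by simp
qed

text \<open>Eliminating a vector parameter \<open>x\<close>: given finitely many points, let \<open>w\<close> be the best
  approximation of \<open>x\<close> in the spans attached to the points, and \<open>\<delta> = val (x - w)\<close>. By maximality,
  \<open>val (x + z) = min \<delta> (val (w + z))\<close> for all \<open>z\<close> in all of these spans, so \<open>x\<close> may be replaced by \<open>\<delta>\<close>
  and the coordinates of \<open>w\<close>, at the cost of adjoining to every point the one whose span
  contains \<open>w\<close>.\<close>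

lemma eliminate_vector_parameter:
  assumes P: "definable LV MV P" and F: "finite F" "depends_on MV F P"
    and j0: "(SV, j0) \<in> F" "(SV, j0) \<notin> X"
  obtains P' F' X' where "definable LV MV P'" "finite F'" "depends_on MV F' P'"
    "card {j. (SV, j) \<in> F' - X'} < card {j. (SV, j) \<in> F - X}"
    "poly_growth (Collect (assignment MV)) (Collect (assignment MV)) (\<lambda>a b. P' (merge X' a b)) \<Longrightarrow>
      poly_growth (Collect (assignment MV)) (Collect (assignment MV)) (\<lambda>a b. P (merge X a b))"
proof -
  let ?A = "Collect (assignment MV)"
  obtain N where N: "\<And>s i. (s, i) \<in> F \<Longrightarrow> i < N"
  proof -
    have "finite (snd ` F)" using F(1) by simp
    then obtain N where "\<forall>i\<in>snd ` F. i < N" using finite_nat_set_iff_bounded by blast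
    then show ?thesis by (intro that[of N]) force
  qed
  \<comment> \<open>\<open>J\<close> contains the other vector variables of points and of parameters
    alike: the span attached to a point includes the remaining vector parameters.\<close>
  define J where "J = {i. (SV, i) \<in> F} - {j0}"
  have FV: "{i. (SV, i) \<in> F} = insert j0 J" using j0 by (auto simp: J_def)
  have "{i. (SV, i) \<in> F} = snd ` (F \<inter> {SV} \<times> UNIV)" by force
  then have finJ: "finite J" using F(1) by (simp add: J_def)
  have J_less: "i < N" if "i \<in> J" for i using that N by (auto simp: J_def)
  \<comment> \<open>Indices are laid out in blocks of length \<open>N\<close>: the old variables,
    their copies at the adjoined point, and from \<open>2 * N\<close> on the new parameters for the
    coordinates of \<open>w\<close> and for \<open>\<delta>\<close>. A parameter vector is common to
    all points, so \<open>cp\<close> shifts only the variables in \<open>X\<close>.\<close>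
  define cp where "cp i = (if (SV, i) \<in> X then i + N else i)" for i
  define lin where "lin e \<epsilon> = (\<Sum>i\<in>J. scale (\<epsilon> i) (vv e i))" for e \<epsilon>
  define w where "w e = (\<Sum>i\<in>J. scale (kk e (i + 2 * N)) (vv e (cp i)))" for e
  \<comment> \<open>\<open>C\<close> prescribes \<open>val (x + z)\<close> for all \<open>z\<close>
    in the span attached to the point. \<open>P'\<close> asks only for some such \<open>x\<close>,
    because \<open>C\<close> fixes the isometry type of the tuple.\<close>
  define C where "C e x \<longleftrightarrow> (\<forall>\<epsilon>. val (x + lin e \<epsilon>) = min (gg e (2 * N)) (val (w e + lin e \<epsilon>)))" for e x
  define P' where "P' e \<longleftrightarrow> (\<exists>x. C e x \<and> P (e((SV, j0) := InV x)))" for e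
  define F' where "F' = (F - {(SV, j0)}) \<union> (\<lambda>(s, i). (s, i + N)) ` F \<union> (\<lambda>i. (SK, i + 2 * N)) ` J \<union> {(SG, 2 * N)}"
  define X' where "X' = {(s, i). i < N \<and> (s, i) \<in> X} \<union> {(s, i). N \<le> i \<and> i < 2 * N}"
  have j0_upd: "lin (e((SV, j0) := a)) = lin e" "w (e((SV, j0) := a)) = w e" for e a
  proof -
    have "cp i \<noteq> j0" if "i \<in> J" for i
      using that N[OF j0(1)] by (auto simp: cp_def J_def)
    then show "w (e((SV, j0) := a)) = w e" unfolding w_def by (intro sum.cong) auto
    show "lin (e((SV, j0) := a)) = lin e"
      unfolding lin_def by (intro ext sum.cong) (auto simp: J_def)
  qed
  show ?thesis
  proof (rule that[of P' F' X'])
    show "finite F'" unfolding F'_def using F(1) finJ by simp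
    show "definable LV MV P'"
    proof -
      \<comment> \<open>The quantifier over \<open>\<epsilon>\<close> in \<open>C\<close> uses field
        variables from index \<open>3 * N\<close> on, beyond the coordinates of \<open>w\<close>,
        whose indices lie below \<open>3 * N\<close>.\<close>
      define E where "E = (\<lambda>i. (SK, i + 3 * N)) ` J"
      define C0 where "C0 e \<longleftrightarrow> val (vv e j0 + (\<Sum>i\<in>J. scale (kk e (i + 3 * N)) (vv e i))) =
          min (gg e (2 * N)) (val (w e + (\<Sum>i\<in>J. scale (kk e (i + 3 * N)) (vv e i))))" for e
      have "definable LV MV C0"
        unfolding C0_def w_def
        by (intro definableV_eq_min tmV_val tmV_add tmV_lincomb finJ tmV_v tmV_g)
      then have def: "definable LV MV (\<lambda>e. \<forall>g. assignment MV g \<longrightarrow> C0 (override_on e g E))"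
        by (rule definable_all_override[rotated]) (simp add: E_def finJ)
      have iff: "(\<forall>g. assignment MV g \<longrightarrow> C0 (override_on e g E)) \<longleftrightarrow> C e (vv e j0)" for e
      proof -
        have ov: "override_on e g E (SV, i) = e (SV, i)" "override_on e g E (SG, i) = e (SG, i)" for g i
          by (auto simp: override_on_def E_def)
        have "override_on e g E (SK, i + 2 * N) = e (SK, i + 2 * N)" if "i \<in> J" for g i
          using J_less[OF that] by (auto simp: override_on_def E_def)
        then have w: "w (override_on e g E) = w e" for g
          unfolding w_def by (intro sum.cong) (simp_all add: ov)
        have "override_on e g E (SK, i + 3 * N) = g (SK, i + 3 * N)" if "i \<in> J" for g i
          using that by (auto simp: override_on_def E_def)
        then have l: "(\<Sum>i\<in>J. scale (kk (override_on e g E) (i + 3 * N)) (vv e i)) =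
            lin e (\<lambda>i. kk g (i + 3 * N))" for g
          unfolding lin_def by (intro sum.cong) simp_all
        have C0: "C0 (override_on e g E) \<longleftrightarrow> val (vv e j0 + lin e (\<lambda>i. kk g (i + 3 * N))) =
            min (gg e (2 * N)) (val (w e + lin e (\<lambda>i. kk g (i + 3 * N))))" for g
          unfolding C0_def w ov l ..
        show ?thesis
        proof
          assume *: "\<forall>g. assignment MV g \<longrightarrow> C0 (override_on e g E)"
          show "C e (vv e j0)"
            unfolding C_def
          proof
            fix \<epsilon>
            define g :: "vvs_sort \<times> nat \<Rightarrow> ('k, 'v, 'g) elem" where "g = (\<lambda>(s, i). case s of SK \<Rightarrow> InK (\<epsilon> (i - 3 * N)) | SV \<Rightarrow> InV 0 | SG \<Rightarrow> InG (top :: 'g))"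
            have "assignment MV g" by (auto simp: g_def assignment_def split: vvs_sort.split)
            moreover have "(\<lambda>i. kk g (i + 3 * N)) = \<epsilon>" by (simp add: g_def)
            ultimately show "val (vv e j0 + lin e \<epsilon>) = min (gg e (2 * N)) (val (w e + lin e \<epsilon>))"
              using * C0[of g] by simp
          qed
        qed (simp add: C0 C_def)
      qed
      have "definable LV MV (\<lambda>e. \<exists>a\<in>univ MV SV. C (e((SV, j0) := a)) (vv (e((SV, j0) := a)) j0) \<and> P (e((SV, j0) := a)))"
        using definable_ex[OF definable_and[OF def[unfolded iff] P], of SV j0] .
      then show ?thesis
        by (rule definable_cong) (simp add: P'_def C_def j0_upd)
    qed
    show "depends_on MV F' P'"
      unfolding depends_on_def
    proof (intro allI impI)
      fix e e' :: "vvs_sort \<times> nat \<Rightarrow> ('k, 'v, 'g) elem"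
      assume e: "assignment MV e" "assignment MV e'" and agree: "\<forall>v\<in>F'. e v = e' v"
      have 1: "e (SV, i) = e' (SV, i)" "e (SV, cp i) = e' (SV, cp i)" "e (SK, i + 2 * N) = e' (SK, i + 2 * N)" if "i \<in> J" for i
        using that agree by (auto simp: F'_def J_def cp_def)
      have "lin e = lin e'" "w e = w e'"
        unfolding lin_def w_def using 1 by (auto intro!: sum.cong)
      moreover have "gg e (2 * N) = gg e' (2 * N)" using agree by (simp add: F'_def)
      ultimately have "C e x = C e' x" for x by (simp add: C_def)
      moreover have "P (e((SV, j0) := InV x)) = P (e'((SV, j0) := InV x))" for x
        by (rule F(2)[unfolded depends_on_def, rule_format])
          (use e agree in \<open>auto simp: assignment_upd F'_def\<close>)
      ultimately show "P' e = P' e'" by (simp add: P'_def)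
    qed
    have fin: "finite {j. (SV, j) \<in> F - X}" by (rule finite_subset[of _ "insert j0 J"]) (use FV finJ in auto)
    \<comment> \<open>The copies belong to the points and the new parameters have sorts
      \<open>SK\<close> and \<open>SG\<close>, so no new vector parameter arises while
      \<open>j0\<close> disappears.\<close>
    have "{j. (SV, j) \<in> F' - X'} \<subseteq> {j. (SV, j) \<in> F - X} - {j0}"
      using N by (auto simp: F'_def X'_def)
    then have "card {j. (SV, j) \<in> F' - X'} \<le> card ({j. (SV, j) \<in> F - X} - {j0})"
      by (rule card_mono[rotated]) (use fin in simp)
    also have "\<dots> < card {j. (SV, j) \<in> F - X}" by (rule card_Diff1_less[OF fin]) (use j0 in simp)
    finally show "card {j. (SV, j) \<in> F' - X'} < card {j. (SV, j) \<in> F - X}" .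
    define h where "h a l = (\<lambda>(s, i). if i < N then a (s, i) else l (s, i - N))"
      for a l :: "vvs_sort \<times> nat \<Rightarrow> ('k, 'v, 'g) elem"
    assume "poly_growth ?A ?A (\<lambda>a b. P' (merge X' a b))"
    then show "poly_growth ?A ?A (\<lambda>a b. P (merge X a b))"
    proof (rule poly_growth_choose[where h = h])
      show "h a l \<in> ?A" if "a \<in> ?A" "l \<in> ?A" for a l
        using that by (auto simp: h_def assignment_def)
      fix S b assume S: "finite S" "S \<noteq> {}" "S \<subseteq> ?A" and b: "b \<in> ?A"
      let ?e = "\<lambda>a. merge X a b"
      define x0 where "x0 = vv b j0"
      have "\<exists>c. \<forall>\<epsilon>. val (x0 + lin (?e a) \<epsilon>) \<le> val (x0 + lin (?e a) c)" for a
      proof -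
        obtain y where y: "y \<in> span (vv (?e a) ` J)"
          "\<And>z. z \<in> span (vv (?e a) ` J) \<Longrightarrow> val (x0 + z) \<le> val (x0 + y)"
          using best_approximation[OF finite_imageI[OF finJ]] by metis
        have sp: "z \<in> span (vv (?e a) ` J) \<longleftrightarrow> (\<exists>c. z = lin (?e a) c)" for z
          unfolding lin_def by (rule in_span_image_iff[OF finJ])
        obtain c where "y = lin (?e a) c" using y(1) sp by blast
        then show ?thesis using y(2) sp by blast
      qed
      then obtain c where c: "\<And>a \<epsilon>. val (x0 + lin (?e a) \<epsilon>) \<le> val (x0 + lin (?e a) (c a))" by metis
      define m where "m a = val (x0 + lin (?e a) (c a))" for a
      have "Max (m ` S) \<in> m ` S" using S by (intro Max_in) auto
      then obtain l where l: "l \<in> S" "Max (m ` S) = m l" by blast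
      have max: "val (x0 + lin (?e a) \<epsilon>) \<le> m l" if "a \<in> S" for a \<epsilon>
      proof -
        have "val (x0 + lin (?e a) \<epsilon>) \<le> m a" using c by (simp add: m_def)
        also have "\<dots> \<le> m l" unfolding l(2)[symmetric] by (rule Max_ge) (use S that in auto)
        finally show ?thesis .
      qed
      \<comment> \<open>The value of \<open>x0 + lin\<close> is maximised, hence the approximating
        vector \<open>w\<close> is the negative of \<open>lin\<close> and has the coordinates
        \<open>- c l\<close>.\<close>
      define b' where "b' = (\<lambda>(s, i). if i < N then b (s, i)
        else case s of SK \<Rightarrow> InK (- c l (i - 2 * N)) | SV \<Rightarrow> InV 0 | SG \<Rightarrow> InG (m l))"
      have b': "b' \<in> ?A" using b by (auto simp: b'_def assignment_def split: vvs_sort.split)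
      have "P (?e a) = P' (merge X' (h a l) b')" if a: "a \<in> S" for a
      proof -
        let ?e' = "merge X' (h a l) b'"
        have asg: "assignment MV (?e a)" "assignment MV ?e'"
          using a b b' S(3) l(1) by (auto simp: h_def assignment_def merge_def)
        have low: "?e' (s, i) = ?e a (s, i)" if "i < N" for s i
          using that by (simp add: merge_def X'_def h_def b'_def)
        have lin': "lin ?e' = lin (?e a)"
          unfolding lin_def by (intro ext sum.cong) (simp_all add: low J_less)
        have "vv ?e' (cp i) = vv (?e l) i" "kk ?e' (i + 2 * N) = - c l i" if "i \<in> J" for i
          using J_less[OF that] by (auto simp: merge_def X'_def h_def b'_def cp_def)
        then have w': "w ?e' = - lin (?e l) (c l)"
          by (simp add: w_def lin_def sum_negf)
        have g': "gg ?e' (2 * N) = m l"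
          using N[OF j0(1)] by (simp add: merge_def X'_def b'_def)
        have C: "C ?e' x \<longleftrightarrow> (\<forall>\<epsilon>. val (x + lin (?e a) \<epsilon>) = min (m l) (val (- lin (?e l) (c l) + lin (?e a) \<epsilon>)))" for x
          unfolding C_def lin' w' g' ..
        have C0: "C ?e' x0"
          unfolding C by (intro allI val_translate_eq_min max a) (simp add: m_def)
        have upd: "assignment MV (?e'((SV, j0) := InV y))" for y by (rule assignment_upd[OF asg(2)]) simp
        have "P (?e a) = P (?e'((SV, j0) := InV x0))"
        proof (rule F(2)[unfolded depends_on_def, rule_format, OF asg(1) upd])
          fix v assume "v \<in> F"
          then show "?e a v = (?e'((SV, j0) := InV x0)) v"
            using N low j0(2) assignmentD(2)[of b j0] b by (cases v) (auto simp: merge_def[of X] x0_def)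
        qed
        \<comment> \<open>Any \<open>x\<close> with \<open>C\<close> has the same values as
          \<open>x0\<close> after adding elements of the span. A combination with nonzero
          coefficient at \<open>j0\<close> rescales to this case, so the two tuples are
          isometric.\<close>
        moreover have "P (?e'((SV, j0) := InV x)) = P (?e'((SV, j0) := InV x0))" if x: "C ?e' x" for x
        proof (rule isometric_equivalent[OF P F upd upd refl])
          fix d
          have j0J: "j0 \<notin> J" by (simp add: J_def)
          have "(\<Sum>i\<in>J. scale (d i) (vv (?e'((SV, j0) := InV y)) i)) = lin (?e a) d" for y
            unfolding lin'[symmetric] lin_def using j0J by (intro sum.cong) auto
          then have sum: "(\<Sum>i\<in>insert j0 J. scale (d i) (vv (?e'((SV, j0) := InV y)) i)) = scale (d j0) y + lin (?e a) d" for y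
            using finJ j0J by simp
          show "val (\<Sum>i\<in>{i. (SV, i) \<in> F}. scale (d i) (vv (?e'((SV, j0) := InV x)) i)) =
            val (\<Sum>i\<in>{i. (SV, i) \<in> F}. scale (d i) (vv (?e'((SV, j0) := InV x0)) i))"
            unfolding FV sum
          proof (cases "d j0 = 0")
            case False
            have "scale (d j0) y + lin (?e a) d = scale (d j0) (y + lin (?e a) (\<lambda>i. d i / d j0))" for y
              using False by (simp add: lin_def scale_right_distrib scale_sum_right)
            then have "val (scale (d j0) y + lin (?e a) d) = val (y + lin (?e a) (\<lambda>i. d i / d j0))" for y
              using False by (simp add: val_scale)
            then show "val (scale (d j0) x + lin (?e a) d) = val (scale (d j0) x0 + lin (?e a) d)"
              using x C0 unfolding C by simp
          qed simp
        qed auto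
        ultimately show ?thesis using C0 unfolding P'_def by blast
      qed
      then show "\<exists>l\<in>S. \<exists>b'\<in>?A. \<forall>a\<in>S. P (?e a) = P' (merge X' (h a l) b')" using l(1) b' by blast
    qed
  qed
qed

text \<open>Induction on the number of vector variables of the support on the side of the
  parameters. The predicate, its support and \<open>X\<close> all vary, since each elimination
  introduces new variables.\<close>

lemma poly_growth_definable:
  assumes "NIP LK MK" "NIP LG MG" "definable LV MV P" "finite F" "depends_on MV F P"
  shows "poly_growth (Collect (assignment MV)) (Collect (assignment MV)) (\<lambda>a b. P (merge X a b))"
  using assms(3-5)
proof (induction "card {j. (SV, j) \<in> F - X}" arbitrary: P F X rule: less_induct)
  case less
  show ?case
  proof (cases "\<exists>j. (SV, j) \<in> F - X")
    case True
    then obtain j where "(SV, j) \<in> F" "(SV, j) \<notin> X" by blast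
    from less.prems this show ?thesis
    proof (rule eliminate_vector_parameter)
      fix P' F' X'
      assume "definable LV MV P'" "finite F'" "depends_on MV F' P'"
        and "card {j. (SV, j) \<in> F' - X'} < card {j. (SV, j) \<in> F - X}"
        and *: "poly_growth (Collect (assignment MV)) (Collect (assignment MV)) (\<lambda>a b. P' (merge X' a b)) \<Longrightarrow>
          poly_growth (Collect (assignment MV)) (Collect (assignment MV)) (\<lambda>a b. P (merge X a b))"
      then show ?thesis by (intro *) (rule less.hyps[of F' X' P'])
    qed
  next
    case False
    then show ?thesis using poly_growth_no_vector_parameters[OF assms(1,2) less.prems] by blast
  qed
qed

lemma NIP_vvs:
  assumes "NIP LK MK" "NIP LG MG"
  shows "NIP LV MV"
  unfolding NIP_def
proof (intro allI impI)
  fix p X assume p: "wf_fm LV p"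
  obtain F where "finite F" "depends_on MV F (\<lambda>e. sat MV e p)"
    using definable_depends_on[OF definable_sat[OF p]] by blast
  then show "\<not> has_IP MV p X"
    by (intro poly_growth_not_IP poly_growth_definable[OF assms definable_sat[OF p]])
qed

section \<open>Interpreting the base field and the value set\<close>

lemma ex_assignment:
  obtains g where "assignment MV g" "kk g = c" "vv g = v"
proof
  let ?g = "\<lambda>(s, i). case s of SK \<Rightarrow> InK (c i) | SV \<Rightarrow> InV (v i) | SG \<Rightarrow> InG (top :: 'g)"
  show "assignment MV ?g" by (auto simp: assignment_def split: vvs_sort.split)
qed simp_all

lemma ex_assignment_iff:
  "(\<exists>g. assignment MV g \<and> R (kk g)) \<longleftrightarrow> (\<exists>c. R c)" "(\<forall>g. assignment MV g \<longrightarrow> R (kk g)) \<longleftrightarrow> (\<forall>c. R c)"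
  "(\<exists>g. assignment MV g \<and> R' (vv g)) \<longleftrightarrow> (\<exists>v. R' v)"
  by (rule iffI; (elim exE)?, metis ex_assignment)+

lemma definable_N:
  assumes "tm_definable LV MV SV (\<lambda>e. InV (f e))"
  shows "definable LV MV (\<lambda>e. f e \<in> N (gg e i))"
proof -
  have "definable LV MV (\<lambda>e. InV (f e) = (InV 0 :: ('k, 'v, 'g) elem) \<or> gg e i < val (f e))"
    by (intro definable_or definable_eq[OF assms tmV_0] definableV_less tmV_g tmV_val assms)
  then show ?thesis by (rule definable_cong) auto
qed

text \<open>The dimension condition is first-order for fixed \<open>n\<close>: some \<open>n\<close>
  vectors have residues that span and are independent. Field and vector variables with index below
  \<open>n\<close> carry the coefficients and these vectors; the vector variable \<open>n\<close>
  carries the element to be spanned.\<close>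

lemma definable_D: "definable LV MV (\<lambda>e. gg e i \<in> D scale val n)"
proof -
  define lin where "lin e = (\<Sum>l<n. scale (kk e l) (vv e l))" for e
  define EK where "EK = (\<lambda>l. (SK, l)) ` {..<n}"
  define EV where "EV = (\<lambda>l. (SV, l)) ` {..<n}"
  have fin: "finite EK" "finite EV" by (simp_all add: EK_def EV_def)
  have tm_lin: "tm_definable LV MV SV (\<lambda>e. InV (lin e))"
    unfolding lin_def by (rule tmV_lincomb[of "{..<n}" "\<lambda>l. l" "\<lambda>l. l"]) simp
  have ovK: "override_on e g EK (SV, l) = e (SV, l)" "override_on e g EK (SG, l) = e (SG, l)" for e g l
    by (auto simp: override_on_def EK_def)
  have lin_ov: "lin (override_on e g EK) = (\<Sum>l<n. scale (kk g l) (vv e l))" for e g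
    unfolding lin_def by (rule sum.cong) (auto simp: override_on_def EK_def)
  define S where "S e \<longleftrightarrow> (\<exists>c. vv e n + (\<Sum>l<n. scale (c l) (vv e l)) \<in> N (gg e i))" for e
  have "definable LV MV (\<lambda>e. \<exists>g. assignment MV g \<and>
      (\<lambda>e. vv e n + lin e \<in> N (gg e i)) (override_on e g EK))"
    by (intro definable_ex_override fin definable_N tmV_add tmV_v tm_lin)
  then have S: "definable LV MV S"
  proof (rule definable_cong)
    fix e
    show "S e \<longleftrightarrow> (\<exists>g. assignment MV g \<and> vv (override_on e g EK) n + lin (override_on e g EK) \<in> N (gg (override_on e g EK) i))"
      unfolding lin_ov ovK S_def
      by (rule ex_assignment_iff(1)[of "\<lambda>c. vv e n + (\<Sum>l<n. scale (c l) (vv e l)) \<in> N (gg e i)", symmetric])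
  qed
  define T where "T e \<longleftrightarrow> (\<forall>c. (\<Sum>l<n. scale (c l) (vv e l)) \<in> N (gg e i) \<longrightarrow> (\<forall>l\<in>{..<n}. c l = 0))" for e
  have "tm_definable LV MV SK (\<lambda>e. InK 0)"
    using tm_definable_fn[of LV KZero "[]" SK MV "[]"] by simp
  then have "definable LV MV (\<lambda>e. InK (kk e l) = (InK 0 :: ('k, 'v, 'g) elem))" for l by (rule definable_eq[OF tmV_k])
  then have z: "definable LV MV (\<lambda>e. kk e l = 0)" for l by simp
  have "definable LV MV (\<lambda>e. \<forall>g. assignment MV g \<longrightarrow>
      (\<lambda>e. lin e \<in> N (gg e i) \<longrightarrow> (\<forall>l\<in>{..<n}. kk e l = 0)) (override_on e g EK))"
    by (intro definable_all_override fin definable_imp definable_N tm_lin definable_ball z) simp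
  then have T: "definable LV MV T"
  proof (rule definable_cong)
    fix e
    have kk_ov: "(\<forall>l\<in>{..<n}. kk (override_on e g EK) l = 0) \<longleftrightarrow> (\<forall>l\<in>{..<n}. kk g l = 0)" for g
      by (rule ball_cong) (auto simp: override_on_def EK_def)
    show "T e \<longleftrightarrow> (\<forall>g. assignment MV g \<longrightarrow> lin (override_on e g EK) \<in> N (gg (override_on e g EK) i) \<longrightarrow>
        (\<forall>l\<in>{..<n}. kk (override_on e g EK) l = 0))"
      unfolding lin_ov ovK T_def kk_ov
      by (rule ex_assignment_iff(2)[of "\<lambda>c. (\<Sum>l<n. scale (c l) (vv e l)) \<in> N (gg e i) \<longrightarrow> (\<forall>l\<in>{..<n}. c l = 0)", symmetric])
  qed
  define U where "U e \<longleftrightarrow> (\<forall>l\<in>{..<n}. gg e i \<le> val (vv e l)) \<and>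
    (\<forall>a\<in>univ MV SV. gg (e((SV, n) := a)) i \<le> val (vv (e((SV, n) := a)) n) \<longrightarrow> S (e((SV, n) := a))) \<and> T e" for e
  have U: "definable LV MV U"
    unfolding U_def
    by (intro definable_and definable_ball T definableV_le tmV_g tmV_val tmV_v
        definable_all[of LV MV "\<lambda>e. gg e i \<le> val (vv e n) \<longrightarrow> S e"] definable_imp S) simp
  have U_iff: "U e \<longleftrightarrow> res_family (gg e i) {..<n} (vv e)" for e
  proof -
    have "S (e((SV, n) := InV x)) \<longleftrightarrow> (\<exists>c. x - (\<Sum>l<n. scale (c l) (vv e l)) \<in> N (gg e i))" for x
    proof -
      have "S (e((SV, n) := InV x)) \<longleftrightarrow> (\<exists>c. x + (\<Sum>l<n. scale (c l) (vv e l)) \<in> N (gg e i))"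
        by (simp add: S_def)
      \<comment> \<open>\<open>S\<close> is written with a sum because the language has addition of
        vectors but no subtraction; negating the coefficients leads to
        \<open>res_family\<close>.\<close>
      also have "\<dots> \<longleftrightarrow> (\<exists>c. x + (\<Sum>l<n. scale (- c l) (vv e l)) \<in> N (gg e i))"
      proof
        assume "\<exists>c. x + (\<Sum>l<n. scale (c l) (vv e l)) \<in> N (gg e i)"
        then obtain c where "x + (\<Sum>l<n. scale (c l) (vv e l)) \<in> N (gg e i)" by blast
        then show "\<exists>c. x + (\<Sum>l<n. scale (- c l) (vv e l)) \<in> N (gg e i)"
          by (intro exI[of _ "\<lambda>l. - c l"]) simp
      next
        assume "\<exists>c. x + (\<Sum>l<n. scale (- c l) (vv e l)) \<in> N (gg e i)"
        then obtain c where "x + (\<Sum>l<n. scale (- c l) (vv e l)) \<in> N (gg e i)" by blast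
        then show "\<exists>c. x + (\<Sum>l<n. scale (c l) (vv e l)) \<in> N (gg e i)" by (rule exI[of _ "\<lambda>l. - c l"])
      qed
      finally show ?thesis by (simp add: sum_negf)
    qed
    then show ?thesis unfolding U_def T_def res_family_def by auto
  qed
  have "definable LV MV (\<lambda>e. \<exists>g. assignment MV g \<and> U (override_on e g EV))"
    by (rule definable_ex_override[OF fin(2) U])
  then show ?thesis
  proof (rule definable_cong)
    fix e
    have "res_family \<gamma> {..<n} v \<longleftrightarrow> res_family \<gamma> {..<n} v'" if "\<And>l. l < n \<Longrightarrow> v l = v' l" for \<gamma> v v'
    proof -
      have "(\<Sum>l<n. scale (c l) (v l)) = (\<Sum>l<n. scale (c l) (v' l))" for c
        by (rule sum.cong) (use that in auto)
      then show ?thesis unfolding res_family_def using that by auto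
    qed
    from this[of "vv (override_on e g EV)" "vv g" for g]
    have "U (override_on e g EV) \<longleftrightarrow> res_family (gg e i) {..<n} (vv g)" for g
      unfolding U_iff by (auto simp: override_on_def EV_def)
    then show "gg e i \<in> D scale val n \<longleftrightarrow> (\<exists>g. assignment MV g \<and> U (override_on e g EV))"
      unfolding D_iff by (simp only: ex_assignment_iff(3)[of "res_family (gg e i) {..<n}"])
  qed
qed

lemma NIP_base_field:
  assumes "NIP LV MV"
  shows "NIP LK MK"
proof -
  obtain e0 where "assignment MV e0" using ex_assignment .
  have tm: "tm_sort LK t s \<Longrightarrow> tm_definable LV MV SK (\<lambda>e. InK (eval_tm MK (\<lambda>v. the_K (e (SK, snd v))) t))" for t s
  proof (induction rule: tm_sort.induct)
    case (1 s i)
    then show ?case by (simp add: tmV_k)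
  next
    case (2 f ss s ts)
    let ?ev = "\<lambda>e. eval_tm MK (\<lambda>v. the_K (e (SK, snd v)))"
    have sig: "field_sig f = (ss, s)" and ts: "list_all2 (\<lambda>t s. tm_definable LV MV SK (\<lambda>e. InK (?ev e t))) ts ss"
      using 2 by (auto elim: list_all2_mono)
    show ?case
    proof (cases f)
      case FAdd
      then obtain a b where "ts = [a, b]" "tm_definable LV MV SK (\<lambda>e. InK (?ev e a))" "tm_definable LV MV SK (\<lambda>e. InK (?ev e b))"
        using sig ts by (auto simp: list_all2_Cons2)
      then show ?thesis using tm_definable_fn[of LV KAdd "[SK, SK]" SK MV "[\<lambda>e. InK (?ev e a), \<lambda>e. InK (?ev e b)]"]
        by (simp add: FAdd)
    next
      case FMul
      then obtain a b where "ts = [a, b]" "tm_definable LV MV SK (\<lambda>e. InK (?ev e a))" "tm_definable LV MV SK (\<lambda>e. InK (?ev e b))"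
        using sig ts by (auto simp: list_all2_Cons2)
      then show ?thesis using tm_definable_fn[of LV KMul "[SK, SK]" SK MV "[\<lambda>e. InK (?ev e a), \<lambda>e. InK (?ev e b)]"]
        by (simp add: FMul)
    next
      case FZero
      then show ?thesis using tm_definable_fn[of LV KZero "[]" SK MV "[]"] by simp
    next
      case FOne
      then show ?thesis using tm_definable_fn[of LV KOne "[]" SK MV "[]"] by simp
    qed
  qed
  show ?thesis
  proof (rule NIP_interpretation[OF assms, of SK InK the_K, OF _ _ _ \<open>assignment MV e0\<close> tm])
    fix r ts assume "wf_fm LK (Rel r ts)"
    then obtain m where m: "arK r = Some m" and ts: "list_all2 (tm_sort LK) ts (replicate m ())" by auto
    let ?fs = "map (\<lambda>t e. InK (eval_tm MK (\<lambda>v. the_K (e (SK, snd v))) t)) ts"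
    have "list_all2 (tm_definable LV MV) (replicate m SK) ?fs"
      using ts tm by (auto simp: list_all2_conv_all_nth)
    from definable_rel[of LV "ExtraK r", OF _ this] m
    show "definable LV MV (\<lambda>e. sat MK (\<lambda>v. the_K (e (SK, snd v))) (Rel r ts))"
      by (simp add: comp_def)
  qed simp_all
qed

text \<open>The order and the additional relations are symbols of the three-sorted language, and
  terms are just variables or \<open>top\<close>; only the dimension predicates require a
  formula.\<close>

lemma NIP_value_set:
  assumes "NIP LV MV"
  shows "NIP LG MG"
proof -
  obtain e0 where "assignment MV e0" using ex_assignment .
  let ?ev = "\<lambda>e :: vvs_sort \<times> nat \<Rightarrow> ('k, 'v, 'g) elem. eval_tm MG (\<lambda>v. the_G (e (SG, snd v)))"
  have var: "(\<exists>i. \<forall>e. ?ev e t = gg e i) \<or> (\<forall>e. ?ev e t = top)" if "tm_sort LG t s" for t s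
    using that by (cases rule: tm_sort.cases) auto
  have tm_top: "tm_definable LV MV SG (\<lambda>e. InG top)"
    using tm_definable_fn[of LV Inf "[]" SG MV "[]"] by simp
  have tm: "tm_definable LV MV SG (\<lambda>e. InG (?ev e t))" if "tm_sort LG t s" for t s
    using var[OF that]
  proof
    assume "\<exists>i. \<forall>e. ?ev e t = gg e i"
    then obtain i where "\<forall>e. ?ev e t = gg e i" by blast
    then show ?thesis by (intro tm_definable_cong[OF tmV_g[of i]]) simp
  next
    assume "\<forall>e. ?ev e t = top"
    then show ?thesis by (intro tm_definable_cong[OF tm_top]) simp
  qed
  show ?thesis
  proof (rule NIP_interpretation[OF assms, of SG InG the_G, OF _ _ _ \<open>assignment MV e0\<close> tm])
    fix r :: "'rg value_rel" and ts assume "wf_fm LG (Rel r ts)"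
    then obtain ss where ss: "value_rel_sig arG r = Some ss" "list_all2 (tm_sort LG) ts ss" by auto
    show "definable LV MV (\<lambda>e. sat MG (\<lambda>v. the_G (e (SG, snd v))) (Rel r ts))"
    proof (cases r)
      case GLess
      then obtain a b where ab: "ts = [a, b]" "tm_sort LG a ()" "tm_sort LG b ()"
        using ss by (auto simp: list_all2_Cons2)
      then show ?thesis using GLess by (simp add: definableV_less[OF tm tm])
    next
      case (GDim n)
      then obtain a where a: "ts = [a]" "tm_sort LG a ()" using ss by (auto simp: list_all2_Cons2)
      \<comment> \<open>\<open>definable_D\<close> concerns a variable; at the constant
        \<open>top\<close> the predicate has a fixed truth value.\<close>
      show ?thesis using var[OF a(2)] GDim a(1) by (auto simp: definable_D definable_const)
    next
      case (GExtra q)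
      then obtain m where m: "arG q = Some m" and ts: "list_all2 (tm_sort LG) ts (replicate m ())"
        using ss by auto
      let ?fs = "map (\<lambda>t e. InG (?ev e t)) ts"
      have "list_all2 (tm_definable LV MV) (replicate m SG) ?fs"
        using ts tm by (auto simp: list_all2_conv_all_nth)
      from definable_rel[of LV "ExtraG q", OF _ this] m
      show ?thesis by (simp add: comp_def GExtra)
    qed
  qed simp_all
qed

end

theorem proposition3p15:
  fixes scale :: "'k::field \<Rightarrow> 'v::ab_group_add \<Rightarrow> 'v"
    and val :: "'v \<Rightarrow> 'g::{linorder, order_top}"
    and arK :: "'rk \<Rightarrow> nat option" and RK :: "'rk \<Rightarrow> 'k list \<Rightarrow> bool"
    and arG :: "'rg \<Rightarrow> nat option" and RG :: "'rg \<Rightarrow> 'g list \<Rightarrow> bool"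
  assumes "valued_vector_space scale val"
  shows "NIP (vvs_lang arK arG) (vvs_struct scale val RK RG) \<longleftrightarrow>
    NIP (field_lang arK) (field_struct RK) \<and> NIP (value_lang arG) (value_struct scale val RG)"
proof -
  interpret vvs_structure scale val arK RK arG RG
    using assms by (rule vvs_structure.intro)
  show ?thesis using NIP_vvs NIP_base_field NIP_value_set by blast
qed

end
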